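(* Assume that $\psi_E$ has conductor $\mathfrak{o}_E$. Let $(\pi,V)$ be an irreducible generic representation of $G$ whose conductor $N_\pi$ is positive. For the newform $v$ in $V(N_\pi)$ which satisfies $W_v(e)=1$, we have \[ Z(s,W_v,\Phi_{N_\pi})=\frac{1}{1-(\nu+q^2-q^3)q^{-2}q^{-2s}-(\nu+q^2-\lambda)q^{-1}q^{-4s}}, \] where $\nu$ is the eigenvalue of the Hecke operator $T$ on $V(N_\pi+1)$ and $\lambda$ is that of the operator $\delta\theta'$ on $V(N_\pi)$.
   Context: Let $F$ be a non-archimedean local field of characteristic zero with odd residual characteristic, ring of integers $\mathfrak{o}_F$, maximal ideal $\mathfrak{p}_F$, uniformizer $\varpi$, residue field of cardinality $q$. Let $E=F[\sqrt{\epsilon}]$ ($\epsilon\in\mathfrak{o}_F^\times$ a non-square) be the unramified quadratic extension, with ring of integers $\mathfrak{o}_E$, maximal ideal $\mathfrak{p}_E$ and non-trivial Galois automorphism $x\mapsto\overline{x}$. Absolute values: $|\varpi|_F=q^{-1}$, $|\varpi|_E=q^{-2}$. $E^1$ is the group of norm-one elements of $E^\times$. Group: $G=\{g\in \mathrm{GL}_3(E) : {}^t\overline{g}Jg=J\}$, where $J$ is the $3\times3$ antidiagonal matrix with entries $1$; $e$ is its identity element. $U$ is the group of $u(x,y)=\begin{pmatrix}1&x&y\sqrt{\epsilon}-x\overline{x}/2\\0&1&-\overline{x}\\0&0&1\end{pmatrix}$, $x\in E$, $y\in F$. A non-trivial additive character $\psi_E$ of $E$ defines the character $\psi_E(u(x,y))=\psi_E(x)$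 of $U$; its conductor is the largest fractional ideal on which $\psi_E$ is trivial. A smooth representation $(\pi,V)$ is generic if $\mathrm{Hom}_U(\pi,\psi_E)\neq\{0\}$. For $\pi$ irreducible generic, fix a non-zero $l\in \mathrm{Hom}_U(\pi,\psi_E)$ and put $W_v(g)=l(\pi(g)v)$ for $v\in V$, $g\in G$. Newforms: for $n\ge 0$ let $K_n=\begin{pmatrix}\mathfrak{o}_E&\mathfrak{o}_E&\mathfrak{p}_E^{-n}\\ \mathfrak{p}_E^n&1+\mathfrak{p}_E^n&\mathfrak{o}_E\\ \mathfrak{p}_E^n&\mathfrak{p}_E^n&\mathfrak{o}_E\end{pmatrix}\cap G$ and $V(n)=V^{K_n}$. The conductor is $N_\pi=\min\{n\ge0: V(n)\neq\{0\}\}$ (known to exist); elements of $V(N_\pi)$ are newforms. It is known that $\dim V(N_\pi)=1$ and, if $\psi_E$ has conductor $\mathfrak{o}_E$, that $W_v(e)\neq0$ for non-zero $v\in V(N_\pi)$. Operators: write $N=N_\pi>0$; it is known that $V(N+1)$ is one-dimensional. Let $\zeta=\mathrm{diag}(\varpi,1,\varpi^{-1})$. The level raising operator $\theta':V(N)\to V(N+1)$ is $\theta'v=\pi(\zeta^{-1})v+\sum_{x\in\mathfrak{p}_F^{-1-N}/\mathfrak{p}_F^{-N}}\pi(u(0,x))v$. The Hecke operator $T$ on $V(N+1)$ is $Tw=\frac{1}{\mathrm{vol}(K_{N+1})}\int_{K_{N+1}\zeta K_{N+1}}\pi(g)w\,dg=\sum_{k\in K_{N+1}/(K_{N+1}\cap\zeta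 K_{N+1}\zeta^{-1})}\pi(k\zeta)w$; $\nu\in\mathbf{C}$ is defined by $Tw=\nu w$ for $w\in V(N+1)$. Identify the center $Z$ of $G$ with $E^1$ and let $Z_N=Z\cap(1+\mathfrak{p}_E^N)=Z\cap K_N$; the central character of $\pi$ is trivial on $Z_N$, so $Z_NK_{N+1}$ acts trivially on $V(N+1)$. The level lowering operator $\delta:V(N+1)\to V(N)$ is $\delta w=\sum_{k\in K_N/(K_N\cap(Z_NK_{N+1}))}\pi(k)w$; $\lambda\in\mathbf{C}$ is defined by $\delta\theta'v=\lambda v$ for $v\in V(N)$. Zeta integrals: let $H=\left\{\begin{pmatrix}a&0&b\\0&1&0\\c&0&d\end{pmatrix}\in G\right\}$, identified with $\mathrm{U}(1,1)\subset\mathrm{GL}_2(E)$ via $\begin{pmatrix}a&b\\c&d\end{pmatrix}$, and $U_H=U\cap H$. In $\mathrm{GL}_2(E)$ put $t(a)=\mathrm{diag}(a,\overline{a}^{-1})$, $d(a)=\mathrm{diag}(a,1)$. For a locally constant compactly supported function $\Phi$ on $F^2$ and $g\in\mathrm{GL}_2(F)$ put $z(s,g,\Phi)=\int_{F^\times}\Phi((0,r)g)|r|_E^s\,d^\times r$ with $\mathrm{vol}(\mathfrak{o}_F^\times)=1$. Every $h\in H$ can be written $h=t(b)d(\sqrt\epsilon)h_1d(\sqrt\epsilon^{-1})$ with $b\in E^\times$, $h_1\in\mathrm{SL}_2(F)$, and $f(s,h,\Phi)=|b|_E^s z(s,h_1,\Phi)$ is independent of this choice. For $W=W_v$ with $v\in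 V$ put $Z(s,W,\Phi)=\int_{U_H\backslash H}W(h)f(s,h,\Phi)\,dh$, which converges absolutely for $\mathrm{Re}(s)$ large to an element of $\mathbf{C}(q^{-2s})$; $dh$ is the Haar (right $H$-invariant) measure on $U_H\backslash H$ normalized so that $U_H\backslash U_H(H\cap \mathrm{GL}_2(\mathfrak{o}_E))$ has volume one. For an integer $n$, $\Phi_n$ is the characteristic function of $\mathfrak{p}_F^n\oplus\mathfrak{o}_F$.
   Formalization: The measure dh on U_H\H is normalized so that U_H\U_H(H ∩ K_{N_π}) has volume one, instead of U_H\U_H(H ∩ GL_2(o_E)); with the latter, the zeta integral would equal q^{-N_π} times the displayed right-hand side. *)

theory Defs
  imports "HOL-Analysis.Analysis" "HOL-Computational_Algebra.Polynomial"
begin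

section \<open>Non-archimedean local fields\<close>

text \<open>The library reserves \<open>norm\<close> for real normed spaces, so the absolute value is a
  class parameter of its own; it induces the metric, hence the topology, of the field.\<close>

class nonarch_valued_field = field_char_0 + metric_space +
  fixes vabs :: "'a \<Rightarrow> real"
  assumes dist_vabs: "dist x y = vabs (x - y)"
    and vabs_mult: "vabs (x * y) = vabs x * vabs y"
    and vabs_add_le_max: "vabs (x + y) \<le> max (vabs x) (vabs y)"

definition (in nonarch_valued_field) ring_of_integers :: "'a set" where
  "ring_of_integers = {x. vabs x \<le> 1}"

text \<open>The residue field, as the set of cosets of the maximal ideal in the ring of integers.\<close>

definition (in nonarch_valued_field) residue_field :: "'a set set" where
  "residue_field = (\<lambda>x. {y. vabs (y - x) < 1}) ` ring_of_integers"

text \<open>The absolute value of a local field is normalised: its value group is generated by the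
  cardinality of the residue field.\<close>

class nonarch_local_field = nonarch_valued_field + complete_space +
  assumes finite_residue_field: "finite (residue_field :: 'a set set)"
    and value_group:
      "vabs ` (UNIV - {0 :: 'a}) = range (\<lambda>n::int. real (card (residue_field :: 'a set set)) powi n)"

definition residue_card :: "'a::nonarch_local_field itself \<Rightarrow> nat" where
  "residue_card _ = card (residue_field :: 'a set set)"

definition residual_char :: "'a::nonarch_local_field itself \<Rightarrow> nat" where
  "residual_char _ = (LEAST p. p > 0 \<and> vabs (of_nat p :: 'a) < 1)"

definition frac_ideal :: "'a \<Rightarrow> int \<Rightarrow> 'a::nonarch_local_field set" where
  "frac_ideal w n = (\<lambda>x. w powi n * x) ` ring_of_integers"


section \<open>The unramified quadratic extension\<close>

text \<open>\<open>E\<close> is a type \<open>'e\<close> with an embedding of \<open>F\<close> (the type \<open>'f\<close>); the record collects this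
  embedding, \<open>\<epsilon>\<close>, its chosen square root in \<open>E\<close>, and the uniformizer of \<open>F\<close>.\<close>

record ('f, 'e) quad_ext =
  emb :: "'f \<Rightarrow> 'e"
  eps :: 'f
  sqrt_eps :: 'e
  unif :: 'f

definition unramified_quadratic ::
    "('f::nonarch_local_field, 'e::nonarch_local_field) quad_ext \<Rightarrow> bool" where
  "unramified_quadratic E \<longleftrightarrow>
     emb E 1 = 1 \<and>
     (\<forall>x y. emb E (x + y) = emb E x + emb E y) \<and>
     (\<forall>x y. emb E (x * y) = emb E x * emb E y) \<and>
     vabs (eps E) = 1 \<and> \<not> (\<exists>x. x\<^sup>2 = eps E) \<and>
     (sqrt_eps E)\<^sup>2 = emb E (eps E) \<and>
     (\<forall>z. \<exists>a b. z = emb E a + emb E b * sqrt_eps E) \<and>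
     (\<forall>x. vabs (emb E x) = (vabs x)\<^sup>2) \<and>
     vabs (unif E) = 1 / real (residue_card TYPE('f))"

definition unifE :: "('f, 'e) quad_ext \<Rightarrow> 'e" where
  "unifE E = emb E (unif E)"

definition conjE :: "('f, 'e::field) quad_ext \<Rightarrow> 'e \<Rightarrow> 'e" where
  "conjE E z = (THE w. \<exists>a b. z = emb E a + emb E b * sqrt_eps E \<and>
                             w = emb E a - emb E b * sqrt_eps E)"

text \<open>Since \<open>E/F\<close> is unramified, a uniformizer of \<open>F\<close> is also one of \<open>E\<close>.\<close>

abbreviation idealF :: "('f::nonarch_local_field, 'e) quad_ext \<Rightarrow> int \<Rightarrow> 'f set" where
  "idealF E n \<equiv> frac_ideal (unif E) n"

abbreviation idealE :: "('f, 'e::nonarch_local_field) quad_ext \<Rightarrow> int \<Rightarrow> 'e set" where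
  "idealE E n \<equiv> frac_ideal (unifE E) n"


section \<open>The unitary group and its subgroups\<close>

definition matJ :: "'e::field^3^3" where
  "matJ = vector [vector [0, 0, 1], vector [0, 1, 0], vector [1, 0, 0]]"

definition unitary_group :: "('f, 'e::field) quad_ext \<Rightarrow> ('e^3^3) set" where
  "unitary_group E = {g. invertible g \<and> transpose (\<chi> i j. conjE E (g $ i $ j)) ** matJ ** g = matJ}"

definition umat :: "('f, 'e::field) quad_ext \<Rightarrow> 'e \<Rightarrow> 'f \<Rightarrow> 'e^3^3" where
  "umat E x y = vector [vector [1, x, emb E y * sqrt_eps E - x * conjE E x / 2],
                        vector [0, 1, - conjE E x],
                        vector [0, 0, 1]]"

definition zeta_mat :: "('f, 'e::field) quad_ext \<Rightarrow> 'e^3^3" where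
  "zeta_mat E = vector [vector [unifE E, 0, 0],
                        vector [0, 1, 0],
                        vector [0, 0, inverse (unifE E)]]"

definition Kgrp :: "('f, 'e::nonarch_local_field) quad_ext \<Rightarrow> nat \<Rightarrow> ('e^3^3) set" where
  "Kgrp E n = {g \<in> unitary_group E.
     g$1$1 \<in> ring_of_integers \<and> g$1$2 \<in> ring_of_integers \<and> g$1$3 \<in> idealE E (- int n) \<and>
     g$2$1 \<in> idealE E (int n) \<and> g$2$2 - 1 \<in> idealE E (int n) \<and> g$2$3 \<in> ring_of_integers \<and>
     g$3$1 \<in> idealE E (int n) \<and> g$3$2 \<in> idealE E (int n) \<and> g$3$3 \<in> ring_of_integers}"

definition centre :: "('f, 'e::field) quad_ext \<Rightarrow> ('e^3^3) set" where
  "centre E = {z \<in> unitary_group E. \<forall>g \<in> unitary_group E. z ** g = g ** z}"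

definition Zsub :: "('f, 'e::nonarch_local_field) quad_ext \<Rightarrow> nat \<Rightarrow> ('e^3^3) set" where
  "Zsub E n = centre E \<inter> Kgrp E n"


section \<open>Additive characters and representations\<close>

definition additive_character :: "('a::nonarch_local_field \<Rightarrow> complex) \<Rightarrow> bool" where
  "additive_character \<psi> \<longleftrightarrow> continuous_on UNIV \<psi> \<and>
     (\<forall>x. cmod (\<psi> x) = 1) \<and> (\<forall>x y. \<psi> (x + y) = \<psi> x * \<psi> y)"

definition has_conductor ::
    "('f, 'e::nonarch_local_field) quad_ext \<Rightarrow> ('e \<Rightarrow> complex) \<Rightarrow> 'e set \<Rightarrow> bool" where
  "has_conductor E \<psi> I \<longleftrightarrow>
     I \<in> range (idealE E) \<and> (\<forall>x\<in>I. \<psi> x = 1) \<and>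
     (\<forall>I' \<in> range (idealE E). (\<forall>x\<in>I'. \<psi> x = 1) \<longrightarrow> I' \<subseteq> I)"

text \<open>The representation space is the whole type \<open>'v\<close>, with complex scalar multiplication
  \<open>sc\<close>.\<close>

definition smooth_rep ::
    "('f, 'e::nonarch_local_field) quad_ext \<Rightarrow> (complex \<Rightarrow> 'v::ab_group_add \<Rightarrow> 'v) \<Rightarrow>
     ('e^3^3 \<Rightarrow> 'v \<Rightarrow> 'v) \<Rightarrow> bool" where
  "smooth_rep E sc \<pi> \<longleftrightarrow>
     vector_space sc \<and>
     (\<forall>g \<in> unitary_group E. Vector_Spaces.linear sc sc (\<pi> g)) \<and>
     (\<forall>v. \<pi> (mat 1) v = v) \<and>
     (\<forall>g \<in> unitary_group E. \<forall>h \<in> unitary_group E. \<forall>v. \<pi> (g ** h) v = \<pi> g (\<pi> h v)) \<and>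
     (\<forall>v. openin (top_of_set (unitary_group E)) {g \<in> unitary_group E. \<pi> g v = v})"

definition irreducible_rep ::
    "('f, 'e::nonarch_local_field) quad_ext \<Rightarrow> (complex \<Rightarrow> 'v::ab_group_add \<Rightarrow> 'v) \<Rightarrow>
     ('e^3^3 \<Rightarrow> 'v \<Rightarrow> 'v) \<Rightarrow> bool" where
  "irreducible_rep E sc \<pi> \<longleftrightarrow>
     (UNIV :: 'v set) \<noteq> {0} \<and>
     (\<forall>S. module.subspace sc S \<and> (\<forall>g \<in> unitary_group E. \<pi> g ` S \<subseteq> S) \<longrightarrow> S = {0} \<or> S = UNIV)"

definition Hom_U ::
    "('f, 'e::nonarch_local_field) quad_ext \<Rightarrow> (complex \<Rightarrow> 'v::ab_group_add \<Rightarrow> 'v) \<Rightarrow>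
     ('e^3^3 \<Rightarrow> 'v \<Rightarrow> 'v) \<Rightarrow> ('e \<Rightarrow> complex) \<Rightarrow> ('v \<Rightarrow> complex) set" where
  "Hom_U E sc \<pi> \<psi> = {l. Vector_Spaces.linear sc (*) l \<and>
                        (\<forall>x y v. l (\<pi> (umat E x y) v) = \<psi> x * l v)}"

definition generic_rep ::
    "('f, 'e::nonarch_local_field) quad_ext \<Rightarrow> (complex \<Rightarrow> 'v::ab_group_add \<Rightarrow> 'v) \<Rightarrow>
     ('e^3^3 \<Rightarrow> 'v \<Rightarrow> 'v) \<Rightarrow> ('e \<Rightarrow> complex) \<Rightarrow> bool" where
  "generic_rep E sc \<pi> \<psi> \<longleftrightarrow> Hom_U E sc \<pi> \<psi> \<noteq> {\<lambda>_. 0}"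

definition whittaker :: "('e^3^3 \<Rightarrow> 'v \<Rightarrow> 'v) \<Rightarrow> ('v \<Rightarrow> complex) \<Rightarrow> 'v \<Rightarrow> 'e^3^3 \<Rightarrow> complex" where
  "whittaker \<pi> l v g = l (\<pi> g v)"

definition Vfix ::
    "('f, 'e::nonarch_local_field) quad_ext \<Rightarrow> ('e^3^3 \<Rightarrow> 'v \<Rightarrow> 'v) \<Rightarrow> nat \<Rightarrow> 'v set" where
  "Vfix E \<pi> n = {v. \<forall>k \<in> Kgrp E n. \<pi> k v = v}"

definition rep_conductor ::
    "('f, 'e::nonarch_local_field) quad_ext \<Rightarrow> ('e^3^3 \<Rightarrow> 'v::ab_group_add \<Rightarrow> 'v) \<Rightarrow> nat" where
  "rep_conductor E \<pi> = (LEAST n. Vfix E \<pi> n \<noteq> {0})"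


section \<open>Level raising, Hecke and level lowering operators\<close>

text \<open>Sum over the left cosets of \<open>B\<close> in \<open>A\<close> (for the group operation \<open>m\<close>), evaluated at an
  arbitrary representative of each coset.\<close>

definition coset_sum ::
    "('a \<Rightarrow> 'a \<Rightarrow> 'a) \<Rightarrow> 'a set \<Rightarrow> 'a set \<Rightarrow> ('a \<Rightarrow> 'v::comm_monoid_add) \<Rightarrow> 'v" where
  "coset_sum m A B f = (\<Sum>X \<in> (\<lambda>a. m a ` B) ` A. f (SOME x. x \<in> X))"

definition theta' ::
    "('f::nonarch_local_field, 'e::nonarch_local_field) quad_ext \<Rightarrow>
     ('e^3^3 \<Rightarrow> 'v::ab_group_add \<Rightarrow> 'v) \<Rightarrow> nat \<Rightarrow> 'v \<Rightarrow> 'v" where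
  "theta' E \<pi> N v = \<pi> (matrix_inv (zeta_mat E)) v +
     coset_sum (+) (idealF E (- 1 - int N)) (idealF E (- int N)) (\<lambda>x. \<pi> (umat E 0 x) v)"

text \<open>The Hecke operator attached to the double coset of \<open>\<zeta>\<close>, at level \<open>n\<close>.\<close>

definition hecke_T ::
    "('f, 'e::nonarch_local_field) quad_ext \<Rightarrow>
     ('e^3^3 \<Rightarrow> 'v::ab_group_add \<Rightarrow> 'v) \<Rightarrow> nat \<Rightarrow> 'v \<Rightarrow> 'v" where
  "hecke_T E \<pi> n w =
     coset_sum (**) (Kgrp E n)
       (Kgrp E n \<inter> (\<lambda>k. zeta_mat E ** k ** matrix_inv (zeta_mat E)) ` Kgrp E n)
       (\<lambda>k. \<pi> (k ** zeta_mat E) w)"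

definition delta ::
    "('f, 'e::nonarch_local_field) quad_ext \<Rightarrow>
     ('e^3^3 \<Rightarrow> 'v::ab_group_add \<Rightarrow> 'v) \<Rightarrow> nat \<Rightarrow> 'v \<Rightarrow> 'v" where
  "delta E \<pi> N w =
     coset_sum (**) (Kgrp E N)
       (Kgrp E N \<inter> {z ** k | z k. z \<in> Zsub E N \<and> k \<in> Kgrp E (N + 1)})
       (\<lambda>k. \<pi> k w)"


section \<open>Zeta integrals\<close>

definition embH :: "'e::field^2^2 \<Rightarrow> 'e^3^3" where
  "embH m = vector [vector [m$1$1, 0, m$1$2], vector [0, 1, 0], vector [m$2$1, 0, m$2$2]]"

definition Hgrp :: "('f, 'e::field) quad_ext \<Rightarrow> ('e^3^3) set" where
  "Hgrp E = unitary_group E \<inter> range embH"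

definition UH :: "('f, 'e::field) quad_ext \<Rightarrow> ('e^3^3) set" where
  "UH E = {umat E x y | x y. True} \<inter> Hgrp E"

definition tmat :: "('f, 'e::field) quad_ext \<Rightarrow> 'e \<Rightarrow> 'e^2^2" where
  "tmat E a = vector [vector [a, 0], vector [0, inverse (conjE E a)]]"

definition dmat :: "'e::field \<Rightarrow> 'e^2^2" where
  "dmat a = vector [vector [a, 0], vector [0, 1]]"

definition haar_units :: "'f::nonarch_local_field measure \<Rightarrow> bool" where
  "haar_units M \<longleftrightarrow>
     sets M = sets (restrict_space borel (UNIV - {0})) \<and>
     (\<forall>a. a \<noteq> 0 \<longrightarrow> (\<forall>A \<in> sets M. emeasure M ((*) a ` A) = emeasure M A)) \<and>
     emeasure M {x. vabs x = 1} = 1"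

text \<open>The coset space of \<open>UH\<close> in \<open>Hgrp\<close>, with the Borel sigma-algebra of its quotient topology:
  a set of cosets is open iff its union is open in \<open>Hgrp\<close>.\<close>

definition cosetUH :: "('f, 'e::field) quad_ext \<Rightarrow> 'e^3^3 \<Rightarrow> ('e^3^3) set" where
  "cosetUH E h = (\<lambda>u. u ** h) ` UH E"

definition quotient_space :: "('f, 'e::field) quad_ext \<Rightarrow> ('e^3^3) set set" where
  "quotient_space E = cosetUH E ` Hgrp E"

text \<open>The invariant measure on the coset space for which the orbit of the base point under
  \<open>H \<inter> K\<^sub>n\<close> has volume one. For \<open>n = 0\<close> this group consists of the integral points
  \<open>H \<inter> GL\<^sub>2\<close> of \<open>H\<close>. In general the orbit is \<open>q ^ n\<close> times smaller than the orbit of the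
  integral points: both groups have the same volume in \<open>H\<close>, but the \<open>K\<^sub>n\<close>-group meets \<open>UH\<close> in a
  subgroup that is \<open>q ^ n\<close> times larger. With the constant fixed at the integral points, the
  zeta integral of the newform against \<open>Phi E n\<close> would have constant term \<open>1 / q ^ n\<close>, and not
  1, as a power series in \<open>q powr (- 2 * s)\<close>.\<close>

definition haar_quotient ::
    "('f, 'e::nonarch_local_field) quad_ext \<Rightarrow> nat \<Rightarrow> ('e^3^3) set measure \<Rightarrow> bool" where
  "haar_quotient E n M \<longleftrightarrow>
     space M = quotient_space E \<and>
     sets M = sigma_sets (quotient_space E)
                {A. A \<subseteq> quotient_space E \<and> openin (top_of_set (Hgrp E)) (\<Union>A)} \<and>
     (\<forall>h \<in> Hgrp E. \<forall>A \<in> sets M. emeasure M ((\<lambda>X. (\<lambda>g. g ** h) ` X) ` A) = emeasure M A) \<and>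
     emeasure M (cosetUH E ` (Hgrp E \<inter> Kgrp E n)) = 1"

definition z_int ::
    "('f::nonarch_local_field, 'e::nonarch_local_field) quad_ext \<Rightarrow> 'f measure \<Rightarrow>
     complex \<Rightarrow> 'f^2^2 \<Rightarrow> ('f^2 \<Rightarrow> complex) \<Rightarrow> complex" where
  "z_int E mF s g \<Phi> =
     (LINT r|mF. \<Phi> (vector [0, r] v* g) * complex_of_real (vabs (emb E r)) powr s)"

text \<open>The value does not depend on the decomposition of \<open>h\<close> that is chosen.\<close>

definition f_section ::
    "('f::nonarch_local_field, 'e::nonarch_local_field) quad_ext \<Rightarrow> 'f measure \<Rightarrow>
     complex \<Rightarrow> 'e^3^3 \<Rightarrow> ('f^2 \<Rightarrow> complex) \<Rightarrow> complex" where
  "f_section E mF s h \<Phi> =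
     (let (b, h1) = (SOME (b, h1). b \<noteq> 0 \<and> det h1 = 1 \<and>
            h = embH (tmat E b ** dmat (sqrt_eps E) ** (\<chi> i j. emb E (h1 $ i $ j))
                      ** dmat (inverse (sqrt_eps E))))
      in complex_of_real (vabs b) powr s * z_int E mF s h1 \<Phi>)"

text \<open>The function on the coset space induced by \<open>h \<mapsto> W h * f s h \<Phi>\<close>, which is left
  \<open>UH\<close>-invariant when \<open>W\<close> is a Whittaker function.\<close>

definition zeta_integrand ::
    "('f::nonarch_local_field, 'e::nonarch_local_field) quad_ext \<Rightarrow> 'f measure \<Rightarrow>
     complex \<Rightarrow> ('e^3^3 \<Rightarrow> complex) \<Rightarrow> ('f^2 \<Rightarrow> complex) \<Rightarrow> ('e^3^3) set \<Rightarrow> complex" where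
  "zeta_integrand E mF s W \<Phi> X = (let h = (SOME h. h \<in> X) in W h * f_section E mF s h \<Phi>)"

definition zeta_converges ::
    "('f::nonarch_local_field, 'e::nonarch_local_field) quad_ext \<Rightarrow> 'f measure \<Rightarrow>
     ('e^3^3) set measure \<Rightarrow> complex \<Rightarrow> ('e^3^3 \<Rightarrow> complex) \<Rightarrow> ('f^2 \<Rightarrow> complex) \<Rightarrow> bool" where
  "zeta_converges E mF mH s W \<Phi> \<longleftrightarrow> integrable mH (zeta_integrand E mF s W \<Phi>)"

definition zeta_integral ::
    "('f::nonarch_local_field, 'e::nonarch_local_field) quad_ext \<Rightarrow> 'f measure \<Rightarrow>
     ('e^3^3) set measure \<Rightarrow> complex \<Rightarrow> ('e^3^3 \<Rightarrow> complex) \<Rightarrow> ('f^2 \<Rightarrow> complex) \<Rightarrow> complex" where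
  "zeta_integral E mF mH s W \<Phi> = (LINT X|mH. zeta_integrand E mF s W \<Phi> X)"

definition zeta_ratfun ::
    "('f::nonarch_local_field, 'e::nonarch_local_field) quad_ext \<Rightarrow> 'f measure \<Rightarrow>
     ('e^3^3) set measure \<Rightarrow> ('e^3^3 \<Rightarrow> complex) \<Rightarrow> ('f^2 \<Rightarrow> complex) \<Rightarrow>
     complex poly \<Rightarrow> complex poly \<Rightarrow> bool" where
  "zeta_ratfun E mF mH W \<Phi> P Q \<longleftrightarrow>
     (\<exists>\<sigma>::real. \<forall>s. Re s > \<sigma> \<longrightarrow>
        (let X = of_nat (residue_card TYPE('f)) powr (- 2 * s) in
           zeta_converges E mF mH s W \<Phi> \<and> poly Q X \<noteq> 0 \<and>
           zeta_integral E mF mH s W \<Phi> = poly P X / poly Q X))"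

text \<open>For all complex \<open>s\<close>, the zeta integral is the value at \<open>q powr (-2 * s)\<close> of the rational
  function that it equals for large real part of \<open>s\<close>. That function is written in lowest terms,
  so its value is unambiguous; at a pole it is \<open>0\<close> by the convention for division by zero.\<close>

definition Zeta ::
    "('f::nonarch_local_field, 'e::nonarch_local_field) quad_ext \<Rightarrow> 'f measure \<Rightarrow>
     ('e^3^3) set measure \<Rightarrow> complex \<Rightarrow> ('e^3^3 \<Rightarrow> complex) \<Rightarrow> ('f^2 \<Rightarrow> complex) \<Rightarrow> complex" where
  "Zeta E mF mH s W \<Phi> =
     (let (P, Q) = (SOME (P, Q). coprime P Q \<and> zeta_ratfun E mF mH W \<Phi> P Q);
          X = of_nat (residue_card TYPE('f)) powr (- 2 * s)
      in poly P X / poly Q X)"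

definition Phi :: "('f::nonarch_local_field, 'e) quad_ext \<Rightarrow> int \<Rightarrow> 'f^2 \<Rightarrow> complex" where
  "Phi E n = indicator {x. x$1 \<in> idealF E n \<and> x$2 \<in> ring_of_integers}"

end

theory Submission
  imports Defs
begin

text \<open>
  Write \<open>c\<^sub>i\<close> for the value of \<open>W\<^sub>v\<close> at \<open>\<zeta>\<^sup>i\<close> and \<open>X\<close> for \<open>q\<^sup>-\<^sup>2\<^sup>s\<close>. The theorem combines two facts about
  these numbers.

  The zeta integral is a power series in \<open>X\<close> with coefficients given by the \<open>c\<^sub>i\<close>. The integrand
  is constant on the orbits of \<open>H \<inter> K\<^sub>N\<close> in the quotient of \<open>H\<close> by \<open>U\<^sub>H\<close>, and these orbits are represented by
  the \<open>\<zeta>\<^sup>i\<close> (\<open>Iwasawa\<close>). A coset is determined by the bottom row of its elements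
  (\<open>same_row\<close>), so that the orbits become level sets of a valuation on row vectors; invariance
  of the measure under \<open>\<zeta>\<close>, under the Weyl element and under lower unipotent matrices then forces
  the orbit of \<open>\<zeta>\<^sup>i\<close> to have volume \<open>q\<^sup>2\<^sup>i\<close> (\<open>volume_rows\<close>). On this orbit \<open>f(s, h, \<Phi>)\<close> is
  \<open>X\<^sup>i / (1 - X)\<close> (\<open>f_section_rows\<close>), and \<open>c\<^sub>i\<close> vanishes for negative \<open>i\<close> since \<open>v\<close> is fixed by
  integral unipotent matrices (\<open>torus_val_neg\<close>). Hence \<open>(1 - X) Z\<close> is the sum of the
  \<open>c\<^sub>i q\<^sup>2\<^sup>i X\<^sup>i\<close>.

  The \<open>c\<^sub>i\<close> satisfy a recursion of order two (\<open>torus_val_recursion\<close>). The vector \<open>w = \<theta>'v\<close> is the sum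
  of the \<open>K\<^sub>N\<^sub>+\<^sub>1\<close>-translates of \<open>v\<close>, so that it is fixed by \<open>K\<^sub>N\<^sub>+\<^sub>1\<close>, and the value of its Whittaker function at
  \<open>\<zeta>\<^sup>i\<close> is \<open>c\<^sub>i\<^sub>-\<^sub>1 + q c\<^sub>i\<close>. One description of cosets (\<open>transversal_Kgrp\<close>) splits both \<open>T w\<close> and
  \<open>\<delta> w\<close> into a sum of upper unipotent translates of \<open>\<pi>(\<zeta>) w\<close>, where the Whittaker functional is computed by
  the character, and a second sum. The second sum for \<open>T\<close> is the \<open>\<zeta>\<^sup>-\<^sup>1\<close>-translate of the one for \<open>\<delta>\<close>
  (\<open>eigen_relations\<close>); eliminating it from \<open>T w = \<nu> w\<close> and \<open>\<delta> w = \<lambda> v\<close> gives the recursion,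
  and the recursion sums the series.

  All coset computations reduce to congruences between matrix entries once \<open>E\<close> is known to have the same
  uniformizer as \<open>F\<close> and the integral basis \<open>1\<close>, \<open>\<surd>\<epsilon>\<close>; this is Hensel's lemma for squares
  (\<open>hensel_square\<close>, \<open>vabs_coords\<close>).
\<close>

section \<open>Non-archimedean absolute values\<close>

lemma vabs_zero [simp]: "vabs (0 :: 'a::nonarch_valued_field) = 0"
  using dist_vabs[of "0::'a" 0] by simp

lemma vabs_nonneg [simp]: "0 \<le> vabs (x :: 'a::nonarch_valued_field)"
  using dist_vabs[of x 0] by (metis diff_zero zero_le_dist)

lemma vabs_eq_0_iff [simp]: "vabs (x :: 'a::nonarch_valued_field) = 0 \<longleftrightarrow> x = 0"
  using dist_vabs[of x 0] by auto

lemma vabs_pos_iff [simp]: "0 < vabs (x :: 'a::nonarch_valued_field) \<longleftrightarrow> x \<noteq> 0"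
  by (metis order_less_le vabs_eq_0_iff vabs_nonneg)

lemma vabs_one [simp]: "vabs (1 :: 'a::nonarch_valued_field) = 1"
proof -
  have "vabs (1::'a) * vabs (1::'a) = vabs (1::'a)"
    using vabs_mult[of "1::'a" 1] by simp
  then show ?thesis
    by (metis mult_cancel_right1 one_neq_zero vabs_eq_0_iff)
qed

lemma vabs_minus [simp]: "vabs (- x) = vabs (x :: 'a::nonarch_valued_field)"
  using dist_vabs[of x 0] dist_vabs[of 0 x] by (simp add: dist_commute)

lemma vabs_minus_commute: "vabs (x - y) = vabs (y - x :: 'a::nonarch_valued_field)"
  by (metis minus_diff_eq vabs_minus)

lemma vabs_inverse: "vabs (inverse x) = inverse (vabs (x :: 'a::nonarch_valued_field))"
proof (cases "x = 0")
  case False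
  then have "vabs x * vabs (inverse x) = 1"
    using vabs_mult[of x "inverse x"] by simp
  then show ?thesis by (metis inverse_unique)
qed simp

lemma vabs_divide: "vabs (x / y) = vabs x / vabs (y :: 'a::nonarch_valued_field)"
  by (simp add: divide_inverse vabs_mult vabs_inverse)

lemma vabs_power: "vabs (x ^ n) = vabs (x :: 'a::nonarch_valued_field) ^ n"
  by (induction n) (auto simp: vabs_mult)

lemma vabs_powi: "vabs (x powi n) = vabs (x :: 'a::nonarch_valued_field) powi n"
  by (simp add: power_int_def vabs_power vabs_inverse)

lemma vabs_add_le: "vabs x \<le> r \<Longrightarrow> vabs y \<le> r \<Longrightarrow> vabs (x + y :: 'a::nonarch_valued_field) \<le> r"
  using vabs_add_le_max[of x y] by simp

lemma vabs_diff_le: "vabs x \<le> r \<Longrightarrow> vabs y \<le> r \<Longrightarrow> vabs (x - y :: 'a::nonarch_valued_field) \<le> r"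
  using vabs_add_le[of x r "- y"] by simp

lemma vabs_add_less: "vabs x < r \<Longrightarrow> vabs y < r \<Longrightarrow> vabs (x + y :: 'a::nonarch_valued_field) < r"
  using vabs_add_le_max[of x y] by simp

lemma vabs_add_eq:
  fixes x y :: "'a::nonarch_valued_field"
  assumes "vabs y < vabs x" shows "vabs (x + y) = vabs x"
proof (rule antisym)
  show "vabs (x + y) \<le> vabs x" using vabs_add_le[of x "vabs x" y] assms by simp
  show "vabs x \<le> vabs (x + y)"
    using vabs_add_le_max[of "x + y" "- y"] assms by auto
qed

lemma vabs_of_nat_le_1: "vabs (of_nat n :: 'a::nonarch_valued_field) \<le> 1"
  by (induction n) (auto intro: vabs_add_le)

section \<open>Squares in a complete field\<close>

text \<open>Newton's iteration for \<open>x\<^sup>2 = a\<close> squares the error at each step, because the divisor \<open>2 x\<close> of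
  the correction is a unit.\<close>

lemma hensel_square:
  fixes a b :: "'a::{nonarch_valued_field, complete_space}"
  assumes two: "vabs (2::'a) = 1" and a: "vabs a = 1" and b: "vabs (a - b\<^sup>2) < 1"
  shows "\<exists>c. c\<^sup>2 = a"
proof -
  have two0: "(2::'a) \<noteq> 0" using two by auto
  define B where "B = rec_nat b (\<lambda>_ x. (x + a / x) / 2)"
  define e where "e = vabs (a - b\<^sup>2)"
  have B0: "B 0 = b" and BS: "B (Suc n) = (B n + a / B n) / 2" for n
    by (simp_all add: B_def)
  have e: "0 \<le> e" "e < 1" using b by (auto simp: e_def)
  have inv: "vabs (B n) = 1 \<and> vabs (a - (B n)\<^sup>2) \<le> e ^ Suc n" for n
  proof (induction n)
    case 0
    have "vabs (b\<^sup>2) = vabs a"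
      using vabs_add_eq[of "- (a - b\<^sup>2)" a] a b by (simp add: vabs_minus_commute)
    then have "(vabs b)\<^sup>2 = 1\<^sup>2" using a by (simp add: vabs_power)
    then have "vabs b = 1" by (subst (asm) power2_eq_iff_nonneg) auto
    then show ?case by (simp add: B0 e_def)
  next
    case (Suc n)
    define x where "x = B n"
    have x: "vabs x = 1" "vabs (a - x\<^sup>2) \<le> e ^ Suc n" using Suc by (auto simp: x_def)
    have x0: "x \<noteq> 0" using x by auto
    have eq: "B (Suc n) = x + (a - x\<^sup>2) / (2 * x)"
      using two0 x0 by (simp add: BS x_def[symmetric] field_simps power2_eq_square)
    have eq2: "a - (B (Suc n))\<^sup>2 = - ((a - x\<^sup>2)\<^sup>2 / (4 * x\<^sup>2))"
    proof -
      have "4 = (2::'a) * 2" by simp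
      then have "(4::'a) \<noteq> 0" using two0 by (metis mult_eq_0_iff)
      then show ?thesis
        unfolding eq using two0 x0 by (simp add: field_simps power2_eq_square)
    qed
    have le: "e ^ Suc n \<le> e" using e by (simp add: mult_left_le power_le_one)
    have "vabs ((a - x\<^sup>2) / (2 * x)) < 1"
      using x two le e by (simp add: vabs_divide vabs_mult)
    then have 1: "vabs (B (Suc n)) = 1" unfolding eq using x by (subst vabs_add_eq) auto
    have "vabs (4::'a) = 1" using vabs_mult[of "2::'a" 2] two by simp
    then have "vabs (a - (B (Suc n))\<^sup>2) = (vabs (a - x\<^sup>2))\<^sup>2"
      unfolding eq2 using x by (simp add: vabs_divide vabs_mult vabs_power)
    also have "\<dots> \<le> e * e ^ Suc n"
      using mult_mono[of "vabs (a - x\<^sup>2)" e "vabs (a - x\<^sup>2)" "e ^ Suc n"] x(2) le e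
      by (simp add: power2_eq_square[of "vabs _"])
    finally show ?case using 1 by simp
  qed
  have step: "vabs (B (Suc n) - B n) \<le> e ^ n" for n
  proof -
    have x0: "B n \<noteq> 0" using inv[of n] by auto
    have "B (Suc n) - B n = (a - (B n)\<^sup>2) / (2 * B n)"
      using two0 x0 by (simp add: BS field_simps power2_eq_square)
    then have "vabs (B (Suc n) - B n) \<le> e ^ Suc n"
      using inv[of n] two by (simp add: vabs_divide vabs_mult)
    also have "\<dots> \<le> e ^ n" using e by (simp add: mult_left_le_one_le)
    finally show ?thesis .
  qed
  have tail: "vabs (B (n + k) - B n) \<le> e ^ n" for n k
  proof (induction k)
    case (Suc k)
    have "vabs (B (Suc (n + k)) - B (n + k)) \<le> e ^ (n + k)" by (rule step)
    also have "\<dots> \<le> e ^ n" using e by (simp add: power_decreasing)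
    finally show ?case
      using vabs_add_le[OF _ Suc, of "B (Suc (n + k)) - B (n + k)"] by simp
  qed (simp add: e)
  have e_lim: "(\<lambda>n. e ^ n) \<longlonglongrightarrow> 0" using e by (intro LIMSEQ_realpow_zero) auto
  have "Cauchy B"
  proof (rule metric_CauchyI)
    fix r :: real assume "0 < r"
    then obtain M where M: "e ^ M < r"
      using e real_arch_pow_inv by blast
    show "\<exists>M. \<forall>m\<ge>M. \<forall>n\<ge>M. dist (B m) (B n) < r"
    proof (intro exI allI impI)
      fix m n assume "m \<ge> M" "n \<ge> M"
      then obtain i j where "m = M + i" "n = M + j" by (metis le_add_diff_inverse)
      then have "vabs (B m - B M) \<le> e ^ M" "vabs (B M - B n) \<le> e ^ M"
        using tail[of M i] tail[of M j] by (auto simp: vabs_minus_commute)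
      from vabs_add_le[OF this] show "dist (B m) (B n) < r" using M by (simp add: dist_vabs)
    qed
  qed
  then obtain c where c: "B \<longlonglongrightarrow> c" unfolding Cauchy_convergent_iff convergent_def by (elim exE)
  have dc: "(\<lambda>n. dist (B n) c) \<longlonglongrightarrow> 0" using c by (rule tendsto_dist_iff[THEN iffD1])
  have c1: "vabs c \<le> 1"
  proof -
    from dc have "\<forall>\<^sub>F n in sequentially. dist (B n) c < 1" by (rule order_tendstoD) simp
    then obtain n where "dist (B n) c < 1" by (auto simp: eventually_sequentially)
    then have "vabs (B n - c) \<le> 1" by (simp add: dist_vabs)
    with vabs_diff_le[of "B n" 1 "B n - c"] inv[of n] show ?thesis by simp
  qed
  have "vabs (a - c\<^sup>2) \<le> dist (B n) c + e ^ Suc n" for n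
  proof -
    have "a - c\<^sup>2 = (a - (B n)\<^sup>2) + (B n - c) * (B n + c)"
      by (simp add: algebra_simps power2_eq_square)
    then have "vabs (a - c\<^sup>2) \<le> max (vabs (a - (B n)\<^sup>2)) (vabs (B n - c) * vabs (B n + c))"
      using vabs_add_le_max vabs_mult by metis
    moreover have "vabs (B n + c) \<le> 1" using inv[of n] c1 by (intro vabs_add_le) auto
    then have "vabs (B n - c) * vabs (B n + c) \<le> dist (B n) c"
      by (simp add: dist_vabs mult_left_le)
    moreover have "0 \<le> dist (B n) c" "0 \<le> e ^ Suc n" using e by auto
    ultimately show ?thesis using inv[of n] by linarith
  qed
  moreover have "(\<lambda>n. dist (B n) c + e ^ Suc n) \<longlonglongrightarrow> 0 + 0"
    by (intro tendsto_add dc LIMSEQ_Suc e_lim)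
  ultimately have "vabs (a - c\<^sup>2) \<le> 0 + 0"
    by (intro LIMSEQ_le_const[of "\<lambda>n. dist (B n) c + e ^ Suc n"]) auto
  then have "vabs (a - c\<^sup>2) = 0" using vabs_nonneg[of "a - c\<^sup>2"] by linarith
  then show ?thesis by (intro exI[of _ c]) simp
qed

section \<open>Local fields\<close>

lemma residue_card_gt_1: "residue_card TYPE('a::nonarch_local_field) > 1"
proof -
  let ?c = "\<lambda>x::'a. {y. vabs (y - x) < 1}"
  have ne: "?c 0 \<noteq> ?c 1"
  proof
    assume "?c 0 = ?c 1"
    then have "(1::'a) \<in> ?c 0" by simp
    then show False by simp
  qed
  have sub: "{?c 0, ?c 1} \<subseteq> (residue_field :: 'a set set)"
    unfolding residue_field_def by (auto simp only: ring_of_integers_def insert_subset intro!: imageI) simp_all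
  have "card {?c 0, ?c 1} \<le> residue_card TYPE('a)"
    unfolding residue_card_def by (rule card_mono[OF finite_residue_field sub])
  then show ?thesis using ne by simp
qed

lemma vabs_value:
  fixes x :: "'a::nonarch_local_field"
  assumes "x \<noteq> 0" obtains n where "vabs x = real (residue_card TYPE('a)) powi n"
proof -
  have "vabs x \<in> vabs ` (UNIV - {0 :: 'a})" using assms by auto
  then show thesis using that unfolding value_group residue_card_def by auto
qed

lemma residue_reps:
  obtains R :: "'a::nonarch_local_field set" where
    "finite R" "card R = residue_card TYPE('a)" "R \<subseteq> ring_of_integers"
    "\<And>x. x \<in> ring_of_integers \<Longrightarrow> \<exists>r\<in>R. vabs (x - r) < 1"
    "\<And>r r'. r \<in> R \<Longrightarrow> r' \<in> R \<Longrightarrow> vabs (r' - r) < 1 \<Longrightarrow> r' = r"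
proof -
  let ?c = "\<lambda>x::'a. {y. vabs (y - x) < 1}"
  have "\<exists>U \<subseteq> (ring_of_integers :: 'a set). inj_on ?c U \<and> residue_field = ?c ` U"
    unfolding residue_field_def by (rule subset_image_inj[THEN iffD1, OF order_refl])
  then obtain R where R: "R \<subseteq> (ring_of_integers :: 'a set)" "inj_on ?c R"
      "residue_field = ?c ` R"
    by (elim exE conjE)
  have 1: "finite R" using R finite_residue_field by (metis finite_imageD)
  have 2: "card R = residue_card TYPE('a)"
    using card_image[OF R(2)] R(3) by (simp add: residue_card_def)
  have 3: "\<exists>r\<in>R. vabs (x - r) < 1" if "x \<in> ring_of_integers" for x :: 'a
  proof -
    have "?c x \<in> ?c ` R" unfolding R(3)[symmetric] using that by (auto simp: residue_field_def)
    then obtain r where "r \<in> R" "?c x = ?c r" by auto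
    moreover have "x \<in> ?c x" by simp
    ultimately show ?thesis by blast
  qed
  have 4: "r' = r" if "r \<in> R" "r' \<in> R" "vabs (r' - r) < 1" for r r'
  proof -
    have "?c r' = ?c r"
    proof safe
      fix y assume "vabs (y - r') < 1"
      then show "vabs (y - r) < 1" using vabs_add_less[of "y - r'" 1 "r' - r"] that by simp
    next
      fix y assume "vabs (y - r) < 1"
      then show "vabs (y - r') < 1"
        using vabs_add_less[of "y - r" 1 "r - r'"] that by (simp add: vabs_minus_commute)
    qed
    then show ?thesis using R(2) that by (meson inj_onD)
  qed
  show thesis using that[OF 1 2 R(1) 3 4] .
qed

lemma vabs_two_of_odd_residual_char:
  assumes "odd (residual_char TYPE('a::nonarch_local_field))"
  shows "vabs (2 :: 'a) = 1"
proof (rule ccontr)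
  assume "vabs (2 :: 'a) \<noteq> 1"
  then have lt: "vabs (of_nat 2 :: 'a) < 1"
    using vabs_of_nat_le_1[of 2, where 'a = 'a] by simp
  let ?P = "\<lambda>p. p > 0 \<and> vabs (of_nat p :: 'a) < 1"
  have "residual_char TYPE('a) \<le> 2" unfolding residual_char_def
    by (rule Least_le) (use lt in auto)
  moreover have "?P (residual_char TYPE('a))" unfolding residual_char_def
    by (rule LeastI[of ?P 2]) (use lt in auto)
  moreover from this have "residual_char TYPE('a) \<noteq> 1" by force
  ultimately have "residual_char TYPE('a) = 2" by linarith
  then show False using assms by simp
qed

section \<open>The unramified quadratic extension\<close>

lemma frac_ideal_iff:
  fixes w :: "'a::nonarch_local_field"
  assumes "w \<noteq> 0"
  shows "x \<in> frac_ideal w n \<longleftrightarrow> vabs x \<le> vabs w powi n"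
proof
  assume "x \<in> frac_ideal w n"
  then obtain y where "x = w powi n * y" "vabs y \<le> 1"
    by (auto simp: frac_ideal_def ring_of_integers_def)
  then show "vabs x \<le> vabs w powi n"
    by (simp add: vabs_mult vabs_powi mult_left_le)
next
  assume le: "vabs x \<le> vabs w powi n"
  have "x = w powi n * (x / w powi n)" using assms by simp
  moreover have "vabs (x / w powi n) \<le> 1"
    using le assms by (simp add: vabs_divide vabs_powi divide_le_eq)
  ultimately show "x \<in> frac_ideal w n"
    unfolding frac_ideal_def ring_of_integers_def by blast
qed

locale unram_ext =
  fixes E :: "('f::nonarch_local_field, 'e::nonarch_local_field) quad_ext" and q :: nat
  assumes odd_residual_char: "odd (residual_char TYPE('f))"
    and unram: "unramified_quadratic E"
    and q_eq: "q = residue_card TYPE('f)"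
begin

abbreviation "j \<equiv> emb E"
abbreviation "se \<equiv> sqrt_eps E"
abbreviation "cj \<equiv> conjE E"
abbreviation "uF \<equiv> unif E"
abbreviation "uE \<equiv> unifE E"

lemma q_gt_1: "q > 1"
  using residue_card_gt_1[where 'a = 'f] by (simp add: q_eq)

lemma q_pos [simp]: "q > 0" "q \<noteq> 0" "real q > 0" "real q > 1" "real q \<ge> 1"
  using q_gt_1 by auto

lemma powi_q_le_iff [simp]: "real q powi m \<le> real q powi n \<longleftrightarrow> m \<le> n"
  using q_pos by (metis power_int_increasing power_int_strict_increasing not_le less_le_not_le)

lemma powi_q_less_iff [simp]: "real q powi m < real q powi n \<longleftrightarrow> m < n"
  using powi_q_le_iff by (meson not_le)

lemma powi_q_eq_iff [simp]: "real q powi m = real q powi n \<longleftrightarrow> m = n"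
  by (metis order.antisym order.refl powi_q_le_iff)

lemma powi_q_pos [simp]: "0 < real q powi m" "real q powi m \<noteq> 0"
  by (simp_all add: zero_less_power_int)

lemma powi_q_le_1_iff [simp]: "real q powi m \<le> 1 \<longleftrightarrow> m \<le> 0" "1 \<le> real q powi m \<longleftrightarrow> 0 \<le> m"
  using powi_q_le_iff[of m 0] powi_q_le_iff[of 0 m] by auto

lemma powi_q_less_1_iff [simp]: "real q powi m < 1 \<longleftrightarrow> m < 0"
  using powi_q_less_iff[of m 0] by auto

lemma powi_q_square: "(real q powi m)\<^sup>2 = real q powi (2 * m)"
  by (simp add: power2_eq_square flip: power_int_add)

lemma emb_1 [simp]: "j 1 = 1"
  and emb_add: "j (x + y) = j x + j y"
  and emb_mult: "j (x * y) = j x * j y"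
  and vabs_eps: "vabs (eps E) = 1"
  and eps_nonsquare: "x\<^sup>2 \<noteq> eps E"
  and se_square: "se\<^sup>2 = j (eps E)"
  and ex_coords: "\<exists>a b. z = j a + j b * se"
  and vabs_emb [simp]: "vabs (j x) = (vabs x)\<^sup>2"
  and vabs_uF: "vabs uF = 1 / real q"
  using unram q_eq unfolding unramified_quadratic_def by blast+

lemma emb_0 [simp]: "j 0 = 0"
  using emb_add[of 0 0] by simp

lemma emb_minus: "j (- x) = - j x"
  using emb_add[of x "- x"] by (simp add: eq_neg_iff_add_eq_0 add.commute)

lemma emb_diff: "j (x - y) = j x - j y"
  using emb_add[of x "- y"] by (simp add: emb_minus)

lemma emb_eq_0_iff [simp]: "j x = 0 \<longleftrightarrow> x = 0"
proof
  assume "j x = 0"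
  then have "(vabs x)\<^sup>2 = 0" by (metis vabs_emb vabs_zero)
  then show "x = 0" by simp
qed simp

lemma emb_eq_iff [simp]: "j x = j y \<longleftrightarrow> x = y"
  using emb_eq_0_iff[of "x - y"] by (simp add: emb_diff)

lemma emb_inverse: "j (inverse x) = inverse (j x)"
proof (cases "x = 0")
  case False
  then have "j x * j (inverse x) = 1" by (simp flip: emb_mult)
  then show ?thesis by (metis inverse_unique)
qed simp

lemma emb_divide: "j (x / y) = j x / j y"
  by (simp add: divide_inverse emb_mult emb_inverse)

lemma emb_power: "j (x ^ n) = j x ^ n"
  by (induction n) (auto simp: emb_mult)

lemma emb_powi: "j (x powi n) = j x powi n"
  by (simp add: power_int_def emb_power emb_inverse)

lemma emb_2 [simp]: "j 2 = 2"
  using emb_add[of 1 1] by simp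

lemma vabs_two_F [simp]: "vabs (2::'f) = 1"
  by (rule vabs_two_of_odd_residual_char[OF odd_residual_char])

lemma vabs_two_E [simp]: "vabs (2::'e) = 1"
  using vabs_emb[of 2] by simp

lemma vabs_se [simp]: "vabs se = 1"
proof -
  have "(vabs se)\<^sup>2 = 1\<^sup>2" using arg_cong[OF se_square, of vabs] by (simp add: vabs_power vabs_eps)
  then show ?thesis by (subst (asm) power2_eq_iff_nonneg) auto
qed

lemma se_nonzero [simp]: "se \<noteq> 0"
  using vabs_se by (metis vabs_zero zero_neq_one)

text \<open>If \<open>a\<close> and \<open>b\<close> are units and \<open>a + b \<surd>\<epsilon>\<close> is not, then \<open>\<epsilon>\<close> is congruent to a square, hence
  is a square.\<close>

lemma vabs_unit_coords:
  assumes "vabs a = 1" "vabs b = 1" shows "vabs (j a + j b * se) = 1"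
proof (rule ccontr)
  assume ne: "vabs (j a + j b * se) \<noteq> 1"
  have le: "vabs (j a + j b * se) \<le> 1" "vabs (j a - j b * se) \<le> 1"
    using assms by (auto intro!: vabs_add_le vabs_diff_le simp: vabs_mult)
  have b0: "b \<noteq> 0" using assms by auto
  have "vabs (j a + j b * se) * vabs (j a - j b * se) < 1"
    using ne le mult_left_le[of "vabs (j a - j b * se)" "vabs (j a + j b * se)"] by simp
  moreover have "(j a + j b * se) * (j a - j b * se) = j (a\<^sup>2 - b\<^sup>2 * eps E)"
    by (simp add: emb_diff emb_mult emb_power se_square[symmetric] algebra_simps power2_eq_square)
  ultimately have "(vabs (a\<^sup>2 - b\<^sup>2 * eps E))\<^sup>2 < 1\<^sup>2"
    by (metis vabs_mult vabs_emb power_one)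
  then have lt: "vabs (a\<^sup>2 - b\<^sup>2 * eps E) < 1"
    by (rule power_less_imp_less_base) simp
  have "eps E - (a / b)\<^sup>2 = - ((a\<^sup>2 - b\<^sup>2 * eps E) / b\<^sup>2)"
    using b0 by (simp add: field_simps)
  then have "vabs (eps E - (a / b)\<^sup>2) < 1"
    using lt assms by (simp only: vabs_minus vabs_divide vabs_power) simp
  from hensel_square[OF vabs_two_F vabs_eps this] eps_nonsquare show False by blast
qed

lemma vabs_coords: "vabs (j a + j b * se) = (max (vabs a) (vabs b))\<^sup>2"
proof -
  consider "vabs a < vabs b" | "vabs b < vabs a" | "vabs a = vabs b" "a = 0"
    | "vabs a = vabs b" "a \<noteq> 0" by linarith
  then show ?thesis
  proof cases
    case 1
    then have "vabs (j b * se + j a) = vabs (j b * se)"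
      by (intro vabs_add_eq) (simp add: vabs_mult power_strict_mono)
    then show ?thesis using 1 by (simp add: add.commute vabs_mult)
  next
    case 2
    then have "vabs (j a + j b * se) = vabs (j a)"
      by (intro vabs_add_eq) (simp add: vabs_mult power_strict_mono)
    then show ?thesis using 2 by (simp add: vabs_mult)
  next
    case 3
    then show ?thesis by (metis add_0 emb_0 max.idem mult_zero_left vabs_eq_0_iff vabs_zero zero_power2)
  next
    case 4
    then have "vabs (j 1 + j (b / a) * se) = 1"
      by (intro vabs_unit_coords) (auto simp: vabs_divide)
    moreover have "j a + j b * se = j a * (j 1 + j (b / a) * se)"
      using 4 by (simp add: emb_divide field_simps)
    ultimately show ?thesis using 4 by (simp add: vabs_mult)
  qed
qed

lemma coords_unique:
  assumes "j a + j b * se = j a' + j b' * se" shows "a = a' \<and> b = b'"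
proof -
  have "j (a - a') + j (b - b') * se = 0"
    using assms by (simp add: emb_diff algebra_simps)
  then have "max (vabs (a - a')) (vabs (b - b')) = 0"
    by (metis vabs_coords vabs_zero power_eq_0_iff)
  then have "vabs (a - a') = 0" "vabs (b - b') = 0"
    using vabs_nonneg[of "a - a'"] vabs_nonneg[of "b - b'"] by linarith+
  then show ?thesis by simp
qed

text \<open>The coordinates of an element of \<open>E\<close> in the basis \<open>1\<close>, \<open>\<surd>\<epsilon>\<close>.\<close>

definition reF :: "'e \<Rightarrow> 'f" where "reF z = (SOME a. \<exists>b. z = j a + j b * se)"
definition imF :: "'e \<Rightarrow> 'f" where "imF z = (SOME b. z = j (reF z) + j b * se)"

lemma coords: "z = j (reF z) + j (imF z) * se"
proof -
  have "\<exists>b. z = j (reF z) + j b * se"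
    unfolding reF_def by (rule someI_ex) (rule ex_coords)
  then show ?thesis unfolding imF_def by (rule someI_ex)
qed

lemma cj_coords: "cj (j a + j b * se) = j a - j b * se"
  unfolding conjE_def
proof (rule the_equality)
  show "\<exists>a' b'. j a + j b * se = j a' + j b' * se \<and> j a - j b * se = j a' - j b' * se"
    by blast
next
  fix w assume "\<exists>a' b'. j a + j b * se = j a' + j b' * se \<and> w = j a' - j b' * se"
  then show "w = j a - j b * se" using coords_unique by blast
qed

lemma cj_add: "cj (x + y) = cj x + cj y"
proof -
  have "x + y = j (reF x + reF y) + j (imF x + imF y) * se"
    by (subst (1 2) coords) (simp add: emb_add algebra_simps)
  then have "cj (x + y) = j (reF x + reF y) - j (imF x + imF y) * se"
    using cj_coords by metis
  also have "\<dots> = (j (reF x) - j (imF x) * se) + (j (reF y) - j (imF y) * se)"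
    by (simp add: emb_add algebra_simps)
  also have "\<dots> = cj x + cj y" using cj_coords coords by metis
  finally show ?thesis .
qed

lemma cj_mult: "cj (x * y) = cj x * cj y"
proof -
  define a b c d where "a = reF x" "b = imF x" "c = reF y" "d = imF y"
  have x: "x = j a + j b * se" and y: "y = j c + j d * se"
    unfolding a_b_c_d_def by (rule coords)+
  have "x * y = j (a * c + b * d * eps E) + j (a * d + b * c) * se"
    unfolding x y by (simp add: emb_add emb_mult se_square[symmetric] algebra_simps power2_eq_square)
  then have "cj (x * y) = j (a * c + b * d * eps E) - j (a * d + b * c) * se"
    using cj_coords by metis
  also have "\<dots> = (j a - j b * se) * (j c - j d * se)"
    by (simp add: emb_add emb_mult se_square[symmetric] algebra_simps power2_eq_square)
  also have "\<dots> = cj x * cj y" by (simp add: x y cj_coords)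
  finally show ?thesis .
qed

lemma cj_emb [simp]: "cj (j a) = j a"
  using cj_coords[of a 0] by simp

lemma cj_se [simp]: "cj se = - se"
  using cj_coords[of 0 1] by simp

lemma cj_0 [simp]: "cj 0 = 0" using cj_emb[of 0] by simp
lemma cj_1 [simp]: "cj 1 = 1" using cj_emb[of 1] by simp
lemma cj_2 [simp]: "cj 2 = 2" using cj_emb[of 2] by simp

lemma cj_minus: "cj (- x) = - cj x"
  using cj_add[of x "- x"] by (simp add: eq_neg_iff_add_eq_0 add.commute)

lemma cj_diff: "cj (x - y) = cj x - cj y"
  using cj_add[of x "- y"] by (simp add: cj_minus)

lemma cj_cj [simp]: "cj (cj z) = z"
proof -
  have "cj z = j (reF z) + j (- imF z) * se" using cj_coords coords[of z] by (metis add_uminus_conv_diff emb_minus mult_minus_left)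
  then have "cj (cj z) = j (reF z) - j (- imF z) * se" by (metis cj_coords)
  then show ?thesis using coords[of z] by (simp add: emb_minus)
qed

lemma cj_eq_iff [simp]: "cj x = cj y \<longleftrightarrow> x = y"
  by (metis cj_cj)

lemma cj_eq_0_iff [simp]: "cj x = 0 \<longleftrightarrow> x = 0"
  using cj_eq_iff[of x 0] by simp

lemma cj_inverse: "cj (inverse x) = inverse (cj x)"
proof (cases "x = 0")
  case False
  then have "cj x * cj (inverse x) = 1" by (simp flip: cj_mult)
  then show ?thesis by (metis inverse_unique)
qed simp

lemma cj_divide: "cj (x / y) = cj x / cj y"
  by (simp add: divide_inverse cj_mult cj_inverse)

lemma vabs_coords_conj: "vabs (j a - j b * se) = vabs (j a + j b * se)"
  using vabs_coords[of a b] vabs_coords[of a "- b"] by (simp add: emb_minus)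

lemma vabs_cj [simp]: "vabs (cj z) = vabs z"
  using vabs_coords_conj[of "reF z" "imF z"] cj_coords[of "reF z" "imF z"] coords[of z] by metis

lemma cj_fixed: "cj z = z \<Longrightarrow> z = j (reF z)"
  and cj_antifixed: "cj z = - z \<Longrightarrow> z = j (imF z) * se"
proof -
  define a b where "a = reF z" "b = imF z"
  have z: "z = j a + j b * se" and cz: "cj z = j a - j b * se"
    using coords[of z] cj_coords[of a b] by (simp_all add: a_b_def)
  have two: "(2::'e) \<noteq> 0" using vabs_two_E by force
  { assume "cj z = z"
    then have "2 * (j b * se) = 0" using z cz by (simp add: algebra_simps)
    then have "b = 0" using two by simp
    then show "z = j (reF z)" unfolding a_b_def(1)[symmetric] using z by simp }
  { assume "cj z = - z"
    then have "2 * j a = 0" using z cz by (simp add: algebra_simps)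
    then have "a = 0" using two by simp
    then show "z = j (imF z) * se" unfolding a_b_def(2)[symmetric] using z by simp }
qed

lemma imF_coords: "imF (j a + j b * se) = b"
  using coords_unique coords by metis

lemma reF_coords: "reF (j a + j b * se) = a"
  using coords_unique coords by metis

section \<open>Fractional ideals\<close>
lemma uF_nonzero [simp]: "uF \<noteq> 0"
  using vabs_uF by auto

lemma uE_nonzero [simp]: "uE \<noteq> 0"
  by (simp add: unifE_def)

lemma cj_uE [simp]: "cj uE = uE"
  by (simp add: unifE_def)

lemma cj_uE_powi [simp]: "cj (uE powi n) = uE powi n"
  by (simp add: unifE_def flip: emb_powi)

lemma vabs_uF_powi: "vabs (uF powi n) = real q powi (- n)"
  by (simp add: vabs_powi vabs_uF power_int_minus power_int_divide_distrib divide_inverse power_int_inverse)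

lemma vabs_uE_powi: "vabs (uE powi n) = real q powi (- 2 * n)"
  by (simp add: unifE_def vabs_uF_powi powi_q_square flip: emb_powi)

lemma idealF_iff: "x \<in> idealF E n \<longleftrightarrow> vabs x \<le> real q powi (- n)"
  using vabs_uF_powi[of n] by (simp add: frac_ideal_iff vabs_powi[symmetric])

lemma idealE_iff: "z \<in> idealE E n \<longleftrightarrow> vabs z \<le> real q powi (- 2 * n)"
  using vabs_uE_powi[of n] by (simp add: frac_ideal_iff vabs_powi[symmetric])

lemma integers_eq_idealE: "ring_of_integers = idealE E 0"
  using idealE_iff[of _ 0] by (auto simp: ring_of_integers_def)

lemma integers_eq_idealF: "ring_of_integers = idealF E 0"
  using idealF_iff[of _ 0] by (auto simp: ring_of_integers_def)

lemma idealE_coords: "z \<in> idealE E n \<longleftrightarrow> reF z \<in> idealF E n \<and> imF z \<in> idealF E n"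
proof -
  have "real q powi (- 2 * n) = (real q powi (- n))\<^sup>2"
    by (simp add: powi_q_square)
  then have "z \<in> idealE E n \<longleftrightarrow> (max (vabs (reF z)) (vabs (imF z)))\<^sup>2 \<le> (real q powi (- n))\<^sup>2"
    unfolding idealE_iff using vabs_coords[of "reF z" "imF z"] coords[of z] by simp
  also have "\<dots> \<longleftrightarrow> max (vabs (reF z)) (vabs (imF z)) \<le> real q powi (- n)"
    by (rule power_mono_iff) (auto simp: le_max_iff_disj less_imp_le)
  finally show ?thesis by (simp add: idealF_iff)
qed

lemma emb_in_idealE [simp]: "j x \<in> idealE E n \<longleftrightarrow> x \<in> idealF E n"
  using reF_coords[of x 0] imF_coords[of x 0] by (simp add: idealE_coords idealF_iff)

lemma value_F:
  fixes x :: 'f assumes "x \<noteq> 0" obtains n where "vabs x = real q powi n"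
  using vabs_value[OF assms] q_eq by metis

lemma value_E:
  fixes z :: 'e assumes "z \<noteq> 0" obtains n where "vabs z = real q powi (- 2 * n)"
proof -
  let ?m = "if vabs (reF z) \<le> vabs (imF z) then imF z else reF z"
  have v: "vabs z = (vabs ?m)\<^sup>2"
    using vabs_coords[of "reF z" "imF z"] coords[of z] by (auto simp: max_def)
  have "?m \<noteq> 0"
  proof
    assume "?m = 0"
    with v have "vabs z = 0" by simp
    with assms show False by simp
  qed
  then obtain n where "vabs ?m = real q powi n" by (rule value_F)
  then have "vabs z = real q powi (- 2 * (- n))"
    unfolding v by (simp add: powi_q_square)
  then show thesis by (rule that)
qed

lemma idealE_0 [simp]: "0 \<in> idealE E n" and idealF_0 [simp]: "0 \<in> idealF E n"
  by (simp_all add: idealE_iff idealF_iff less_imp_le)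

lemma idealE_add: "x \<in> idealE E n \<Longrightarrow> y \<in> idealE E n \<Longrightarrow> x + y \<in> idealE E n"
  and idealE_diff: "x \<in> idealE E n \<Longrightarrow> y \<in> idealE E n \<Longrightarrow> x - y \<in> idealE E n"
  and idealE_minus [simp]: "- x \<in> idealE E n \<longleftrightarrow> x \<in> idealE E n"
  and idealE_cj [simp]: "cj x \<in> idealE E n \<longleftrightarrow> x \<in> idealE E n"
  by (simp_all add: idealE_iff vabs_add_le vabs_diff_le)

lemma idealF_add: "x \<in> idealF E n \<Longrightarrow> y \<in> idealF E n \<Longrightarrow> x + y \<in> idealF E n"
  and idealF_diff: "x \<in> idealF E n \<Longrightarrow> y \<in> idealF E n \<Longrightarrow> x - y \<in> idealF E n"
  and idealF_minus [simp]: "- x \<in> idealF E n \<longleftrightarrow> x \<in> idealF E n"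
  by (simp_all add: idealF_iff vabs_add_le vabs_diff_le)

lemma idealE_mono: "x \<in> idealE E n \<Longrightarrow> m \<le> n \<Longrightarrow> x \<in> idealE E m"
  unfolding idealE_iff by (erule order_trans) simp

lemma idealF_mono: "x \<in> idealF E n \<Longrightarrow> m \<le> n \<Longrightarrow> x \<in> idealF E m"
  unfolding idealF_iff by (erule order_trans) simp

lemma idealE_mult:
  assumes "x \<in> idealE E a" "y \<in> idealE E b" "c \<le> a + b" shows "x * y \<in> idealE E c"
proof -
  have "vabs (x * y) \<le> real q powi (- 2 * a) * real q powi (- 2 * b)"
    unfolding vabs_mult using assms by (intro mult_mono) (auto simp: idealE_iff less_imp_le)
  also have "\<dots> = real q powi (- 2 * (a + b))"
    by (simp add: power_int_add[symmetric] algebra_simps)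
  also have "\<dots> \<le> real q powi (- 2 * c)" using assms(3) by simp
  finally show ?thesis by (simp add: idealE_iff)
qed

lemma uE_powi_in [simp]: "uE powi n \<in> idealE E m \<longleftrightarrow> m \<le> n"
  by (auto simp: idealE_iff vabs_uE_powi)

lemma idealE_uE_powi_mult: "uE powi n * x \<in> idealE E m \<longleftrightarrow> x \<in> idealE E (m - n)"
proof
  assume *: "uE powi n * x \<in> idealE E m"
  have "uE powi (- n) * (uE powi n * x) \<in> idealE E (m - n)"
    by (rule idealE_mult[OF _ *, of _ "- n"]) auto
  then show "x \<in> idealE E (m - n)" by (simp add: power_int_minus mult.assoc[symmetric])
next
  assume "x \<in> idealE E (m - n)"
  then show "uE powi n * x \<in> idealE E m"
    by (rule idealE_mult[rotated, where a = n]) auto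
qed

lemma idealF_uF_powi_mult: "uF powi n * x \<in> idealF E m \<longleftrightarrow> x \<in> idealF E (m - n)"
  using idealE_uE_powi_mult[of n "j x" m] emb_in_idealE[of "uF powi n * x" m]
    emb_in_idealE[of x "m - n"]
  by (simp add: unifE_def emb_mult emb_powi)

lemma idealE_unit_mult: "vabs u = 1 \<Longrightarrow> u * x \<in> idealE E n \<longleftrightarrow> x \<in> idealE E n"
  by (simp add: idealE_iff vabs_mult)

lemma idealE_half: "x / 2 \<in> idealE E n \<longleftrightarrow> x \<in> idealE E n"
  by (simp add: idealE_iff vabs_divide)

lemma idealE_se: "x * se \<in> idealE E n \<longleftrightarrow> x \<in> idealE E n"
  by (simp add: idealE_iff vabs_mult)

lemma imF_in: "z \<in> idealE E n \<Longrightarrow> imF z \<in> idealF E n"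
  by (simp add: idealE_coords)

text \<open>The absolute value takes no value strictly between \<open>q\<^sup>-\<^sup>2\<close> and \<open>1\<close> on \<open>E\<close>, since \<open>E\<close> has the
  same uniformizer as \<open>F\<close>.\<close>

lemma idealE_1_iff: "z \<in> idealE E 1 \<longleftrightarrow> vabs z < 1"
proof (cases "z = 0")
  case False
  then obtain n where "vabs z = real q powi (- 2 * n)" by (rule value_E)
  then show ?thesis by (auto simp: idealE_iff)
qed auto

lemma idealF_1_iff: "x \<in> idealF E 1 \<longleftrightarrow> vabs x < 1"
proof (cases "x = 0")
  case False
  then obtain n where n: "vabs x = real q powi n" by (rule value_F)
  have "x \<in> idealF E 1 \<longleftrightarrow> n \<le> - 1" unfolding idealF_iff n by (rule powi_q_le_iff)
  then show ?thesis unfolding n by auto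
qed auto

lemma idealE_0_cases:
  assumes "z \<in> idealE E 0" obtains "vabs z = 1" | "z \<in> idealE E 1"
proof -
  have "vabs z \<le> 1" using assms by (simp add: idealE_iff)
  then show ?thesis using that idealE_1_iff[of z] by (cases "vabs z = 1") auto
qed

end

section \<open>Sums over cosets\<close>

text \<open>A coset sum does not depend on representatives when the summand is constant on cosets; explicit
  representatives are given by a transversal of the left cosets of \<open>B\<close> in \<open>A\<close>.\<close>

definition transversal :: "('a \<Rightarrow> 'a \<Rightarrow> 'a) \<Rightarrow> 'a set \<Rightarrow> 'a set \<Rightarrow> 'a set \<Rightarrow> bool" where
  "transversal m A B R \<longleftrightarrow> R \<subseteq> A \<and> (\<forall>a\<in>A. \<exists>r\<in>R. \<exists>b\<in>B. a = m r b) \<and>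
     (\<forall>r\<in>R. \<forall>r'\<in>R. \<forall>b\<in>B. r' = m r b \<longrightarrow> r' = r)"

text \<open>The operation is a parameter, because the same argument serves addition of scalars and
  multiplication of matrices.\<close>

definition is_subgroup :: "('a \<Rightarrow> 'a \<Rightarrow> 'a) \<Rightarrow> 'a set \<Rightarrow> bool" where
  "is_subgroup m B \<longleftrightarrow> (\<forall>a b c. m (m a b) c = m a (m b c)) \<and> (\<forall>b\<in>B. \<forall>b'\<in>B. m b b' \<in> B) \<and>
     (\<exists>e\<in>B. (\<forall>a. m a e = a) \<and> (\<forall>b\<in>B. \<exists>b'\<in>B. m b b' = e))"

lemma transversalD:
  assumes "transversal m A B R"
  shows "R \<subseteq> A" "\<And>a. a \<in> A \<Longrightarrow> \<exists>r\<in>R. \<exists>b\<in>B. a = m r b"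
    "\<And>r r' b. r \<in> R \<Longrightarrow> r' \<in> R \<Longrightarrow> b \<in> B \<Longrightarrow> r' = m r b \<Longrightarrow> r' = r"
  using assms unfolding transversal_def by blast+

lemma coset_sum_transversal:
  assumes B: "is_subgroup m B" and R: "transversal m A B R"
    and f: "\<And>a b. a \<in> A \<Longrightarrow> b \<in> B \<Longrightarrow> f (m a b) = f a"
  shows "coset_sum m A B f = sum f R"
proof -
  note RD = transversalD[OF R]
  obtain e where e: "e \<in> B" "\<And>a. m a e = a" "\<And>b. b \<in> B \<Longrightarrow> \<exists>b'\<in>B. m b b' = e"
    and assoc: "\<And>a b c. m (m a b) c = m a (m b c)"
    and cl: "\<And>b b'. b \<in> B \<Longrightarrow> b' \<in> B \<Longrightarrow> m b b' \<in> B"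
    using B unfolding is_subgroup_def by blast
  have coset: "m (m r b) ` B = m r ` B" if b: "b \<in> B" for r b
  proof
    show "m (m r b) ` B \<subseteq> m r ` B" using cl b by (auto simp: assoc)
    obtain b' where b': "b' \<in> B" "m b b' = e" using e(3) b by blast
    show "m r ` B \<subseteq> m (m r b) ` B"
    proof
      fix x assume "x \<in> m r ` B"
      then obtain c where c: "c \<in> B" "x = m r c" by blast
      obtain d where d: "d \<in> B" "m b' d = e" using e(3) b'(1) by blast
      have "m e (m d c) = m (m b b') (m d c)" by (simp add: b')
      also have "\<dots> = m b (m (m b' d) c)" by (simp add: assoc)
      finally have "m e (m d c) = m b (m e c)" by (simp add: d)
      have "x = m (m (m r b) b') c" using c b' e(2) by (simp add: assoc[of r b b'])
      then show "x \<in> m (m r b) ` B" using cl b'(1) c(1) by (auto simp: assoc)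
    qed
  qed
  have img: "(\<lambda>a. m a ` B) ` A = (\<lambda>r. m r ` B) ` R"
  proof
    show "(\<lambda>r. m r ` B) ` R \<subseteq> (\<lambda>a. m a ` B) ` A" using RD(1) by blast
    show "(\<lambda>a. m a ` B) ` A \<subseteq> (\<lambda>r. m r ` B) ` R"
    proof safe
      fix a assume "a \<in> A"
      then obtain r b where "r \<in> R" "b \<in> B" "a = m r b" using RD(2) by blast
      then show "m a ` B \<in> (\<lambda>r. m r ` B) ` R" using coset by auto
    qed
  qed
  have inj: "inj_on (\<lambda>r. m r ` B) R"
  proof (rule inj_onI)
    fix r r' assume r: "r \<in> R" "r' \<in> R" "m r ` B = m r' ` B"
    have "r' \<in> m r' ` B" using e by (metis image_eqI)
    then obtain b where b: "b \<in> B" "r' = m r b" using r(3) by blast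
    show "r = r'" using RD(3)[OF r(1,2) b] by simp
  qed
  have "coset_sum m A B f = (\<Sum>r\<in>R. f (SOME x. x \<in> m r ` B))"
    unfolding coset_sum_def img by (simp add: sum.reindex[OF inj])
  also have "\<dots> = sum f R"
  proof (rule sum.cong)
    fix r assume r: "r \<in> R"
    have "m r e \<in> m r ` B" using e(1) by (rule imageI)
    then have "(SOME x. x \<in> m r ` B) \<in> m r ` B" by (rule someI)
    then obtain b where "b \<in> B" "(SOME x. x \<in> m r ` B) = m r b" by blast
    then show "f (SOME x. x \<in> m r ` B) = f r" using f r RD(1) by auto
  qed simp
  finally show ?thesis .
qed

text \<open>A left translate of a transversal is again one, so both give the same coset sum.\<close>

lemma sum_transversal_translate:
  assumes B: "is_subgroup m B" and R: "transversal m A B R"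
    and f: "\<And>a b. a \<in> A \<Longrightarrow> b \<in> B \<Longrightarrow> f (m a b) = f a"
    and g: "\<And>a. a \<in> A \<Longrightarrow> m g a \<in> A" "\<And>a. a \<in> A \<Longrightarrow> m g' a \<in> A"
      "\<And>a. m g (m g' a) = a" "\<And>a. m g' (m g a) = a"
  shows "(\<Sum>r\<in>R. f (m g r)) = sum f R"
proof -
  note RD = transversalD[OF R]
  have assoc: "m (m a b) c = m a (m b c)" for a b c
    using B unfolding is_subgroup_def by blast
  have "transversal m A B (m g ` R)"
    unfolding transversal_def
  proof (intro conjI ballI impI)
    show "m g ` R \<subseteq> A" using RD(1) g(1) by blast
  next
    fix a assume "a \<in> A"
    then obtain r b where rb: "r \<in> R" "b \<in> B" "m g' a = m r b" using RD(2) g(2) by blast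
    then have "a = m (m g r) b" using g(3)[of a] by (simp add: assoc)
    then show "\<exists>r\<in>m g ` R. \<exists>b\<in>B. a = m r b" using rb by blast
  next
    fix r r' b assume "r \<in> m g ` R" "r' \<in> m g ` R" and b: "b \<in> B" "r' = m r b"
    then obtain s s' where s: "s \<in> R" "s' \<in> R" "r = m g s" "r' = m g s'" by blast
    then have "m g' (m g s') = m g' (m g (m s b))" using b by (simp add: assoc)
    then have "s' = m s b" by (simp add: g(4))
    then show "r' = r" using RD(3) s b by metis
  qed
  from coset_sum_transversal[where f = f, OF B this f] coset_sum_transversal[where f = f, OF B R f]
  have "sum f (m g ` R) = sum f R" by simp
  moreover have "inj_on (m g) R" using g(4) by (rule inj_on_inverseI)
  ultimately show ?thesis by (simp add: sum.reindex)
qed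

context unram_ext
begin

lemma is_subgroup_idealE: "is_subgroup (+) (idealE E n)"
  unfolding is_subgroup_def
proof (intro conjI)
  show "\<exists>e\<in>idealE E n. (\<forall>a. a + e = a) \<and> (\<forall>b\<in>idealE E n. \<exists>b'\<in>idealE E n. b + b' = e)"
  proof (rule bexI[of _ 0], intro conjI ballI)
    fix b assume "b \<in> idealE E n"
    then show "\<exists>b'\<in>idealE E n. b + b' = 0" by (intro bexI[of _ "- b"]) auto
  qed auto
qed (auto intro: idealE_add simp: add.assoc)

lemma is_subgroup_idealF: "is_subgroup (+) (idealF E n)"
  unfolding is_subgroup_def
proof (intro conjI)
  show "\<exists>e\<in>idealF E n. (\<forall>a. a + e = a) \<and> (\<forall>b\<in>idealF E n. \<exists>b'\<in>idealF E n. b + b' = e)"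
  proof (rule bexI[of _ 0], intro conjI ballI)
    fix b assume "b \<in> idealF E n"
    then show "\<exists>b'\<in>idealF E n. b + b' = 0" by (intro bexI[of _ "- b"]) auto
  qed auto
qed (auto intro: idealF_add simp: add.assoc)

text \<open>Scaling by a power of the uniformizer reduces the graded pieces of the filtration to the residue
  field.\<close>

lemma transversal_idealF_1:
  "\<exists>R. transversal (+) (idealF E a) (idealF E (a + 1)) R \<and> finite R \<and> card R = q"
proof -
  obtain R :: "'f set" where R: "finite R" "card R = q" "R \<subseteq> ring_of_integers"
    "\<And>x. x \<in> ring_of_integers \<Longrightarrow> \<exists>r\<in>R. vabs (x - r) < 1"
    "\<And>r r'. r \<in> R \<Longrightarrow> r' \<in> R \<Longrightarrow> vabs (r' - r) < 1 \<Longrightarrow> r' = r"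
    using residue_reps[where 'a = 'f] unfolding q_eq by blast
  let ?s = "\<lambda>x. uF powi a * x"
  have "transversal (+) (idealF E a) (idealF E (a + 1)) (?s ` R)"
    unfolding transversal_def
  proof (intro conjI ballI impI)
    show "?s ` R \<subseteq> idealF E a"
      using R(3) by (auto simp: idealF_uF_powi_mult integers_eq_idealF)
  next
    fix x assume "x \<in> idealF E a"
    then have "uF powi (- a) * x \<in> ring_of_integers"
      by (simp add: idealF_uF_powi_mult integers_eq_idealF)
    then obtain r where r: "r \<in> R" "vabs (uF powi (- a) * x - r) < 1" using R(4) by blast
    have "?s (uF powi (- a) * x - r) \<in> idealF E (a + 1)"
      using r(2) by (simp only: idealF_uF_powi_mult) (simp add: idealF_1_iff)
    moreover have "x = ?s r + ?s (uF powi (- a) * x - r)"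
      by (simp add: right_diff_distrib power_int_minus mult.assoc[symmetric])
    ultimately show "\<exists>r\<in>?s ` R. \<exists>b\<in>idealF E (a + 1). x = r + b" using r(1) by blast
  next
    fix r r' b assume "r \<in> ?s ` R" "r' \<in> ?s ` R" and b: "b \<in> idealF E (a + 1)" "r' = r + b"
    then obtain t t' where t: "t \<in> R" "t' \<in> R" "r = ?s t" "r' = ?s t'" by blast
    have "b = r' - r" using b(2) by simp
    then have "?s (t' - t) = b" by (simp add: t right_diff_distrib)
    then have "t' - t \<in> idealF E 1" using b(1) idealF_uF_powi_mult[of a "t' - t" "a + 1"] by simp
    then show "r' = r" using R(5) t by (auto simp: idealF_1_iff)
  qed
  moreover have "card (?s ` R) = q" using R(2) by (subst card_image) (auto intro!: inj_onI)
  ultimately show ?thesis using R(1) by blast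
qed

lemma transversal_idealF:
  "\<exists>R. transversal (+) (idealF E a) (idealF E (a + int k)) R \<and> finite R \<and> card R = q ^ k"
proof (induction k)
  case 0
  have "transversal (+) (idealF E a) (idealF E a) {0}"
    unfolding transversal_def by auto
  then show ?case by (intro exI[of _ "{0}"]) simp
next
  case (Suc k)
  then obtain R where R: "transversal (+) (idealF E a) (idealF E (a + int k)) R"
      "finite R" "card R = q ^ k" by blast
  obtain S where S: "transversal (+) (idealF E (a + int k)) (idealF E (a + int k + 1)) S"
      "finite S" "card S = q" using transversal_idealF_1 by blast
  note RD = transversalD[OF R(1)] and SD = transversalD[OF S(1)]
  let ?p = "\<lambda>(r, s). r + s"
  have eq: "r' = r \<and> s' = s" if "r \<in> R" "s \<in> S" "r' \<in> R" "s' \<in> S" "r' + s' = r + s + b"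
    "b \<in> idealF E (a + int k + 1)" for r s r' s' b
  proof -
    have "s - s' + b \<in> idealF E (a + int k)"
      using that SD(1) idealF_mono[OF that(6), of "a + int k"] by (intro idealF_add idealF_diff) auto
    moreover have "r' = r + (s - s' + b)" using that(5) by (simp add: algebra_simps)
    ultimately have "r' = r" using RD(3) that by blast
    moreover from this have "s' = s + b" using that(5) by (simp add: algebra_simps)
    ultimately show ?thesis using SD(3) that by blast
  qed
  have "transversal (+) (idealF E a) (idealF E (a + int (Suc k))) (?p ` (R \<times> S))"
    unfolding transversal_def
  proof (intro conjI ballI impI)
    show "?p ` (R \<times> S) \<subseteq> idealF E a"
    proof clarsimp
      fix r s assume "r \<in> R" "s \<in> S"
      then have "s \<in> idealF E (a + int k)" using SD(1) by blast
      then have "s \<in> idealF E a" by (rule idealF_mono) simp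
      then show "r + s \<in> idealF E a" using RD(1) \<open>r \<in> R\<close> by (intro idealF_add) auto
    qed
  next
    fix x assume "x \<in> idealF E a"
    then obtain r b where r: "r \<in> R" "b \<in> idealF E (a + int k)" "x = r + b" using RD(2) by blast
    then obtain s c where "s \<in> S" "c \<in> idealF E (a + int k + 1)" "b = s + c" using SD(2) by blast
    then show "\<exists>r\<in>?p ` (R \<times> S). \<exists>b\<in>idealF E (a + int (Suc k)). x = r + b"
      using r by (intro bexI[of _ "r + s"] bexI[of _ c]) (auto simp: algebra_simps)
  next
    fix x x' b assume "x \<in> ?p ` (R \<times> S)" "x' \<in> ?p ` (R \<times> S)"
      and b: "b \<in> idealF E (a + int (Suc k))" "x' = x + b"
    then obtain r s r' s' where rs: "r \<in> R" "s \<in> S" "r' \<in> R" "s' \<in> S" "x = r + s" "x' = r' + s'"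
      by auto
    have "b \<in> idealF E (a + int k + 1)" using b(1) by (simp add: algebra_simps)
    from eq[OF rs(1-4) _ this] show "x' = x" using rs b(2) by simp
  qed
  moreover have "inj_on ?p (R \<times> S)" using eq[of _ _ _ _ 0] by (auto intro!: inj_onI)
  then have "card (?p ` (R \<times> S)) = q ^ Suc k"
    by (simp add: card_image card_cartesian_product R S)
  ultimately show ?case using R(2) S(2) by blast
qed

lemma transversal_idealE_1:
  "\<exists>R. transversal (+) (idealE E 0) (idealE E 1) R \<and> finite R \<and> card R = q\<^sup>2"
proof -
  obtain R where R: "transversal (+) (idealF E 0) (idealF E 1) R" "finite R" "card R = q"
    using transversal_idealF_1[of 0] by auto
  note RD = transversalD[OF R(1)]
  let ?p = "\<lambda>(a, b). j a + j b * se"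
  have inj: "inj_on ?p (R \<times> R)"
    by (rule inj_onI) (use coords_unique in auto)
  have "transversal (+) (idealE E 0) (idealE E 1) (?p ` (R \<times> R))"
    unfolding transversal_def
  proof (intro conjI ballI impI)
    show "?p ` (R \<times> R) \<subseteq> idealE E 0"
      using RD(1) by (auto simp: idealE_coords reF_coords imF_coords)
  next
    fix z assume "z \<in> idealE E 0"
    then have "reF z \<in> idealF E 0" "imF z \<in> idealF E 0" by (simp_all add: idealE_coords)
    then obtain r b s c where rs: "r \<in> R" "b \<in> idealF E 1" "reF z = r + b"
        "s \<in> R" "c \<in> idealF E 1" "imF z = s + c" using RD(2) by metis
    have "z = (j r + j s * se) + (j b + j c * se)"
      using coords[of z] rs(3,6) by (simp add: emb_add algebra_simps)
    moreover have "j b + j c * se \<in> idealE E 1" using rs by (simp add: idealE_coords reF_coords imF_coords)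
    moreover have "j r + j s * se \<in> ?p ` (R \<times> R)" using rs by (intro image_eqI[of _ _ "(r, s)"]) auto
    ultimately show "\<exists>r\<in>?p ` (R \<times> R). \<exists>b\<in>idealE E 1. z = r + b" by blast
  next
    fix z z' b assume "z \<in> ?p ` (R \<times> R)" "z' \<in> ?p ` (R \<times> R)" and b: "b \<in> idealE E 1" "z' = z + b"
    then obtain r s r' s' where rs: "r \<in> R" "s \<in> R" "r' \<in> R" "s' \<in> R" "z = j r + j s * se"
      "z' = j r' + j s' * se" by auto
    have "j r' + j s' * se = j (r + reF b) + j (s + imF b) * se"
      using rs b(2) coords[of b] by (simp add: emb_add algebra_simps)
    then have "r' = r + reF b" "s' = s + imF b" using coords_unique by blast+
    moreover have "reF b \<in> idealF E 1" "imF b \<in> idealF E 1" using b(1) by (simp_all add: idealE_coords)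
    ultimately have "r' = r" "s' = s" using RD(3) rs by blast+
    then show "z' = z" using rs by simp
  qed
  moreover have "card (?p ` (R \<times> R)) = q\<^sup>2"
    using inj by (simp add: card_image card_cartesian_product R power2_eq_square)
  ultimately show ?thesis using R(2) by blast
qed

end

section \<open>The unitary group\<close>

definition mat3 :: "'a \<Rightarrow> 'a \<Rightarrow> 'a \<Rightarrow> 'a \<Rightarrow> 'a \<Rightarrow> 'a \<Rightarrow> 'a \<Rightarrow> 'a \<Rightarrow> 'a \<Rightarrow> 'a::zero^3^3" where
  "mat3 a b c d e f g h i = vector [vector [a, b, c], vector [d, e, f], vector [g, h, i]]"

lemma mat3_nth [simp]:
  "mat3 a b c d e f g h i $ 1 $ 1 = a" "mat3 a b c d e f g h i $ 1 $ 2 = b"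
  "mat3 a b c d e f g h i $ 1 $ 3 = c" "mat3 a b c d e f g h i $ 2 $ 1 = d"
  "mat3 a b c d e f g h i $ 2 $ 2 = e" "mat3 a b c d e f g h i $ 2 $ 3 = f"
  "mat3 a b c d e f g h i $ 3 $ 1 = g" "mat3 a b c d e f g h i $ 3 $ 2 = h"
  "mat3 a b c d e f g h i $ 3 $ 3 = i"
  by (simp_all add: mat3_def)

lemma mat3_cong_iff:
  "A = B \<longleftrightarrow> A$1$1 = B$1$1 \<and> A$1$2 = B$1$2 \<and> A$1$3 = B$1$3 \<and> A$2$1 = B$2$1 \<and> A$2$2 = B$2$2 \<and>
     A$2$3 = B$2$3 \<and> A$3$1 = B$3$1 \<and> A$3$2 = B$3$2 \<and> A$3$3 = (B :: 'a^3^3)$3$3"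
  by (auto simp: vec_eq_iff forall_3)

lemma mult_nth3: "(A ** B) $ i $ k = A$i$1 * B$1$k + A$i$2 * B$2$k + A$i$3 * (B :: 'a::semiring_1^3^3)$3$k"
  by (simp add: matrix_matrix_mult_def sum_3)

lemma mat3_mult:
  "mat3 a b c d e f g h i ** mat3 a' b' c' d' e' f' g' h' i' =
   mat3 (a * a' + b * d' + c * g') (a * b' + b * e' + c * h') (a * c' + b * f' + c * i')
        (d * a' + e * d' + f * g') (d * b' + e * e' + f * h') (d * c' + e * f' + f * i')
        (g * a' + h * d' + i * g') (g * b' + h * e' + i * h') (g * c' + h * f' + i * (i'::'a::semiring_1))"
  by (simp add: mat3_cong_iff mult_nth3)

lemma mat3_1: "mat 1 = (mat3 1 0 0 0 1 0 0 0 1 :: 'a::semiring_1^3^3)"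
  by (simp add: mat3_cong_iff mat_def)

lemma mat_1_nth [simp]:
  "(mat 1 :: 'a::zero_neq_one^3^3) $ 1 $ 1 = 1" "(mat 1 :: 'a^3^3) $ 1 $ 2 = 0" "(mat 1 :: 'a^3^3) $ 1 $ 3 = 0"
  "(mat 1 :: 'a^3^3) $ 2 $ 1 = 0" "(mat 1 :: 'a^3^3) $ 2 $ 2 = 1" "(mat 1 :: 'a^3^3) $ 2 $ 3 = 0"
  "(mat 1 :: 'a^3^3) $ 3 $ 1 = 0" "(mat 1 :: 'a^3^3) $ 3 $ 2 = 0" "(mat 1 :: 'a^3^3) $ 3 $ 3 = 1"
  by (simp_all add: mat_def)

lemma mat3_eq_iff:
  "mat3 a b c d e f g h i = mat3 a' b' c' d' e' f' g' h' i' \<longleftrightarrow>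
   a = a' \<and> b = b' \<and> c = c' \<and> d = d' \<and> e = e' \<and> f = f' \<and> g = g' \<and> h = h' \<and> i = i'"
  by (simp add: mat3_cong_iff)

lemma matJ_mat3: "matJ = mat3 0 0 1 0 1 0 1 0 0"
  by (simp add: matJ_def mat3_def)

lemma umat_mat3: "umat E x y = mat3 1 x (emb E y * sqrt_eps E - x * conjE E x / 2) 0 1 (- conjE E x) 0 0 1"
  by (simp add: umat_def mat3_def)

context unram_ext
begin

text \<open>The product of \<open>J\<close>, the conjugate transpose of \<open>g\<close>, and \<open>J\<close>: the inverse of \<open>g\<close> if \<open>g\<close> is
  unitary. It permutes the entries of \<open>g\<close>, so the groups below are visibly closed under inverses.\<close>

definition ustar :: "'e^3^3 \<Rightarrow> 'e^3^3" where
  "ustar g = mat3 (cj (g$3$3)) (cj (g$2$3)) (cj (g$1$3)) (cj (g$3$2)) (cj (g$2$2)) (cj (g$1$2))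
                  (cj (g$3$1)) (cj (g$2$1)) (cj (g$1$1))"

lemma ustar_nth [simp]:
  "ustar g $ 1 $ 1 = cj (g$3$3)" "ustar g $ 1 $ 2 = cj (g$2$3)" "ustar g $ 1 $ 3 = cj (g$1$3)"
  "ustar g $ 2 $ 1 = cj (g$3$2)" "ustar g $ 2 $ 2 = cj (g$2$2)" "ustar g $ 2 $ 3 = cj (g$1$2)"
  "ustar g $ 3 $ 1 = cj (g$3$1)" "ustar g $ 3 $ 2 = cj (g$2$1)" "ustar g $ 3 $ 3 = cj (g$1$1)"
  by (simp_all add: ustar_def)

lemma ustar_mult: "ustar (g ** h) = ustar h ** ustar g"
  by (simp add: mat3_cong_iff mult_nth3 cj_add cj_mult algebra_simps)

lemma ustar_ustar [simp]: "ustar (ustar g) = g"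
  by (simp add: mat3_cong_iff)

lemma ustar_1 [simp]: "ustar (mat 1) = mat 1"
  by (simp add: mat3_cong_iff mat3_1)

lemma unitary_iff: "g \<in> unitary_group E \<longleftrightarrow> ustar g ** g = mat 1"
proof -
  have J: "matJ ** matJ = (mat 1 :: 'e^3^3)" by (simp add: matJ_mat3 mat3_mult mat3_1)
  let ?X = "transpose (\<chi> i k. cj (g $ i $ k))"
  have star: "ustar g = matJ ** ?X ** matJ"
    by (simp add: mat3_cong_iff mult_nth3 matJ_mat3 transpose_def)
  have cancel: "matJ ** A = matJ ** B \<longleftrightarrow> A = B" for A B :: "'e^3^3"
  proof
    assume "matJ ** A = matJ ** B"
    then have "matJ ** (matJ ** A) = matJ ** (matJ ** B)" by simp
    then show "A = B" by (simp only: matrix_mul_assoc J matrix_mul_lid)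
  qed simp
  have "?X ** matJ ** g = matJ \<longleftrightarrow> matJ ** (?X ** matJ ** g) = matJ ** matJ"
    by (rule cancel[symmetric])
  also have "\<dots> \<longleftrightarrow> ustar g ** g = mat 1" by (simp add: star matrix_mul_assoc J)
  finally have "?X ** matJ ** g = matJ \<longleftrightarrow> ustar g ** g = mat 1" .
  moreover have "ustar g ** g = mat 1 \<Longrightarrow> invertible g"
    by (metis invertible_def matrix_left_right_inverse)
  ultimately show ?thesis unfolding unitary_group_def by blast
qed

lemma ustar_left: "g \<in> unitary_group E \<Longrightarrow> ustar g ** g = mat 1"
  and ustar_right: "g \<in> unitary_group E \<Longrightarrow> g ** ustar g = mat 1"
  by (simp_all add: unitary_iff matrix_left_right_inverse[of "ustar g"])

lemma unitary_mult: "g \<in> unitary_group E \<Longrightarrow> h \<in> unitary_group E \<Longrightarrow> g ** h \<in> unitary_group E"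
  unfolding unitary_iff ustar_mult by (metis matrix_mul_assoc matrix_mul_lid)

lemma unitary_ustar: "g \<in> unitary_group E \<Longrightarrow> ustar g \<in> unitary_group E"
  using ustar_right by (simp add: unitary_iff)

lemma unitary_1 [simp]: "mat 1 \<in> unitary_group E"
  by (simp add: unitary_iff)

lemma unitary_rel:
  assumes "g \<in> unitary_group E"
  shows "cj (g$3$3) * g$1$1 + cj (g$2$3) * g$2$1 + cj (g$1$3) * g$3$1 = 1"
    "cj (g$3$3) * g$1$3 + cj (g$2$3) * g$2$3 + cj (g$1$3) * g$3$3 = 0"
    "cj (g$3$2) * g$1$3 + cj (g$2$2) * g$2$3 + cj (g$1$2) * g$3$3 = 0"
    "cj (g$3$2) * g$1$2 + cj (g$2$2) * g$2$2 + cj (g$1$2) * g$3$2 = 1"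
    "cj (g$3$1) * g$1$1 + cj (g$2$1) * g$2$1 + cj (g$1$1) * g$3$1 = 0"
    "cj (g$3$1) * g$1$3 + cj (g$2$1) * g$2$3 + cj (g$1$1) * g$3$3 = 1"
  using ustar_left[OF assms] by (simp_all add: mat3_cong_iff mult_nth3 mat3_1)

text \<open>\<open>weyl n\<close> lies in \<open>K\<^sub>n\<close> and the product of two such elements is a power of \<open>\<zeta>\<close>; this is how
  the levels \<open>N\<close> and \<open>N + 1\<close> communicate.\<close>

definition zeta_pow :: "int \<Rightarrow> 'e^3^3" where
  "zeta_pow i = mat3 (uE powi i) 0 0 0 1 0 0 0 (uE powi (- i))"

definition weyl :: "int \<Rightarrow> 'e^3^3" where
  "weyl n = mat3 0 0 (uE powi (- n)) 0 1 0 (uE powi n) 0 0"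

lemma zeta_pow_unitary [simp]: "zeta_pow i \<in> unitary_group E"
  and weyl_unitary [simp]: "weyl n \<in> unitary_group E"
  by (simp_all add: unitary_iff mat3_cong_iff mult_nth3 zeta_pow_def weyl_def power_int_minus cj_inverse)

lemma cj_half: "cj (z / 2) = cj z / 2"
  by (simp add: cj_divide)

lemma two_nonzero [simp]: "(2::'e) \<noteq> 0"
  using vabs_two_E by (metis vabs_zero zero_neq_one)

lemma umat_unitary [simp]: "umat E x y \<in> unitary_group E"
  by (simp add: unitary_iff mat3_cong_iff mult_nth3 mat3_1 umat_mat3 cj_minus cj_diff cj_mult cj_half)

lemma zeta_pow_add: "zeta_pow i ** zeta_pow k = zeta_pow (i + k)"
  by (simp add: zeta_pow_def mat3_mult mat3_eq_iff power_int_add power_int_diff power_int_minus divide_inverse)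

lemma zeta_pow_0: "zeta_pow 0 = mat 1"
  by (simp add: zeta_pow_def mat3_1)

lemma zeta_mat_zeta_pow: "zeta_mat E = zeta_pow 1"
  by (simp add: zeta_pow_def zeta_mat_def mat3_def power_int_minus)

lemma zeta_pow_inverse: "zeta_pow i ** zeta_pow (- i) = mat 1" "zeta_pow (- i) ** zeta_pow i = mat 1"
  by (simp_all add: zeta_pow_add zeta_pow_0)

lemma inverse_zeta_mat: "matrix_inv (zeta_mat E) = zeta_pow (- 1)"
proof -
  have "zeta_pow 1 ** matrix_inv (zeta_pow 1) = mat 1"
    unfolding matrix_inv_def by (rule someI2[of _ "zeta_pow (- 1)"]) (simp_all add: zeta_pow_inverse)
  then have "zeta_pow (- 1) ** (zeta_pow 1 ** matrix_inv (zeta_pow 1)) = zeta_pow (- 1)" by simp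
  then show ?thesis by (simp only: zeta_mat_zeta_pow matrix_mul_assoc zeta_pow_inverse matrix_mul_lid)
qed

lemma weyl_mult: "weyl n ** weyl m = zeta_pow (m - n)"
  by (simp add: weyl_def zeta_pow_def mat3_mult mat3_eq_iff power_int_diff power_int_minus divide_inverse mult.commute)

lemma weyl_weyl: "weyl n ** weyl n = mat 1"
  by (simp add: weyl_mult zeta_pow_0)

lemma ustar_umat: "ustar (umat E x y) = umat E (- x) (- y)"
  by (simp add: umat_mat3 ustar_def mat3_eq_iff cj_minus cj_diff cj_mult cj_half emb_minus)

lemma umat_inverse: "umat E x y ** umat E (- x) (- y) = mat 1" "umat E (- x) (- y) ** umat E x y = mat 1"
  using ustar_right[of "umat E x y"] ustar_left[of "umat E x y"] by (simp_all add: ustar_umat)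

lemma umat_0_add: "umat E 0 y ** umat E 0 y' = umat E 0 (y + y')"
  by (simp add: umat_mat3 mat3_mult mat3_eq_iff emb_add algebra_simps)

lemma umat_0_0 [simp]: "umat E 0 0 = mat 1"
  by (simp add: umat_mat3 mat3_1)

lemma zeta_pow_umat: "zeta_pow i ** umat E x y = umat E (uE powi i * x) (uF powi (2 * i) * y) ** zeta_pow i"
proof -
  define c where "c = uE powi i"
  have c: "c \<noteq> 0" "cj c = c" by (simp_all add: c_def)
  have zeta_pow: "zeta_pow i = mat3 c 0 0 0 1 0 0 0 (inverse c)"
    by (simp add: zeta_pow_def c_def power_int_minus)
  have "uE powi (2 * i) = c * c"
    unfolding c_def mult_2 by (rule power_int_add) simp
  then have y: "j (uF powi (2 * i) * y) = c * c * j y"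
    by (simp add: emb_mult emb_powi unifE_def)
  show ?thesis
    unfolding umat_mat3 zeta_pow mat3_mult mat3_eq_iff y c_def[symmetric] cj_mult c(2)
    using c(1) by (simp add: field_simps)
qed

lemma umat_eq_iff: "umat E x y = umat E x' y' \<longleftrightarrow> x = x' \<and> y = y'"
  by (auto simp: umat_mat3 mat3_eq_iff)

section \<open>The groups fixing newforms\<close>

lemma Kgrp_iff:
  "g \<in> Kgrp E n \<longleftrightarrow> g \<in> unitary_group E \<and>
     g$1$1 \<in> idealE E 0 \<and> g$1$2 \<in> idealE E 0 \<and> g$1$3 \<in> idealE E (- int n) \<and>
     g$2$1 \<in> idealE E (int n) \<and> g$2$2 - 1 \<in> idealE E (int n) \<and> g$2$3 \<in> idealE E 0 \<and>
     g$3$1 \<in> idealE E (int n) \<and> g$3$2 \<in> idealE E (int n) \<and> g$3$3 \<in> idealE E 0"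
  by (simp add: Kgrp_def integers_eq_idealE)

lemma one_in_idealE [simp]: "1 \<in> idealE E n \<longleftrightarrow> n \<le> 0"
  using uE_powi_in[of 0 n] by simp

lemma Kgrp_22: "g \<in> Kgrp E n \<Longrightarrow> g$2$2 \<in> idealE E 0"
proof -
  assume "g \<in> Kgrp E n"
  then have "g$2$2 - 1 \<in> idealE E 0"
    using idealE_mono[of "g$2$2 - 1" "int n" 0] by (simp add: Kgrp_iff)
  from idealE_add[OF this, of 1] show ?thesis by simp
qed

lemma Kgrp_unitary: "g \<in> Kgrp E n \<Longrightarrow> g \<in> unitary_group E"
  by (simp add: Kgrp_iff)

lemma Kgrp_1 [simp]: "mat 1 \<in> Kgrp E n"
  by (simp add: Kgrp_iff)

lemma Kgrp_ustar: "g \<in> Kgrp E n \<Longrightarrow> ustar g \<in> Kgrp E n"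
proof -
  assume "g \<in> Kgrp E n"
  moreover have "cj (g$2$2) - 1 = cj (g$2$2 - 1)" by (simp add: cj_diff)
  ultimately show ?thesis unfolding Kgrp_iff by (simp add: unitary_ustar)
qed

lemma mult_nth_in:
  fixes g h :: "'e^3^3"
  assumes "g$i$1 \<in> idealE E aa" "g$i$2 \<in> idealE E ab" "g$i$3 \<in> idealE E ac"
    and "h$1$k \<in> idealE E ba" "h$2$k \<in> idealE E bb" "h$3$k \<in> idealE E bc"
    and "c \<le> aa + ba" "c \<le> ab + bb" "c \<le> ac + bc"
  shows "(g ** h)$i$k \<in> idealE E c"
  unfolding mult_nth3 using assms by (intro idealE_add) (auto intro: idealE_mult)

lemma Kgrp_mult:
  assumes g: "g \<in> Kgrp E n" and h: "h \<in> Kgrp E n" shows "g ** h \<in> Kgrp E n"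
proof -
  note g' = g[unfolded Kgrp_iff] Kgrp_22[OF g] and h' = h[unfolded Kgrp_iff] Kgrp_22[OF h]
  have eq: "(g ** h)$2$2 - 1 = g$2$1 * h$1$2 + (g$2$2 - 1) * h$2$2 + (h$2$2 - 1) + g$2$3 * h$3$2"
    by (simp add: mult_nth3 algebra_simps)
  have 22: "(g ** h)$2$2 - 1 \<in> idealE E (int n)"
    unfolding eq
    by (intro idealE_add idealE_mult[of "g$2$1" "int n" _ 0] idealE_mult[of "g$2$3" 0 _ "int n"]
        idealE_mult[of "g$2$2 - 1" "int n" _ 0]) (use g' h' in auto)
  show ?thesis
    unfolding Kgrp_iff
  proof (intro conjI 22)
    show "g ** h \<in> unitary_group E" using g' h' by (simp add: unitary_mult)
    show "(g ** h)$1$1 \<in> idealE E 0"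
      by (rule mult_nth_in[where aa = "0" and ba = "0"
          and ab = "0" and bb = "int n"
          and ac = "- int n" and bc = "int n"])
         (use g' h' in auto)
    show "(g ** h)$1$2 \<in> idealE E 0"
      by (rule mult_nth_in[where aa = "0" and ba = "0"
          and ab = "0" and bb = "0"
          and ac = "- int n" and bc = "int n"])
         (use g' h' in auto)
    show "(g ** h)$1$3 \<in> idealE E (- int n)"
      by (rule mult_nth_in[where aa = "0" and ba = "- int n"
          and ab = "0" and bb = "0"
          and ac = "- int n" and bc = "0"])
         (use g' h' in auto)
    show "(g ** h)$2$1 \<in> idealE E (int n)"
      by (rule mult_nth_in[where aa = "int n" and ba = "0"
          and ab = "0" and bb = "int n"
          and ac = "0" and bc = "int n"])
         (use g' h' in auto)
    show "(g ** h)$2$3 \<in> idealE E 0"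
      by (rule mult_nth_in[where aa = "int n" and ba = "- int n"
          and ab = "0" and bb = "0"
          and ac = "0" and bc = "0"])
         (use g' h' in auto)
    show "(g ** h)$3$1 \<in> idealE E (int n)"
      by (rule mult_nth_in[where aa = "int n" and ba = "0"
          and ab = "int n" and bb = "int n"
          and ac = "0" and bc = "int n"])
         (use g' h' in auto)
    show "(g ** h)$3$2 \<in> idealE E (int n)"
      by (rule mult_nth_in[where aa = "int n" and ba = "0"
          and ab = "int n" and bb = "0"
          and ac = "0" and bc = "int n"])
         (use g' h' in auto)
    show "(g ** h)$3$3 \<in> idealE E 0"
      by (rule mult_nth_in[where aa = "int n" and ba = "- int n"
          and ab = "int n" and bb = "0"
          and ac = "0" and bc = "0"])
         (use g' h' in auto)
  qed
qed

lemma is_subgroup_matrices: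
  assumes "mat 1 \<in> B" "\<And>g h. g \<in> B \<Longrightarrow> h \<in> B \<Longrightarrow> g ** h \<in> B" "\<And>g. g \<in> B \<Longrightarrow> ustar g \<in> B"
    "B \<subseteq> unitary_group E"
  shows "is_subgroup (**) (B :: ('e^3^3) set)"
  unfolding is_subgroup_def
proof (intro conjI)
  show "\<exists>e\<in>B. (\<forall>a. a ** e = a) \<and> (\<forall>b\<in>B. \<exists>b'\<in>B. b ** b' = e)"
  proof (rule bexI[of _ "mat 1"], intro conjI ballI)
    fix b assume "b \<in> B"
    then show "\<exists>b'\<in>B. b ** b' = mat 1"
      using assms(3,4) ustar_right by (intro bexI[of _ "ustar b"]) auto
  qed (simp_all add: assms)
qed (simp_all add: assms matrix_mul_assoc)

lemma uE_power_in [simp]: "uE ^ n \<in> idealE E m \<longleftrightarrow> m \<le> int n"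
  using uE_powi_in[of "int n" m] by simp

lemma idealE_uE_power_mult: "uE ^ n * x \<in> idealE E m \<longleftrightarrow> x \<in> idealE E (m - int n)"
  using idealE_uE_powi_mult[of "int n" x m] by simp

lemma weyl_Kgrp [simp]: "weyl (int n) \<in> Kgrp E n"
  by (simp add: Kgrp_iff) (simp add: weyl_def)

lemma umat_13_in: "x \<in> idealE E 0 \<Longrightarrow> y \<in> idealF E a \<Longrightarrow> a \<le> 0 \<Longrightarrow> j y * se - x * cj x / 2 \<in> idealE E a"
  using idealE_mult[of x 0 "cj x" 0 a] by (intro idealE_diff) (auto simp: idealE_se idealE_half)

lemma umat_Kgrp: "x \<in> idealE E 0 \<Longrightarrow> y \<in> idealF E (- int n) \<Longrightarrow> umat E x y \<in> Kgrp E n"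
  using umat_13_in[of x y "- int n"] by (simp add: Kgrp_iff) (simp add: umat_mat3)

text \<open>The subgroups \<open>K\<^sub>n \<inter> K\<^sub>n\<^sub>-\<^sub>1\<close> (\<open>m = 1\<close>, \<open>k = 0\<close>), \<open>K\<^sub>n \<inter> \<zeta> K\<^sub>n \<zeta>\<^sup>-\<^sup>1\<close> (\<open>m = 2\<close>, \<open>k = 1\<close>) and, up to
  conjugation, \<open>K\<^sub>n \<inter> Z\<^sub>n K\<^sub>n\<^sub>+\<^sub>1\<close> (\<open>m = 1\<close>, \<open>k = 1\<close>), treated together.\<close>

definition Dgrp :: "nat \<Rightarrow> nat \<Rightarrow> nat \<Rightarrow> ('e^3^3) set" where
  "Dgrp n m k = {g \<in> Kgrp E n. g$1$2 \<in> idealE E (int k) \<and> g$2$3 \<in> idealE E (int k) \<and>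
                  g$1$3 \<in> idealE E (int m - int n)}"

lemma Dgrp_subgroup:
  assumes "k \<le> m" "m \<le> n" shows "is_subgroup (**) (Dgrp n m k)"
proof (rule is_subgroup_matrices)
  show "mat 1 \<in> Dgrp n m k" by (simp add: Dgrp_def)
  show "Dgrp n m k \<subseteq> unitary_group E" by (auto simp: Dgrp_def Kgrp_iff)
  show "ustar g \<in> Dgrp n m k" if "g \<in> Dgrp n m k" for g
    using that by (simp add: Dgrp_def Kgrp_ustar)
  show "g ** h \<in> Dgrp n m k" if g: "g \<in> Dgrp n m k" and h: "h \<in> Dgrp n m k" for g h
  proof -
    have gK: "g \<in> Kgrp E n" and hK: "h \<in> Kgrp E n" using g h by (auto simp: Dgrp_def)
    note g' = g[unfolded Dgrp_def] gK[unfolded Kgrp_iff] Kgrp_22[OF gK]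
      and h' = h[unfolded Dgrp_def] hK[unfolded Kgrp_iff] Kgrp_22[OF hK]
    have 1: "(g ** h)$1$2 \<in> idealE E (int k)"
      by (rule mult_nth_in[where aa = "0" and ba = "int k"
          and ab = "int k" and bb = "0"
          and ac = "int m - int n" and bc = "int n"])
         (use g' h' assms in auto)
    have 2: "(g ** h)$2$3 \<in> idealE E (int k)"
      by (rule mult_nth_in[where aa = "int n" and ba = "int m - int n"
          and ab = "0" and bb = "int k"
          and ac = "int k" and bc = "0"])
         (use g' h' assms in auto)
    have 3: "(g ** h)$1$3 \<in> idealE E (int m - int n)"
      by (rule mult_nth_in[where aa = "0" and ba = "int m - int n"
          and ab = "int k" and bb = "int k"
          and ac = "int m - int n" and bc = "0"])
         (use g' h' assms in auto)
    show ?thesis using 1 2 3 Kgrp_mult[OF gK hK] by (simp add: Dgrp_def)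
  qed
qed

lemma vabs_mult_unit:
  assumes "cj a * b = 1 + - x" "vabs (- x) < 1" shows "vabs a * vabs b = 1"
proof -
  have "vabs (cj a * b) = 1" unfolding assms(1) using vabs_add_eq[of "- x" 1] assms(2) by simp
  then show ?thesis by (simp add: vabs_mult)
qed

lemma Dgrp_unit:
  assumes b: "b \<in> Dgrp n m k" and mn: "1 \<le> m" "m \<le> n" shows "vabs (b$3$3) = 1"
proof -
  have K: "b \<in> Kgrp E n" "b$1$3 \<in> idealE E (int m - int n)" using b by (auto simp: Dgrp_def)
  note K' = K(1)[unfolded Kgrp_iff] K(2)
  have "cj (b$3$1) * b$1$3 + cj (b$2$1) * b$2$3 \<in> idealE E 1"
    by (intro idealE_add idealE_mult[where a = "int n" and b = "int m - int n"]
        idealE_mult[where a = "int n" and b = 0]) (use K' mn in auto)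
  then have lt: "vabs (- (cj (b$3$1) * b$1$3 + cj (b$2$1) * b$2$3)) < 1"
    by (simp only: vabs_minus idealE_1_iff)
  have eq: "cj (b$1$1) * b$3$3 = 1 + - (cj (b$3$1) * b$1$3 + cj (b$2$1) * b$2$3)"
    using unitary_rel(6)[of b] K' by (simp add: algebra_simps)
  have "vabs (b$1$1) * vabs (b$3$3) = 1" by (rule vabs_mult_unit[OF eq lt])
  moreover have "vabs (b$1$1) \<le> 1" "vabs (b$3$3) \<le> 1" using K' by (auto simp: idealE_iff)
  ultimately show ?thesis
    using mult_left_le_one_le[of "vabs (b$3$3)" "vabs (b$1$1)"] by simp
qed

text \<open>A non-unit lower right entry forces the entry in the upper right corner to be as large as
  possible; the Weyl element \<open>weyl n\<close> exchanges the two.\<close>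

lemma Kgrp_33_nonunit:
  assumes g: "g \<in> Kgrp E n" "1 \<le> n" and "g$3$3 \<in> idealE E 1"
  shows "vabs ((weyl (int n) ** g)$3$3) = 1" "(weyl (int n) ** g)$1$3 \<in> idealE E (1 - int n)"
    "vabs (g$3$1) * vabs (g$1$3) = 1"
proof -
  note K = g(1)[unfolded Kgrp_iff]
  have "cj (g$2$1) * g$2$3 + cj (g$1$1) * g$3$3 \<in> idealE E 1"
    by (intro idealE_add idealE_mult[where a = "int n" and b = 0] idealE_mult[where a = 0 and b = 1])
       (use K assms in auto)
  then have lt: "vabs (- (cj (g$2$1) * g$2$3 + cj (g$1$1) * g$3$3)) < 1"
    by (simp only: vabs_minus idealE_1_iff)
  have eq1: "cj (g$3$1) * g$1$3 = 1 + - (cj (g$2$1) * g$2$3 + cj (g$1$1) * g$3$3)"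
    using unitary_rel(6)[of g] K by (simp add: algebra_simps)
  show one: "vabs (g$3$1) * vabs (g$1$3) = 1" by (rule vabs_mult_unit[OF eq1 lt])
  have eq: "(weyl (int n) ** g)$3$3 = uE powi int n * g$1$3" "(weyl (int n) ** g)$1$3 = uE powi (- int n) * g$3$3"
    by (simp_all add: mult_nth3) (simp_all add: weyl_def)
  have *: "vabs (g$3$1) \<le> real q powi (- 2 * int n)" using K by (simp add: idealE_iff)
  have le: "vabs (uE powi int n * g$1$3) \<le> 1"
    using K idealE_uE_powi_mult[of "int n" "g$1$3" 0] idealE_iff[of _ 0] by simp
  have "1 \<le> real q powi (- 2 * int n) * vabs (g$1$3)"
    using mult_right_mono[OF *, of "vabs (g$1$3)"] one by simp
  then have "1 \<le> vabs (uE powi int n * g$1$3)" by (simp only: vabs_mult vabs_uE_powi)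
  then show "vabs ((weyl (int n) ** g)$3$3) = 1" using le eq by simp
  show "(weyl (int n) ** g)$1$3 \<in> idealE E (1 - int n)"
    unfolding eq idealE_uE_powi_mult using assms by simp
qed

text \<open>If the lower right entry is a unit, the third column is a multiple of that of some
  \<open>umat E x y\<close>, and \<open>x\<close>, \<open>y\<close> may be replaced by representatives.\<close>

lemma Kgrp_33_unit:
  assumes g: "g \<in> Kgrp E n" "vabs (g$3$3) = 1" and a: "g$1$3 \<in> idealE E a" "- int n \<le> a" "a \<le> 0"
    and k: "k \<le> m" "m \<le> n"
    and Rx: "transversal (+) (idealE E 0) (idealE E (int k)) Rx"
    and Ry: "transversal (+) (idealF E a) (idealF E (int m - int n)) Ry"
  obtains x y where "x \<in> Rx" "y \<in> Ry" "umat E (- x) (- y) ** g \<in> Dgrp n m k"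
proof -
  note K = g(1)[unfolded Kgrp_iff]
  define u \<xi> \<beta> where "u = g$3$3" "\<xi> = g$2$3 / g$3$3" "\<beta> = g$1$3 / g$3$3"
  have u: "u \<noteq> 0" "vabs u = 1" using g(2) by (auto simp: u_\<xi>_\<beta>_def)
  have g23: "g$2$3 = u * \<xi>" and g13: "g$1$3 = u * \<beta>" and g33: "g$3$3 = u"
    using u by (auto simp: u_\<xi>_\<beta>_def)
  have \<xi>: "\<xi> \<in> idealE E 0" using K u by (simp add: g23 idealE_unit_mult)
  have \<beta>: "\<beta> \<in> idealE E a" using a u by (simp add: g13 idealE_unit_mult)
  have "cj u * u * (\<beta> + cj \<xi> * \<xi> + cj \<beta>) = 0"
    using unitary_rel(2)[of g] K by (simp add: g23 g13 g33 cj_mult algebra_simps)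
  then have rel: "\<beta> + cj \<xi> * \<xi> + cj \<beta> = 0" using u by simp
  define \<eta> where "\<eta> = imF (\<beta> + cj \<xi> * \<xi> / 2)"
  have "cj (\<beta> + cj \<xi> * \<xi> / 2) = - (\<beta> + cj \<xi> * \<xi> / 2)"
    using rel by (simp add: cj_add cj_half cj_mult eq_neg_iff_add_eq_0 algebra_simps)
  from cj_antifixed[OF this] have \<beta>_eq: "\<beta> = j \<eta> * se - cj \<xi> * \<xi> / 2"
    unfolding \<eta>_def[symmetric] by (simp add: algebra_simps)
  have "cj \<xi> * \<xi> \<in> idealE E a" by (rule idealE_mult[where a = 0 and b = 0]) (use \<xi> a in auto)
  then have "\<eta> \<in> idealF E a" unfolding \<eta>_def by (intro imF_in idealE_add \<beta>) (simp add: idealE_half)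
  then obtain y b' where y: "y \<in> Ry" "b' \<in> idealF E (int m - int n)" "\<eta> = y + b'"
    using transversalD(2)[OF Ry] by blast
  have "- cj \<xi> \<in> idealE E 0" using \<xi> by simp
  then obtain x b where x: "x \<in> Rx" "b \<in> idealE E (int k)" "- cj \<xi> = x + b"
    using transversalD(2)[OF Rx] by blast
  have x_eq: "x = - cj \<xi> - b" using x(3) by (simp add: algebra_simps)
  have x0: "x \<in> idealE E 0" using transversalD(1)[OF Rx] x(1) by blast
  have "y \<in> idealF E a" using transversalD(1)[OF Ry] y(1) by blast
  then have y0: "y \<in> idealF E (- int n)" using a by (auto intro: idealF_mono)
  define h where "h = umat E (- x) (- y) ** g"
  have hK: "h \<in> Kgrp E n" unfolding h_def using x0 y0 g by (intro Kgrp_mult umat_Kgrp) auto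
  have h33: "h$3$3 = u" by (simp add: h_def mult_nth3 umat_mat3 g33)
  have "h$2$3 = - (u * cj b)"
    by (simp add: h_def mult_nth3 umat_mat3 g33 g23 x_eq cj_minus cj_diff cj_add algebra_simps)
  then have h23: "h$2$3 \<in> idealE E (int k)" using x u by (simp add: idealE_unit_mult)
  have "h$1$3 = u * (\<beta> - x * \<xi> - j y * se - x * cj x / 2)"
    by (simp add: h_def mult_nth3 umat_mat3 g33 g23 g13 cj_minus emb_minus algebra_simps)
  also have "\<beta> - x * \<xi> - j y * se - x * cj x / 2 = j b' * se + b * \<xi> / 2 - cj (b * \<xi>) / 2 - b * cj b / 2"
    unfolding \<beta>_eq y(3) x_eq by (simp add: cj_minus cj_diff cj_mult emb_add field_simps)
  finally have h13_eq: "h$1$3 = u * (j b' * se + b * \<xi> / 2 - cj (b * \<xi>) / 2 - b * cj b / 2)" .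
  have 1: "b * \<xi> \<in> idealE E (int m - int n)"
    by (rule idealE_mult[where a = "int k" and b = 0]) (use x \<xi> k in auto)
  have 2: "b * cj b \<in> idealE E (int m - int n)"
    by (rule idealE_mult[where a = "int k" and b = "int k"]) (use x k in auto)
  have h13: "h$1$3 \<in> idealE E (int m - int n)"
    unfolding h13_eq idealE_unit_mult[OF u(2)]
    using 1 2 y by (intro idealE_add idealE_diff) (simp_all add: idealE_half idealE_se)
  have "cj (h$1$2) * u = - (cj (h$3$2) * h$1$3 + cj (h$2$2) * h$2$3)"
    using unitary_rel(3)[of h] hK by (simp add: Kgrp_iff h33 eq_neg_iff_add_eq_0 algebra_simps)
  moreover have "cj (h$3$2) * h$1$3 + cj (h$2$2) * h$2$3 \<in> idealE E (int k)"
    by (intro idealE_add idealE_mult[where a = "int n" and b = "int m - int n"]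
        idealE_mult[where a = 0 and b = "int k"])
       (use hK h13 h23 k Kgrp_22[OF hK] in \<open>auto simp: Kgrp_iff\<close>)
  ultimately have "cj (h$1$2) * u \<in> idealE E (int k)" by (simp only: idealE_minus)
  then have "u * cj (h$1$2) \<in> idealE E (int k)" by (simp only: mult.commute)
  then have "h$1$2 \<in> idealE E (int k)" using u by (simp add: idealE_unit_mult)
  then have "h \<in> Dgrp n m k" using hK h13 h23 by (simp add: Dgrp_def)
  then show thesis using that x y h_def by blast
qed

text \<open>The Heisenberg group law, with its cocycle given by the second coordinate of \<open>x'\<close> times the conjugate
  of \<open>x\<close>.\<close>

lemma umat_diff: "umat E (- x) (- y) ** umat E x' y' = umat E (x' - x) (y' - y - imF (x' * cj x))"
proof -
  define z where "z = x' * cj x"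
  have z: "x' * cj x = z" "x * cj x' = cj z" by (simp_all add: z_def cj_mult mult.commute)
  have cz: "cj z = j (reF z) - j (imF z) * se"
    using cj_coords[of "reF z" "imF z"] by (simp flip: coords)
  have "z - cj z = (j (reF z) + j (imF z) * se) - (j (reF z) - j (imF z) * se)"
    by (rule arg_cong2[of _ _ _ _ "(-)", OF coords cz])
  then have *: "j (imF z) * se = (z - cj z) / 2" by simp
  show ?thesis
    unfolding z(1)
    by (simp add: umat_mat3 mat3_mult mat3_eq_iff emb_diff emb_minus cj_minus cj_diff * left_diff_distrib)
       (simp add: field_simps z)
qed

text \<open>The cosets are separated by the third column: either the lower right entry is a unit, or it becomes
  one after multiplication by \<open>weyl n\<close>, and then the upper right entry lies one step deeper in
  the filtration. This is the Bruhat decomposition modulo \<open>p\<close>.\<close>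

lemma transversal_Kgrp:
  assumes k: "k \<le> 1" "1 \<le> m" "m \<le> n"
    and Rx: "transversal (+) (idealE E 0) (idealE E (int k)) Rx"
    and Ry: "transversal (+) (idealF E (- int n)) (idealF E (int m - int n)) Ry"
    and Ry': "transversal (+) (idealF E (1 - int n)) (idealF E (int m - int n)) Ry'"
  defines "R \<equiv> (\<lambda>(x, y). umat E x y) ` (Rx \<times> Ry)" and "R' \<equiv> (\<lambda>(x, y). weyl (int n) ** umat E x y) ` (Rx \<times> Ry')"
  shows "transversal (**) (Kgrp E n) (Dgrp n m k) (R \<union> R')"
    and "R \<inter> R' = {}" and "inj_on (\<lambda>(x, y). umat E x y) (Rx \<times> Ry)"
    and "inj_on (\<lambda>(x, y). weyl (int n) ** umat E x y) (Rx \<times> Ry')"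
proof -
  let ?w = "weyl (int n)"
  have km: "k \<le> m" "1 \<le> n" using k by auto
  have w_cancel: "?w ** A = ?w ** B \<longleftrightarrow> A = B" for A B
    by (metis matrix_mul_assoc matrix_mul_lid weyl_weyl)
  have RxD: "x \<in> idealE E 0" if "x \<in> Rx" for x using transversalD(1)[OF Rx] that by blast
  have RyD: "y \<in> idealF E (- int n)" if "y \<in> Ry" for y using transversalD(1)[OF Ry] that by blast
  have RyD': "y \<in> idealF E (1 - int n)" if "y \<in> Ry'" for y using transversalD(1)[OF Ry'] that by blast
  have RyD'': "y \<in> idealF E (- int n)" if "y \<in> Ry'" for y using idealF_mono[OF RyD'[OF that]] by simp
  have R33: "g$3$3 = 1" if "g \<in> R" for g using that by (auto simp: R_def umat_mat3)
  have R'33: "g$3$3 \<in> idealE E 1" if "g \<in> R'" for g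
  proof -
    from that obtain x y where xy: "x \<in> Rx" "y \<in> Ry'" "g = ?w ** umat E x y" by (auto simp: R'_def)
    have "g$3$3 = uE powi int n * (j y * se - x * cj x / 2)"
      unfolding xy by (simp add: mult_nth3 weyl_def umat_mat3)
    then show ?thesis using umat_13_in[OF RxD RyD', of x y] xy km by (simp add: idealE_uE_power_mult)
  qed
  show "R \<inter> R' = {}"
  proof (rule ccontr)
    assume "R \<inter> R' \<noteq> {}"
    then have "1 \<in> idealE E 1" using R33 R'33 by force
    then show False by simp
  qed
  show "inj_on (\<lambda>(x, y). umat E x y) (Rx \<times> Ry)" "inj_on (\<lambda>(x, y). ?w ** umat E x y) (Rx \<times> Ry')"
    by (auto intro!: inj_onI simp: umat_eq_iff w_cancel)
  have uniq: "x' = x \<and> y' = y"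
    if "x \<in> Rx" "x' \<in> Rx" "y \<in> S" "y' \<in> S" "b \<in> Dgrp n m k" "umat E x' y' = umat E x y ** b"
      and S: "transversal (+) (idealF E a) (idealF E (int m - int n)) S" for x x' y y' b a S
  proof -
    have "umat E (- x) (- y) ** umat E x' y' = b"
      unfolding that(6) by (simp add: matrix_mul_assoc umat_inverse)
    then have b: "umat E (x' - x) (y' - y - imF (x' * cj x)) = b" by (simp only: umat_diff)
    have "b$1$2 \<in> idealE E (int k)" using that(5) by (simp add: Dgrp_def)
    then have "x' - x \<in> idealE E (int k)" by (simp add: b[symmetric] umat_mat3)
    then have x: "x' = x" using transversalD(3)[OF Rx that(1,2), of "x' - x"] by simp
    have "cj (x * cj x) = x * cj x" by (simp add: cj_mult mult.commute)
    from cj_fixed[OF this] have "imF (x * cj x) = 0"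
      using imF_coords[of "reF (x * cj x)" 0] by simp
    then have "b$1$3 = j (y' - y) * se" by (simp add: b[symmetric] x umat_mat3)
    then have "j (y' - y) * se \<in> idealE E (int m - int n)" using that(5) by (simp add: Dgrp_def)
    then have "y' - y \<in> idealF E (int m - int n)" by (simp add: idealE_se)
    then have "y' = y" using transversalD(3)[OF S that(3,4), of "y' - y"] by simp
    then show ?thesis using x by simp
  qed
  have b33: "vabs ((g ** b)$3$3) = vabs (g$3$3)" if "g \<in> R" "b \<in> Dgrp n m k" for g b
  proof -
    have "(g ** b)$3$3 = b$3$3" using that(1) by (auto simp: R_def mult_nth3 umat_mat3)
    then show ?thesis using Dgrp_unit[OF that(2)] k R33[OF that(1)] by simp
  qed
  have Rdisj: False if "g \<in> R" "g' \<in> R'" "b \<in> Dgrp n m k" "g' = g ** b" for g g' b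
    using b33[OF that(1,3)] R33[OF that(1)] R'33[OF that(2)] that(4) by (simp add: idealE_1_iff)
  have Dinv: "\<exists>b'\<in>Dgrp n m k. b ** b' = mat 1" if "b \<in> Dgrp n m k" for b
    using that ustar_right[of b] Kgrp_ustar[of b n] by (intro bexI[of _ "ustar b"]) (auto simp: Dgrp_def Kgrp_iff)
  show "transversal (**) (Kgrp E n) (Dgrp n m k) (R \<union> R')"
    unfolding transversal_def
  proof (intro conjI ballI impI)
    show "R \<union> R' \<subseteq> Kgrp E n"
      using RxD RyD RyD'' by (auto simp: R_def R'_def intro!: Kgrp_mult umat_Kgrp)
  next
    fix g assume g: "g \<in> Kgrp E n"
    then have "g$3$3 \<in> idealE E 0" by (simp add: Kgrp_iff)
    then show "\<exists>r\<in>R \<union> R'. \<exists>b\<in>Dgrp n m k. g = r ** b"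
    proof (cases rule: idealE_0_cases)
      case 1
      then obtain x y where xy: "x \<in> Rx" "y \<in> Ry" "umat E (- x) (- y) ** g \<in> Dgrp n m k"
        using Kgrp_33_unit[OF g 1 _ _ _ km(1) k(3) Rx Ry] g by (auto simp: Kgrp_iff)
      moreover have "g = umat E x y ** (umat E (- x) (- y) ** g)"
        by (simp add: matrix_mul_assoc umat_inverse)
      ultimately show ?thesis unfolding R_def by blast
    next
      case 2
      have wg: "?w ** g \<in> Kgrp E n" using g by (intro Kgrp_mult) auto
      obtain x y where xy: "x \<in> Rx" "y \<in> Ry'" "umat E (- x) (- y) ** (?w ** g) \<in> Dgrp n m k"
        using Kgrp_33_unit[OF wg _ _ _ _ km(1) k(3) Rx Ry'] Kgrp_33_nonunit[OF g km(2) 2] km by auto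
      moreover have "g = (?w ** umat E x y) ** (umat E (- x) (- y) ** (?w ** g))"
        by (metis matrix_mul_assoc matrix_mul_lid umat_inverse(1) weyl_weyl)
      moreover have "?w ** umat E x y \<in> R \<union> R'" using xy(1,2) by (auto simp: R'_def)
      ultimately show ?thesis by blast
    qed
  next
    fix g g' b assume g: "g \<in> R \<union> R'" "g' \<in> R \<union> R'" and b: "b \<in> Dgrp n m k" "g' = g ** b"
    consider "g \<in> R" "g' \<in> R" | "g \<in> R'" "g' \<in> R'" | "g \<in> R" "g' \<in> R'" | "g \<in> R'" "g' \<in> R"
      using g by blast
    then show "g' = g"
    proof cases
      case 1
      then obtain x y x' y' where xy: "x \<in> Rx" "y \<in> Ry" "x' \<in> Rx" "y' \<in> Ry"
          "g = umat E x y" "g' = umat E x' y'" by (auto simp: R_def)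
      then have "umat E x' y' = umat E x y ** b" using b(2) by simp
      then show ?thesis using uniq[OF xy(1,3,2,4) b(1) _ Ry] xy(5,6) by simp
    next
      case 2
      then obtain x y x' y' where xy: "x \<in> Rx" "y \<in> Ry'" "x' \<in> Rx" "y' \<in> Ry'"
          "g = ?w ** umat E x y" "g' = ?w ** umat E x' y'" by (auto simp: R'_def)
      then have "?w ** umat E x' y' = ?w ** (umat E x y ** b)"
        using b(2) by (simp add: matrix_mul_assoc)
      then have "umat E x' y' = umat E x y ** b" by (simp only: w_cancel)
      then show ?thesis using uniq[OF xy(1,3,2,4) b(1) _ Ry'] xy(5,6) by simp
    next
      case 3
      then show ?thesis using Rdisj b by blast
    next
      case 4
      obtain b' where "b' \<in> Dgrp n m k" "b ** b' = mat 1" using Dinv b by blast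
      then have "g = g' ** b'" using b(2) by (simp flip: matrix_mul_assoc)
      then show ?thesis using Rdisj 4 \<open>b' \<in> Dgrp n m k\<close> by blast
    qed
  qed
qed

lemma sum_transversal_Kgrp:
  assumes k: "k \<le> 1" "1 \<le> m" "m \<le> n"
    and Rx: "transversal (+) (idealE E 0) (idealE E (int k)) Rx" "finite Rx"
    and Ry: "transversal (+) (idealF E (- int n)) (idealF E (int m - int n)) Ry" "finite Ry"
    and Ry': "transversal (+) (idealF E (1 - int n)) (idealF E (int m - int n)) Ry'" "finite Ry'"
  obtains R where "transversal (**) (Kgrp E n) (Dgrp n m k) R"
    "\<And>f :: 'e^3^3 \<Rightarrow> 'v::comm_monoid_add. sum f R = (\<Sum>x\<in>Rx. \<Sum>y\<in>Ry. f (umat E x y)) +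
        (\<Sum>x\<in>Rx. \<Sum>y\<in>Ry'. f (weyl (int n) ** umat E x y))"
proof -
  note T = transversal_Kgrp[OF k Rx(1) Ry(1) Ry'(1)]
  show thesis
  proof (rule that[OF T(1)])
    fix f :: "'e^3^3 \<Rightarrow> 'v"
    show "sum f ((\<lambda>(x, y). umat E x y) ` (Rx \<times> Ry) \<union> (\<lambda>(x, y). weyl (int n) ** umat E x y) ` (Rx \<times> Ry')) =
       (\<Sum>x\<in>Rx. \<Sum>y\<in>Ry. f (umat E x y)) + (\<Sum>x\<in>Rx. \<Sum>y\<in>Ry'. f (weyl (int n) ** umat E x y))"
      using Rx(2) Ry(2) Ry'(2)
      by (subst sum.union_disjoint[OF _ _ T(2)])
         (simp_all add: sum.reindex[OF T(3)] sum.reindex[OF T(4)] sum.cartesian_product comp_def prod.case_distrib[of f])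
  qed
qed

end

section \<open>Level raising, Hecke and level lowering operators\<close>

lemma transversal_conj:
  fixes A B :: "('a::semiring_1^'n^'n) set"
  assumes w: "w ** w = mat 1" and A: "\<And>a. a \<in> A \<Longrightarrow> w ** a ** w \<in> A"
    and R: "transversal (**) A B R"
  shows "transversal (**) A ((\<lambda>b. w ** b ** w) ` B) ((\<lambda>r. w ** r ** w) ` R)"
proof -
  let ?c = "\<lambda>a. w ** a ** w"
  have torus_val: "?c (?c a) = a" for a
  proof -
    have "?c (?c a) = (w ** w) ** a ** (w ** w)" by (simp add: matrix_mul_assoc)
    then show ?thesis by (simp add: w)
  qed
  have cm: "?c (a ** b) = ?c a ** ?c b" for a b
  proof -
    have "?c a ** ?c b = w ** a ** (w ** w) ** b ** w" by (simp add: matrix_mul_assoc)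
    then show ?thesis by (simp add: w matrix_mul_assoc)
  qed
  note RD = transversalD[OF R]
  show ?thesis
    unfolding transversal_def
  proof (intro conjI ballI impI)
    show "?c ` R \<subseteq> A" using RD(1) A by blast
  next
    fix a assume "a \<in> A"
    then obtain r b where rb: "r \<in> R" "b \<in> B" "?c a = r ** b" using RD(2) A by blast
    then have "a = ?c r ** ?c b" using torus_val[of a] cm by simp
    then show "\<exists>r\<in>?c ` R. \<exists>b\<in>?c ` B. a = r ** b" using rb by blast
  next
    fix r r' b assume "r \<in> ?c ` R" "r' \<in> ?c ` R" "b \<in> ?c ` B" and eq: "r' = r ** b"
    then obtain s s' d where s: "s \<in> R" "s' \<in> R" "d \<in> B" "r = ?c s" "r' = ?c s'" "b = ?c d" by blast
    then have "?c (?c s') = ?c (?c (s ** d))" using eq cm by simp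
    then have "s' = s ** d" by (simp only: torus_val)
    then show "r' = r" using RD(3)[OF s(1-3)] s by simp
  qed
qed

context unram_ext
begin

lemma transversal_trivial_E: "transversal (+) (idealE E n) (idealE E n) {0}"
  and transversal_trivial_F: "transversal (+) (idealF E n) (idealF E n) {0}"
  unfolding transversal_def by auto

lemma zeta_pow_conj_nth:
  "(zeta_pow i ** g ** zeta_pow (- i))$1$1 = g$1$1" "(zeta_pow i ** g ** zeta_pow (- i))$1$2 = uE powi i * g$1$2"
  "(zeta_pow i ** g ** zeta_pow (- i))$1$3 = uE powi (2 * i) * g$1$3" "(zeta_pow i ** g ** zeta_pow (- i))$2$1 = uE powi (- i) * g$2$1"
  "(zeta_pow i ** g ** zeta_pow (- i))$2$2 = g$2$2" "(zeta_pow i ** g ** zeta_pow (- i))$2$3 = uE powi i * g$2$3"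
  "(zeta_pow i ** g ** zeta_pow (- i))$3$1 = uE powi (- 2 * i) * g$3$1" "(zeta_pow i ** g ** zeta_pow (- i))$3$2 = uE powi (- i) * g$3$2"
  "(zeta_pow i ** g ** zeta_pow (- i))$3$3 = g$3$3"
  using power_int_add[of uE i i] power_int_add[of uE "- i" "- i"]
  by (simp_all add: mult_nth3 zeta_pow_def power_int_minus)

lemma zeta_pow_conj_zeta_pow_conj: "zeta_pow i ** (zeta_pow (- i) ** g ** zeta_pow i) ** zeta_pow (- i) = g"
proof -
  have "zeta_pow i ** (zeta_pow (- i) ** g ** zeta_pow i) ** zeta_pow (- i) = (zeta_pow i ** zeta_pow (- i)) ** g ** (zeta_pow i ** zeta_pow (- i))"
    by (simp only: matrix_mul_assoc)
  then show ?thesis by (simp add: zeta_pow_inverse)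
qed

text \<open>Conjugation by \<open>\<zeta>\<close> moves the entries above the diagonal deeper into the filtration and relaxes the
  ones below it, so that only the conditions above the diagonal are new.\<close>

lemma Kgrp_zeta_conj:
  assumes "2 \<le> n"
  shows "Kgrp E n \<inter> (\<lambda>k. zeta_pow 1 ** k ** zeta_pow (- 1)) ` Kgrp E n = Dgrp n 2 1"
proof safe
  fix k assume "k \<in> Kgrp E n" and "zeta_pow 1 ** k ** zeta_pow (- 1) \<in> Kgrp E n"
  then show "zeta_pow 1 ** k ** zeta_pow (- 1) \<in> Dgrp n 2 1"
    using zeta_pow_conj_nth[of 1 k] idealE_uE_powi_mult[of 1 _ 1] idealE_uE_powi_mult[of 2 _ "2 - int n"]
    by (simp add: Dgrp_def Kgrp_iff)
next
  fix g assume g: "g \<in> Dgrp n 2 1"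
  then have gK: "g \<in> Kgrp E n" by (simp add: Dgrp_def)
  then show "g \<in> Kgrp E n" .
  let ?k = "zeta_pow (- 1) ** g ** zeta_pow 1"
  have mono: "x \<in> idealE E (int n - 1)" "x \<in> idealE E (int n - 2)" if "x \<in> idealE E (int n)" for x
    using that by (auto intro: idealE_mono[of _ "int n"])
  have "?k \<in> unitary_group E" using gK by (simp add: unitary_mult Kgrp_unitary)
  then have "?k \<in> Kgrp E n"
    unfolding Kgrp_iff zeta_pow_conj_nth[of "- 1" g, unfolded minus_minus] idealE_uE_powi_mult
    using g gK[unfolded Kgrp_iff] mono by (simp add: Dgrp_def)
  moreover have "g = zeta_pow 1 ** ?k ** zeta_pow (- 1)" using zeta_pow_conj_zeta_pow_conj[of 1 g] by simp
  ultimately show "g \<in> (\<lambda>k. zeta_pow 1 ** k ** zeta_pow (- 1)) ` Kgrp E n" by blast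
qed

text \<open>Commuting with \<open>\<zeta>\<close>, which has distinct eigenvalues, makes a matrix diagonal; the Weyl element and a
  unipotent element then identify the diagonal entries.\<close>

lemma centre_scalar:
  assumes z: "z \<in> centre E" obtains t where "z = mat3 t 0 0 0 t 0 0 0 t"
proof -
  have comm: "z ** g = g ** z" if "g \<in> unitary_group E" for g
    using z that by (simp add: centre_def)
  have ne: "uE powi i \<noteq> uE powi k" if "i \<noteq> k" for i k
    using that vabs_uE_powi[of i] vabs_uE_powi[of k] powi_q_eq_iff[of "- 2 * i" "- 2 * k"] by auto
  have u: "uE \<noteq> 1" "uE \<noteq> inverse uE" "inverse uE \<noteq> 1"
    using ne[of 1 0] ne[of 1 "- 1"] ne[of "- 1" 0] by (simp_all add: power_int_minus)
  have diag: "z$1$2 = 0" "z$1$3 = 0" "z$2$1 = 0" "z$2$3 = 0" "z$3$1 = 0" "z$3$2 = 0"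
    using comm[OF zeta_pow_unitary, of 1] u by (simp_all add: mat3_cong_iff mult_nth3 zeta_pow_def power_int_minus mult.commute)
  have "(z ** weyl 0)$1$3 = (weyl 0 ** z)$1$3" by (simp only: comm[OF weyl_unitary])
  then have "z$1$1 = z$3$3" by (simp add: mult_nth3 weyl_def)
  moreover have "(z ** umat E 1 0)$1$2 = (umat E 1 0 ** z)$1$2" by (simp only: comm[OF umat_unitary])
  then have "z$1$1 = z$2$2" using diag by (simp add: mult_nth3 umat_mat3)
  ultimately show thesis using diag by (intro that[of "z$1$1"]) (simp add: mat3_cong_iff)
qed

lemma scalar_centre:
  assumes "cj t * t = 1" shows "mat3 t 0 0 0 t 0 0 0 t \<in> centre E"
  using assms by (simp add: centre_def unitary_iff mat3_cong_iff mult_nth3 mult.commute)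

text \<open>An element of \<open>1 + p\<^sup>n\<close> whose norm is \<open>1\<close> modulo \<open>p\<^sup>n\<^sup>+\<^sup>1\<close> is, modulo \<open>p\<^sup>n\<^sup>+\<^sup>1\<close>, a Cayley
  transform and therefore an element of norm exactly \<open>1\<close>.\<close>

lemma approx_norm_one:
  assumes n: "1 \<le> n" and m: "m - 1 \<in> idealE E n" "cj m * m - 1 \<in> idealE E (n + 1)"
  obtains t where "cj t * t = 1" "vabs t = 1" "t - 1 \<in> idealE E n" "m / t - 1 \<in> idealE E (n + 1)"
proof -
  define p r where "p = (m + cj m) / 2 - 1" "r = (m - cj m) / 2"
  have m_eq: "m = 1 + p + r" "cj m = 1 + p - r" by (simp_all add: p_r_def field_simps)
  have "cj m - 1 = cj (m - 1)" by (simp add: cj_diff)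
  then have cm: "cj m - 1 \<in> idealE E n" using m(1) by simp
  have "p = ((m - 1) + (cj m - 1)) / 2" "r = ((m - 1) - (cj m - 1)) / 2"
    by (simp_all add: p_r_def field_simps)
  then have pr: "p \<in> idealE E n" "r \<in> idealE E n"
    using idealE_add[OF m(1) cm] idealE_diff[OF m(1) cm] by (simp_all only: idealE_half)
  have sq: "p * p \<in> idealE E (n + 1)" "r * r \<in> idealE E (n + 1)" "p * r \<in> idealE E (n + 1)"
    using pr n by (auto intro!: idealE_mult[where a = n and b = n])
  have "cj m * m = (1 + p - r) * (1 + p + r)"
    by (rule arg_cong2[of _ _ _ _ "(*)", OF m_eq(2,1)])
  then have "p = ((cj m * m - 1) - p * p + r * r) / 2"
    by (simp add: field_simps)
  moreover have "(cj m * m - 1) - p * p + r * r \<in> idealE E (n + 1)"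
    by (rule idealE_add[OF idealE_diff[OF m(2) sq(1)] sq(2)])
  ultimately have p: "p \<in> idealE E (n + 1)" by (metis idealE_half)
  have cr: "cj r = - r" by (simp add: p_r_def cj_half cj_diff field_simps)
  have "r / 2 \<in> idealE E 1" using pr(2) n idealE_mono[of r n 1] by (simp add: idealE_half)
  then have r1: "vabs (r / 2) < 1" by (simp add: idealE_1_iff)
  have v1: "vabs (1 + r / 2) = 1" using vabs_add_eq[of "r / 2" 1] r1 by simp
  have v2: "vabs (1 - r / 2) = 1" using vabs_add_eq[of "- (r / 2)" 1] r1 by (simp add: vabs_divide)
  define t where "t = (1 + r / 2) / (1 - r / 2)"
  have nz: "1 + r / 2 \<noteq> 0" "1 - r / 2 \<noteq> 0" using v1 v2 by (metis vabs_zero zero_neq_one)+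
  have "cj t = (1 - r / 2) / (1 + r / 2)"
    by (simp add: t_def cj_divide cj_add cj_diff cr)
  then have 1: "cj t * t = 1" unfolding t_def using nz by simp
  have 2: "vabs t = 1" by (simp add: t_def vabs_divide v1 v2)
  have t0: "t \<noteq> 0" using nz by (simp add: t_def)
  have "(1 - r / 2) * (t - 1) = r"
    unfolding t_def using nz(2) by (simp add: right_diff_distrib)
  then have 3: "t - 1 \<in> idealE E n" using pr(2) idealE_unit_mult[OF v2] by metis
  have "(1 - r / 2) * t = 1 + r / 2" unfolding t_def using nz(2) by simp
  then have "(1 - r / 2) * (m - t) = p - p * r / 2 - r * r / 2"
    by (simp add: right_diff_distrib m_eq(1)) (simp add: field_simps)
  moreover have "p - p * r / 2 - r * r / 2 \<in> idealE E (n + 1)"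
    using p sq by (intro idealE_diff) (auto simp: idealE_half)
  ultimately have "m - t \<in> idealE E (n + 1)" using idealE_unit_mult[OF v2] by metis
  moreover have "t * (m / t - 1) = m - t" using t0 by (simp add: right_diff_distrib)
  ultimately have 4: "m / t - 1 \<in> idealE E (n + 1)" using idealE_unit_mult[OF 2] by metis
  show thesis by (rule that[OF 1 2 3 4])
qed

text \<open>The factor \<open>Z\<^sub>n\<close> absorbs the condition on the middle entry: if \<open>g\<^sub>3\<^sub>2\<close> is in \<open>p\<^sup>n\<^sup>+\<^sup>1\<close>, unitarity
  makes the norm of the middle entry \<open>1\<close> modulo \<open>p\<^sup>n\<^sup>+\<^sup>1\<close>, and \<open>approx_norm_one\<close> supplies the central
  element.\<close>

lemma Kgrp_centre:
  assumes n: "1 \<le> n"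
  shows "g \<in> Kgrp E n \<inter> {z ** k | z k. z \<in> Zsub E n \<and> k \<in> Kgrp E (n + 1)} \<longleftrightarrow>
    g \<in> Kgrp E n \<and> g$2$1 \<in> idealE E (int n + 1) \<and> g$3$1 \<in> idealE E (int n + 1) \<and> g$3$2 \<in> idealE E (int n + 1)"
    (is "?L \<longleftrightarrow> ?R")
proof
  assume L: ?L
  then obtain z k where zk: "g = z ** k" "z \<in> Zsub E n" "k \<in> Kgrp E (n + 1)" by blast
  then obtain t where z: "z = mat3 t 0 0 0 t 0 0 0 t" using centre_scalar by (auto simp: Zsub_def)
  then have t: "t \<in> idealE E 0" using zk(2) by (simp add: Zsub_def Kgrp_iff)
  have "g$2$1 = t * k$2$1" "g$3$1 = t * k$3$1" "g$3$2 = t * k$3$2"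
    by (simp_all add: zk(1) z mult_nth3)
  then show ?R using L zk(3) t by (auto simp: Kgrp_iff add.commute intro!: idealE_mult[where a = 0 and b = "int n + 1"])
next
  assume R: ?R
  then have g: "g \<in> Kgrp E n" by blast
  note K = g[unfolded Kgrp_iff]
  define m where "m = g$2$2"
  have "cj m * m - 1 = - (cj (g$3$2) * g$1$2 + cj (g$1$2) * g$3$2)"
    using unitary_rel(4)[OF Kgrp_unitary[OF g]] by (simp add: m_def algebra_simps)
  moreover have "cj (g$3$2) * g$1$2 + cj (g$1$2) * g$3$2 \<in> idealE E (int n + 1)"
    using R K by (intro idealE_add)
      (auto intro: idealE_mult[where a = "int n + 1" and b = 0] idealE_mult[where a = 0 and b = "int n + 1"])
  ultimately have "cj m * m - 1 \<in> idealE E (int n + 1)" by (simp only: idealE_minus)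
  moreover have "m - 1 \<in> idealE E (int n)" using K by (simp add: m_def)
  ultimately obtain t where t: "cj t * t = 1" "vabs t = 1" "t - 1 \<in> idealE E (int n)" "m / t - 1 \<in> idealE E (int n + 1)"
    using approx_norm_one[of "int n" m] n by auto
  have t0: "t \<noteq> 0" using t(1) by auto
  define z k where "z = mat3 t 0 0 0 t 0 0 0 t" "k = mat3 (inverse t) 0 0 0 (inverse t) 0 0 0 (inverse t) ** g"
  have zc: "z \<in> centre E" unfolding z_k_def by (rule scalar_centre[OF t(1)])
  have tinv: "cj (inverse t) * inverse t = 1"
    using t(1) by (simp add: cj_inverse flip: nonzero_inverse_mult_distrib)
       (metis inverse_1 inverse_mult_distrib)
  have "mat3 (inverse t) 0 0 0 (inverse t) 0 0 0 (inverse t) \<in> unitary_group E"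
    using scalar_centre[OF tinv] by (simp add: centre_def)
  then have ku: "k \<in> unitary_group E" unfolding z_k_def using Kgrp_unitary[OF g] by (intro unitary_mult)
  have kn: "k$i$l = inverse t * g$i$l" for i l
    using exhaust_3[of i] by (auto simp: z_k_def mult_nth3)
  have tv: "vabs (inverse t) = 1" using t(2) by (simp add: vabs_inverse)
  have "k$2$2 - 1 \<in> idealE E (int n + 1)" using t(4) by (simp add: kn m_def divide_inverse mult.commute)
  moreover have "g$1$3 \<in> idealE E (- 1 - int n)" using K idealE_mono[of "g$1$3" "- int n" "- 1 - int n"] by simp
  ultimately have "k \<in> Kgrp E (n + 1)"
    using R K ku by (simp add: Kgrp_iff kn idealE_unit_mult[OF tv] algebra_simps)
  moreover have "z \<in> Zsub E n"
    using zc t(2,3) by (simp add: Zsub_def Kgrp_iff centre_def) (simp add: z_k_def idealE_iff)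
  moreover have "g = z ** k" using t0 by (simp add: mat3_cong_iff mult_nth3 z_k_def)
  ultimately show ?L using g by blast
qed

lemma weyl_conj_nth:
  "(weyl n ** g ** weyl n)$1$2 = uE powi (- n) * g$3$2"
  "(weyl n ** g ** weyl n)$2$3 = uE powi (- n) * g$2$1"
  "(weyl n ** g ** weyl n)$1$3 = uE powi (- 2 * n) * g$3$1"
  using power_int_add[of uE "- n" "- n"] by (simp_all add: mult_nth3 weyl_def mult.commute)

lemma weyl_conj_conj: "weyl n ** (weyl n ** g ** weyl n) ** weyl n = g"
proof -
  have "weyl n ** (weyl n ** g ** weyl n) ** weyl n = (weyl n ** weyl n) ** g ** (weyl n ** weyl n)"
    by (simp only: matrix_mul_assoc)
  then show ?thesis by (simp add: weyl_weyl)
qed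

lemma weyl_conj_Kgrp: "g \<in> Kgrp E n \<Longrightarrow> weyl (int n) ** g ** weyl (int n) \<in> Kgrp E n"
  by (intro Kgrp_mult) auto

lemma Kgrp_centre_conj:
  assumes n: "1 \<le> n"
  shows "Kgrp E n \<inter> {z ** k | z k. z \<in> Zsub E n \<and> k \<in> Kgrp E (n + 1)} =
    (\<lambda>b. weyl (int n) ** b ** weyl (int n)) ` Dgrp n 1 1" (is "?C = ?c ` _")
proof -
  have *: "g \<in> ?C \<longleftrightarrow> ?c g \<in> Dgrp n 1 1" for g
  proof -
    have "g \<in> Kgrp E n \<longleftrightarrow> ?c g \<in> Kgrp E n"
      using weyl_conj_Kgrp[of g n] weyl_conj_Kgrp[of "?c g" n] by (auto simp: weyl_conj_conj)
    moreover have "?c g$1$2 \<in> idealE E 1 \<longleftrightarrow> g$3$2 \<in> idealE E (int n + 1)"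
      "?c g$2$3 \<in> idealE E 1 \<longleftrightarrow> g$2$1 \<in> idealE E (int n + 1)"
      "?c g$1$3 \<in> idealE E (1 - int n) \<longleftrightarrow> g$3$1 \<in> idealE E (int n + 1)"
      unfolding weyl_conj_nth idealE_uE_powi_mult by (simp_all add: algebra_simps)
    ultimately show ?thesis unfolding Kgrp_centre[OF n] by (auto simp: Dgrp_def)
  qed
  show ?thesis
  proof
    show "?C \<subseteq> ?c ` Dgrp n 1 1"
    proof
      fix g assume "g \<in> ?C"
      then have "?c g \<in> Dgrp n 1 1" by (simp only: *)
      moreover have "g = ?c (?c g)" by (rule weyl_conj_conj[symmetric])
      ultimately show "g \<in> ?c ` Dgrp n 1 1" by blast
    qed
    show "?c ` Dgrp n 1 1 \<subseteq> ?C"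
    proof
      fix g assume "g \<in> ?c ` Dgrp n 1 1"
      then obtain b where "b \<in> Dgrp n 1 1" "g = ?c b" by blast
      then have "?c g \<in> Dgrp n 1 1" by (simp add: weyl_conj_conj)
      then show "g \<in> ?C" by (simp only: *)
    qed
  qed
qed

lemma Kgrp_centre_subgroup:
  assumes n: "1 \<le> n"
  shows "is_subgroup (**) (Kgrp E n \<inter> {z ** k | z k. z \<in> Zsub E n \<and> k \<in> Kgrp E (n + 1)})"
proof -
  let ?C = "{g \<in> Kgrp E n. g$2$1 \<in> idealE E (int n + 1) \<and> g$3$1 \<in> idealE E (int n + 1) \<and> g$3$2 \<in> idealE E (int n + 1)}"
  have "is_subgroup (**) ?C"
  proof (rule is_subgroup_matrices)
    show "mat 1 \<in> ?C" by simp
    show "?C \<subseteq> unitary_group E" by (auto simp: Kgrp_iff)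
    show "ustar g \<in> ?C" if "g \<in> ?C" for g using that by (simp add: Kgrp_ustar)
    show "g ** h \<in> ?C" if g: "g \<in> ?C" and h: "h \<in> ?C" for g h
    proof -
      have gK: "g \<in> Kgrp E n" and hK: "h \<in> Kgrp E n" using g h by auto
      note g' = g[simplified] gK[unfolded Kgrp_iff] Kgrp_22[OF gK]
        and h' = h[simplified] hK[unfolded Kgrp_iff] Kgrp_22[OF hK]
      have "(g ** h)$2$1 \<in> idealE E (int n + 1)"
        by (rule mult_nth_in[where aa = "int n + 1" and ba = 0 and ab = 0 and bb = "int n + 1"
              and ac = 0 and bc = "int n + 1"]) (use g' h' in auto)
      moreover have "(g ** h)$3$1 \<in> idealE E (int n + 1)"
        by (rule mult_nth_in[where aa = "int n + 1" and ba = 0 and ab = "int n + 1" and bb = "int n + 1"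
              and ac = 0 and bc = "int n + 1"]) (use g' h' in auto)
      moreover have "(g ** h)$3$2 \<in> idealE E (int n + 1)"
        by (rule mult_nth_in[where aa = "int n + 1" and ba = 0 and ab = "int n + 1" and bb = 0
              and ac = 0 and bc = "int n + 1"]) (use g' h' in auto)
      ultimately show ?thesis using Kgrp_mult[OF gK hK] by simp
    qed
  qed
  moreover have "Kgrp E n \<inter> {z ** k | z k. z \<in> Zsub E n \<and> k \<in> Kgrp E (n + 1)} = ?C"
    using Kgrp_centre[OF n] by blast
  ultimately show ?thesis by simp
qed

end

section \<open>The values of the Whittaker function on the torus\<close>

locale newform = unram_ext E q
  for E :: "('f::nonarch_local_field, 'e::nonarch_local_field) quad_ext" and q :: nat +
  fixes sc :: "complex \<Rightarrow> 'v::ab_group_add \<Rightarrow> 'v"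
    and \<pi> :: "'e^3^3 \<Rightarrow> 'v \<Rightarrow> 'v"
    and \<psi> :: "'e \<Rightarrow> complex"
    and l :: "'v \<Rightarrow> complex"
    and v :: 'v
    and N :: nat and \<nu> lam :: complex
  assumes psi: "additive_character \<psi>"
    and conductor: "has_conductor E \<psi> ring_of_integers"
    and smooth: "smooth_rep E sc \<pi>"
    and l_Hom: "l \<in> Hom_U E sc \<pi> \<psi>"
    and N_pos: "N > 0"
    and hecke_eigen: "\<And>w. w \<in> Vfix E \<pi> (N + 1) \<Longrightarrow> hecke_T E \<pi> (N + 1) w = sc \<nu> w"
    and delta_theta_eigen: "\<And>w. w \<in> Vfix E \<pi> N \<Longrightarrow> delta E \<pi> N (theta' E \<pi> N w) = sc lam w"
    and v_fixed: "v \<in> Vfix E \<pi> N"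
    and v_normalized: "whittaker \<pi> l v (mat 1) = 1"
begin

lemma pi_1 [simp]: "\<pi> (mat 1) x = x"
  and pi_mult: "g \<in> unitary_group E \<Longrightarrow> h \<in> unitary_group E \<Longrightarrow> \<pi> (g ** h) x = \<pi> g (\<pi> h x)"
  using smooth by (auto simp: smooth_rep_def)

lemma pi_additive:
  assumes "g \<in> unitary_group E" shows "Modules.additive (\<pi> g)"
proof -
  have "Vector_Spaces.linear sc sc (\<pi> g)" using smooth assms by (auto simp: smooth_rep_def)
  then interpret Vector_Spaces.linear sc sc "\<pi> g" .
  show ?thesis by (simp add: Modules.additive_def add)
qed

lemma pi_add: "g \<in> unitary_group E \<Longrightarrow> \<pi> g (x + y) = \<pi> g x + \<pi> g y"
  using pi_additive by (simp add: Modules.additive_def)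

lemma pi_sum: "g \<in> unitary_group E \<Longrightarrow> \<pi> g (sum f A) = (\<Sum>a\<in>A. \<pi> g (f a))"
  by (rule additive.sum[OF pi_additive])

lemma l_linear: "Vector_Spaces.linear sc (*) l"
  and l_umat: "l (\<pi> (umat E x y) w) = \<psi> x * l w"
  using l_Hom by (auto simp: Hom_U_def)

lemma l_add: "l (x + y) = l x + l y" and l_scale: "l (sc a x) = a * l x"
  and l_sum: "l (sum f A) = (\<Sum>a\<in>A. l (f a))"
proof -
  interpret Vector_Spaces.linear sc "(*)" l by (rule l_linear)
  show "l (x + y) = l x + l y" by (rule add)
  show "l (sc a x) = a * l x" by (rule scale)
  show "l (sum f A) = (\<Sum>a\<in>A. l (f a))" by (rule sum)
qed

lemma v_Kgrp: "k \<in> Kgrp E N \<Longrightarrow> \<pi> k v = v"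
  using v_fixed by (simp add: Vfix_def)

lemma psi_add: "\<psi> (x + y) = \<psi> x * \<psi> y"
  using psi by (auto simp: additive_character_def)

lemma psi_integer: "x \<in> idealE E 0 \<Longrightarrow> \<psi> x = 1"
  using conductor by (auto simp: has_conductor_def integers_eq_idealE)

lemma psi_nontrivial:
  assumes "i < 0" obtains x where "x \<in> idealE E 0" "\<psi> (uE powi i * x) \<noteq> 1"
proof -
  have "\<not> idealE E i \<subseteq> idealE E 0" using uE_powi_in[of i] assms by (auto dest!: subsetD[of _ _ "uE powi i"])
  then obtain z where z: "z \<in> idealE E i" "\<psi> z \<noteq> 1"
    using conductor unfolding has_conductor_def integers_eq_idealE by blast
  have "uE powi (- i) * z \<in> idealE E 0" using z(1) by (simp only: idealE_uE_powi_mult) simp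
  moreover have "uE powi i * (uE powi (- i) * z) = z"
    by (simp add: power_int_minus)
  then have "\<psi> (uE powi i * (uE powi (- i) * z)) \<noteq> 1" using z(2) by (simp only:) simp
  ultimately show thesis by (rule that)
qed

lemma psi_sum_nonneg:
  assumes Rx: "transversal (+) (idealE E 0) (idealE E 1) Rx" "card Rx = q\<^sup>2" and i: "0 \<le> i"
  shows "(\<Sum>x\<in>Rx. \<psi> (uE powi i * x)) = of_nat q ^ 2"
proof -
  have "\<psi> (uE powi i * x) = 1" if "x \<in> Rx" for x
  proof (rule psi_integer)
    have "x \<in> idealE E 0" using transversalD(1)[OF Rx(1)] that by blast
    then show "uE powi i * x \<in> idealE E 0"
      by (rule idealE_mult[rotated, where a = i]) (use i in auto)
  qed
  then show ?thesis by (simp add: Rx(2))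
qed

text \<open>Translation by an element where the character differs from \<open>1\<close> permutes the summands and multiplies
  the sum by that value.\<close>

lemma psi_sum_neg:
  assumes Rx: "transversal (+) (idealE E 0) (idealE E 1) Rx"
  shows "(\<Sum>x\<in>Rx. \<psi> (uE powi (- 1) * x)) = 0"
proof -
  let ?f = "\<lambda>x. \<psi> (uE powi (- 1) * x)"
  obtain z where z: "z \<in> idealE E 0" "?f z \<noteq> 1" using psi_nontrivial[of "- 1"] by auto
  have inv: "?f (a + b) = ?f a" if "b \<in> idealE E 1" for a b
  proof -
    have "uE powi (- 1) * b \<in> idealE E 0" using that by (simp only: idealE_uE_powi_mult) simp
    then show ?thesis by (simp only: distrib_left psi_add psi_integer) simp
  qed
  have "(\<Sum>x\<in>Rx. ?f (z + x)) = sum ?f Rx"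
    by (rule sum_transversal_translate[where f = ?f and m = "(+)" and g' = "- z", OF is_subgroup_idealE Rx])
       (use z inv in \<open>auto intro: idealE_add idealE_diff\<close>)
  moreover have "(\<Sum>x\<in>Rx. ?f (z + x)) = ?f z * sum ?f Rx"
    by (simp only: distrib_left psi_add sum_distrib_left)
  ultimately have "(?f z - 1) * sum ?f Rx = 0" by (simp add: left_diff_distrib)
  then show ?thesis using z(2) by simp
qed

definition torus_l :: "int \<Rightarrow> 'v \<Rightarrow> complex" where "torus_l i x = l (\<pi> (zeta_pow i) x)"

lemma torus_l_add: "torus_l i (x + y) = torus_l i x + torus_l i y"
  by (simp add: torus_l_def pi_add l_add)

lemma torus_l_sum: "torus_l i (sum f A) = (\<Sum>a\<in>A. torus_l i (f a))"
  by (simp add: torus_l_def pi_sum l_sum)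

lemma torus_l_scale: "torus_l i (sc a x) = a * torus_l i x"
proof -
  have "Vector_Spaces.linear sc sc (\<pi> (zeta_pow i))" using smooth by (auto simp: smooth_rep_def)
  then interpret Vector_Spaces.linear sc sc "\<pi> (zeta_pow i)" .
  show ?thesis by (simp add: torus_l_def scale l_scale)
qed

lemma torus_l_umat: "torus_l i (\<pi> (umat E x y) w) = \<psi> (uE powi i * x) * torus_l i w"
proof -
  have "torus_l i (\<pi> (umat E x y) w) = l (\<pi> (zeta_pow i ** umat E x y) w)"
    by (simp add: torus_l_def pi_mult)
  also have "\<dots> = \<psi> (uE powi i * x) * torus_l i w"
    unfolding zeta_pow_umat by (simp add: pi_mult l_umat torus_l_def)
  finally show ?thesis .
qed

lemma torus_l_zeta_pow: "torus_l i (\<pi> (zeta_pow k) w) = torus_l (i + k) w"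
  by (simp add: torus_l_def flip: pi_mult zeta_pow_add)

definition torus_val :: "int \<Rightarrow> complex" where "torus_val i = torus_l i v"

lemma torus_val_0: "torus_val 0 = 1"
  using v_normalized by (simp add: torus_val_def torus_l_def whittaker_def zeta_pow_0)

text \<open>The vector \<open>v\<close> is fixed by integral \<open>umat E x 0\<close>, whereas \<open>torus_l i\<close> transforms under these by a
  non-trivial character when \<open>i < 0\<close>.\<close>

lemma torus_val_neg: assumes "i < 0" shows "torus_val i = 0"
proof -
  obtain x where x: "x \<in> idealE E 0" "\<psi> (uE powi i * x) \<noteq> 1" using psi_nontrivial[OF assms] .
  have "torus_val i = torus_l i (\<pi> (umat E x 0) v)"
    using x(1) by (simp add: torus_val_def v_Kgrp umat_Kgrp)
  also have "\<dots> = \<psi> (uE powi i * x) * torus_val i" by (simp add: torus_l_umat torus_val_def)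
  finally show ?thesis using x(2) by simp
qed

definition raised :: 'v where "raised = theta' E \<pi> N v"

text \<open>The level raising operator is the sum over \<open>K\<^sub>N\<^sub>+\<^sub>1 / (K\<^sub>N\<^sub>+\<^sub>1 \<inter> K\<^sub>N)\<close>; hence its values are
  fixed by \<open>K\<^sub>N\<^sub>+\<^sub>1\<close>.\<close>

lemma raised_sum:
  obtains Ry R where "card Ry = q" "raised = \<pi> (zeta_pow (- 1)) v + (\<Sum>y\<in>Ry. \<pi> (umat E 0 y) v)"
    "transversal (**) (Kgrp E (N + 1)) (Dgrp (N + 1) 1 0) R" "raised = (\<Sum>r\<in>R. \<pi> r v)"
proof -
  obtain Ry where Ry: "transversal (+) (idealF E (- int (N + 1))) (idealF E (int 1 - int (N + 1))) Ry"
      "finite Ry" "card Ry = q"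
    using transversal_idealF_1[of "- int (N + 1)"] by (auto simp: add.commute)
  have umat_inv: "\<pi> (umat E 0 (a + b)) v = \<pi> (umat E 0 a) v" if "b \<in> idealF E (- int N)" for a b
    using that by (simp add: pi_mult v_Kgrp umat_Kgrp flip: umat_0_add)
  have "coset_sum (+) (idealF E (- 1 - int N)) (idealF E (- int N)) (\<lambda>x. \<pi> (umat E 0 x) v) =
      (\<Sum>y\<in>Ry. \<pi> (umat E 0 y) v)"
  proof (rule coset_sum_transversal[OF is_subgroup_idealF])
    show "transversal (+) (idealF E (- 1 - int N)) (idealF E (- int N)) Ry"
      using Ry(1) by (simp add: algebra_simps)
  qed (rule umat_inv)
  then have raised: "raised = \<pi> (zeta_pow (- 1)) v + (\<Sum>y\<in>Ry. \<pi> (umat E 0 y) v)"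
    by (simp add: raised_def theta'_def inverse_zeta_mat)
  have tE: "transversal (+) (idealE E 0) (idealE E (int 0)) {0}"
    using transversal_trivial_E[of 0] by simp
  have tF: "transversal (+) (idealF E (1 - int (N + 1))) (idealF E (int 1 - int (N + 1))) {0}"
    using transversal_trivial_F[of "- int N"] by simp
  obtain R where R: "transversal (**) (Kgrp E (N + 1)) (Dgrp (N + 1) 1 0) R"
    "\<And>f :: 'e^3^3 \<Rightarrow> 'v. sum f R = (\<Sum>x\<in>{0}. \<Sum>y\<in>Ry. f (umat E x y)) +
        (\<Sum>x\<in>{0}. \<Sum>y\<in>{0}. f (weyl (int (N + 1)) ** umat E x y))"
    by (rule sum_transversal_Kgrp[where 'v = 'v, OF _ _ _ tE _ Ry(1,2) tF]) auto
  have "\<pi> (weyl (int (N + 1))) v = \<pi> (weyl (int (N + 1))) (\<pi> (weyl (int N)) v)"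
    by (simp add: v_Kgrp)
  also have "\<dots> = \<pi> (zeta_pow (- 1)) v" by (simp add: weyl_mult flip: pi_mult)
  finally have raised_R: "raised = (\<Sum>r\<in>R. \<pi> r v)"
    using raised R(2)[of "\<lambda>g. \<pi> g v"] by (simp add: add.commute)
  show thesis by (rule that[OF Ry(3) raised R(1) raised_R])
qed

lemma raised_Kgrp: assumes g: "g \<in> Kgrp E (N + 1)" shows "\<pi> g raised = raised"
proof -
  obtain R where R: "transversal (**) (Kgrp E (N + 1)) (Dgrp (N + 1) 1 0) R" and raised_R: "raised = (\<Sum>r\<in>R. \<pi> r v)"
    by (rule raised_sum)
  have D: "Dgrp (N + 1) 1 0 \<subseteq> Kgrp E N"
  proof
    fix d assume d: "d \<in> Dgrp (N + 1) 1 0"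
    have mono: "x \<in> idealE E (int N)" if "x \<in> idealE E (int (N + 1))" for x
      using that by (rule idealE_mono) simp
    show "d \<in> Kgrp E N"
      using d mono[of "d$2$1"] mono[of "d$2$2 - 1"] mono[of "d$3$1"] mono[of "d$3$2"]
      by (simp add: Dgrp_def Kgrp_iff)
  qed
  note gU = Kgrp_unitary[OF g]
  have RU: "r \<in> unitary_group E" if "r \<in> R" for r
    using transversalD(1)[OF R] that Kgrp_unitary by blast
  have "\<pi> g raised = (\<Sum>r\<in>R. \<pi> (g ** r) v)"
    unfolding raised_R pi_sum[OF gU] using RU gU by (intro sum.cong) (auto simp: pi_mult)
  also have "\<dots> = (\<Sum>r\<in>R. \<pi> r v)"
  proof (rule sum_transversal_translate[where f = "\<lambda>r. \<pi> r v" and g' = "ustar g", OF _ R])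
    show "is_subgroup (**) (Dgrp (N + 1) 1 0)" by (rule Dgrp_subgroup) auto
    show "\<pi> (a ** b) v = \<pi> a v" if "a \<in> Kgrp E (N + 1)" "b \<in> Dgrp (N + 1) 1 0" for a b
    proof -
      have "b \<in> Kgrp E N" using that(2) D by blast
      then show ?thesis using that(1) by (simp add: pi_mult Kgrp_unitary v_Kgrp)
    qed
  qed (use g in \<open>simp_all add: Kgrp_mult Kgrp_ustar matrix_mul_assoc ustar_left ustar_right gU\<close>)
  finally show ?thesis by (simp add: raised_R)
qed

lemma torus_l_raised: "torus_l i raised = torus_val (i - 1) + of_nat q * torus_val i"
proof -
  obtain Ry where Ry: "card Ry = q" "raised = \<pi> (zeta_pow (- 1)) v + (\<Sum>y\<in>Ry. \<pi> (umat E 0 y) v)"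
    by (rule raised_sum)
  have "\<psi> 0 = 1" by (rule psi_integer) simp
  then show ?thesis unfolding Ry(2) torus_l_add torus_l_sum torus_l_zeta_pow torus_l_umat by (simp add: torus_val_def Ry(1))
qed

text \<open>Central elements of \<open>K\<^sub>N\<close> fix \<open>v\<close> and commute with the operators that make up \<open>\<theta>'\<close>.\<close>

lemma raised_Zsub:
  assumes z: "z \<in> Zsub E N" shows "\<pi> z raised = raised"
proof -
  have zU: "z \<in> unitary_group E" and zv: "\<pi> z v = v"
    using z by (auto simp: Zsub_def Kgrp_unitary v_Kgrp)
  have comm: "\<pi> z (\<pi> g v) = \<pi> g v" if "g \<in> unitary_group E" for g
  proof -
    have "z ** g = g ** z" using z that by (auto simp: Zsub_def centre_def)
    then show ?thesis using zU zv that by (metis pi_mult)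
  qed
  obtain Ry where "raised = \<pi> (zeta_pow (- 1)) v + (\<Sum>y\<in>Ry. \<pi> (umat E 0 y) v)"
    by (rule raised_sum)
  then show ?thesis using zU by (simp add: pi_add pi_sum comm)
qed

lemma weyl_raised: "\<pi> (weyl (int N)) raised = \<pi> (zeta_pow 1) raised"
proof -
  have "\<pi> (weyl (int N)) raised = \<pi> (weyl (int N)) (\<pi> (weyl (int (N + 1))) raised)"
    by (simp only: raised_Kgrp[OF weyl_Kgrp])
  also have "\<dots> = \<pi> (zeta_pow 1) raised" by (simp add: weyl_mult flip: pi_mult)
  finally show ?thesis .
qed

text \<open>At level \<open>N + 1\<close> the representatives \<open>weyl (N + 1) ** umat E x y\<close> and at level \<open>N\<close> the conjugates of
  \<open>umat E x y\<close> by \<open>weyl N\<close> run over the same parameters \<open>x\<close>, \<open>y\<close>. As \<open>weyl (N + 1)\<close> is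
  \<open>\<zeta>\<^sup>-\<^sup>1\<close> times \<open>weyl N\<close>, and \<open>weyl N\<close> and \<open>\<zeta>\<close> act alike on \<open>raised\<close>, both sums come from the
  same vector \<open>D\<close>.\<close>

lemma eigen_relations:
  obtains Rx Ry D where "transversal (+) (idealE E 0) (idealE E 1) Rx" "card Rx = q\<^sup>2" "card Ry = q\<^sup>2"
    "sc \<nu> raised = (\<Sum>x\<in>Rx. \<Sum>y\<in>Ry. \<pi> (umat E x y) (\<pi> (zeta_pow 1) raised)) + \<pi> (zeta_pow (- 1)) D"
    "sc lam v = D + (\<Sum>x\<in>Rx. \<pi> (umat E x 0) (\<pi> (zeta_pow 1) raised))"
proof -
  define M where "M = N + 1"
  obtain Rx where Rx: "transversal (+) (idealE E 0) (idealE E (int 1)) Rx" "finite Rx" "card Rx = q\<^sup>2"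
    using transversal_idealE_1 by auto
  obtain Ry where Ry: "transversal (+) (idealF E (- int M)) (idealF E (int 2 - int M)) Ry" "finite Ry" "card Ry = q ^ 2"
    using transversal_idealF[of "- int M" 2] by (auto simp: add.commute)
  obtain Ry' where Ry': "transversal (+) (idealF E (1 - int M)) (idealF E (int 2 - int M)) Ry'" "finite Ry'"
    using transversal_idealF_1[of "1 - int M"] by (auto simp: algebra_simps)
  have Ry'N: "transversal (+) (idealF E (- int N)) (idealF E (int 1 - int N)) Ry'"
    using Ry'(1) by (simp add: M_def algebra_simps)
  have triv: "transversal (+) (idealF E (1 - int N)) (idealF E (int 1 - int N)) {0}"
    using transversal_trivial_F[of "1 - int N"] by simp
  define D where "D = (\<Sum>x\<in>Rx. \<Sum>y\<in>Ry'. \<pi> (weyl (int N) ** umat E x y) (\<pi> (zeta_pow 1) raised))"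

  obtain R where R: "transversal (**) (Kgrp E M) (Dgrp M 2 1) R"
    "\<And>f :: 'e^3^3 \<Rightarrow> 'v. sum f R = (\<Sum>x\<in>Rx. \<Sum>y\<in>Ry. f (umat E x y)) +
        (\<Sum>x\<in>Rx. \<Sum>y\<in>Ry'. f (weyl (int M) ** umat E x y))"
    by (rule sum_transversal_Kgrp[where 'v = 'v, OF _ _ _ Rx(1,2) Ry(1,2) Ry'])
       (use N_pos in \<open>auto simp: M_def\<close>)
  have Dg: "Kgrp E M \<inter> (\<lambda>k. zeta_pow 1 ** k ** zeta_pow (- 1)) ` Kgrp E M = Dgrp M 2 1"
    by (rule Kgrp_zeta_conj) (use N_pos in \<open>simp add: M_def\<close>)
  have "hecke_T E \<pi> M raised = (\<Sum>r\<in>R. \<pi> (r ** zeta_pow 1) raised)"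
    unfolding hecke_T_def inverse_zeta_mat unfolding zeta_mat_zeta_pow Dg
  proof (rule coset_sum_transversal[OF _ R(1)])
    show "is_subgroup (**) (Dgrp M 2 1)" by (rule Dgrp_subgroup) (use N_pos in \<open>auto simp: M_def\<close>)
    fix a b assume a: "a \<in> Kgrp E M" and "b \<in> Dgrp M 2 1"
    then obtain k where k: "k \<in> Kgrp E M" "b = zeta_pow 1 ** k ** zeta_pow (- 1)" using Dg by blast
    have "a ** b ** zeta_pow 1 = a ** zeta_pow 1 ** k ** (zeta_pow (- 1) ** zeta_pow 1)"
      unfolding k(2) by (simp only: matrix_mul_assoc)
    also have "\<dots> = (a ** zeta_pow 1) ** k" by (simp add: zeta_pow_add zeta_pow_0)
    finally have "\<pi> (a ** b ** zeta_pow 1) raised = \<pi> (a ** zeta_pow 1) (\<pi> k raised)"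
      using a k by (simp add: pi_mult unitary_mult Kgrp_unitary)
    then show "\<pi> (a ** b ** zeta_pow 1) raised = \<pi> (a ** zeta_pow 1) raised" using k(1) by (simp add: raised_Kgrp M_def)
  qed
  also have "\<dots> = (\<Sum>x\<in>Rx. \<Sum>y\<in>Ry. \<pi> (umat E x y) (\<pi> (zeta_pow 1) raised)) + \<pi> (zeta_pow (- 1)) D"
  proof -
    have w: "weyl (int M) = zeta_pow (- 1) ** weyl (int N)"
    proof -
      have "zeta_pow (- 1) = weyl (int M) ** weyl (int N)" by (simp add: M_def weyl_mult)
      then have "zeta_pow (- 1) ** weyl (int N) = weyl (int M) ** (weyl (int N) ** weyl (int N))"
        by (simp only: matrix_mul_assoc)
      then show ?thesis by (simp add: weyl_weyl)
    qed
    have "\<pi> (weyl (int M) ** umat E x y ** zeta_pow 1) raised =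
        \<pi> (zeta_pow (- 1)) (\<pi> (weyl (int N) ** umat E x y) (\<pi> (zeta_pow 1) raised))" for x y
      unfolding w by (simp add: pi_mult unitary_mult)
    then show ?thesis
      unfolding R(2) D_def by (simp add: pi_sum pi_mult)
  qed
  finally have hecke: "hecke_T E \<pi> M raised =
    (\<Sum>x\<in>Rx. \<Sum>y\<in>Ry. \<pi> (umat E x y) (\<pi> (zeta_pow 1) raised)) + \<pi> (zeta_pow (- 1)) D" .

  let ?c = "\<lambda>r. weyl (int N) ** r ** weyl (int N)"
  obtain S where S: "transversal (**) (Kgrp E N) (Dgrp N 1 1) S"
    "\<And>f :: 'e^3^3 \<Rightarrow> 'v. sum f S = (\<Sum>x\<in>Rx. \<Sum>y\<in>Ry'. f (umat E x y)) +
        (\<Sum>x\<in>Rx. \<Sum>y\<in>{0}. f (weyl (int N) ** umat E x y))"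
    by (rule sum_transversal_Kgrp[where 'v = 'v, OF _ _ _ Rx(1,2) Ry'N Ry'(2) triv])
       (use N_pos in auto)
  have N1: "1 \<le> N" using N_pos by simp
  have cS: "transversal (**) (Kgrp E N) (?c ` Dgrp N 1 1) (?c ` S)"
    by (rule transversal_conj[OF weyl_weyl weyl_conj_Kgrp S(1)])
  have inj: "inj_on ?c S" using weyl_conj_conj by (rule inj_on_inverseI)
  have "delta E \<pi> N raised = (\<Sum>r\<in>?c ` S. \<pi> r raised)"
    unfolding delta_def
  proof (rule coset_sum_transversal[OF Kgrp_centre_subgroup[OF N1]])
    show "transversal (**) (Kgrp E N) (Kgrp E N \<inter> {z ** k |z k. z \<in> Zsub E N \<and> k \<in> Kgrp E (N + 1)}) (?c ` S)"
      unfolding Kgrp_centre_conj[OF N1] by (rule cS)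
    fix a b assume a: "a \<in> Kgrp E N"
      and "b \<in> Kgrp E N \<inter> {z ** k |z k. z \<in> Zsub E N \<and> k \<in> Kgrp E (N + 1)}"
    then obtain z k where zk: "b = z ** k" "z \<in> Zsub E N" "k \<in> Kgrp E (N + 1)" by blast
    have "z \<in> unitary_group E" using zk(2) by (auto simp: Zsub_def Kgrp_unitary)
    then show "\<pi> (a ** b) raised = \<pi> a raised"
      using a zk by (simp add: pi_mult unitary_mult Kgrp_unitary raised_Kgrp raised_Zsub)
  qed
  also have "\<dots> = (\<Sum>r\<in>S. \<pi> (?c r) raised)" by (simp add: sum.reindex[OF inj])
  also have "\<dots> = D + (\<Sum>x\<in>Rx. \<pi> (umat E x 0) (\<pi> (zeta_pow 1) raised))"
  proof -
    have "\<pi> (?c (umat E x y)) raised = \<pi> (weyl (int N) ** umat E x y) (\<pi> (zeta_pow 1) raised)" for x y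
      by (simp add: pi_mult unitary_mult weyl_raised)
    moreover have "\<pi> (?c (weyl (int N) ** umat E x y)) raised = \<pi> (umat E x y) (\<pi> (zeta_pow 1) raised)" for x y
    proof -
      have "?c (weyl (int N) ** umat E x y) = umat E x y ** weyl (int N)"
        by (simp add: matrix_mul_assoc weyl_weyl)
      then show ?thesis by (simp add: pi_mult weyl_raised)
    qed
    ultimately show ?thesis unfolding S(2) D_def by simp
  qed
  finally have delta: "delta E \<pi> N raised = D + (\<Sum>x\<in>Rx. \<pi> (umat E x 0) (\<pi> (zeta_pow 1) raised))" .

  have "raised \<in> Vfix E \<pi> (N + 1)" using raised_Kgrp by (simp add: Vfix_def)
  then have "sc \<nu> raised = hecke_T E \<pi> M raised" using hecke_eigen by (simp add: M_def)
  moreover have "sc lam v = delta E \<pi> N raised" using delta_theta_eigen v_fixed by (simp add: raised_def)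
  ultimately show thesis
    using that[of Rx Ry D] Rx Ry(3) hecke delta by simp
qed

text \<open>Applying \<open>torus_l i\<close> to the first eigenvalue equation and \<open>torus_l (i - 1)\<close> to the second
  makes the unknown values at \<open>D\<close> agree, so they cancel. For \<open>i = 0\<close> the second equation
  only says that the value at \<open>D\<close> vanishes.\<close>

lemma torus_val_recursion:
  "\<nu> * of_nat q = of_nat q ^ 4 * (1 + of_nat q * torus_val 1)"
  "1 \<le> i \<Longrightarrow> (\<nu> + of_nat q ^ 2) * (torus_val (i - 1) + of_nat q * torus_val i) =
     of_nat q ^ 4 * (torus_val i + of_nat q * torus_val (i + 1)) + lam * torus_val (i - 1)"
proof -
  obtain Rx Ry D where Rx: "transversal (+) (idealE E 0) (idealE E 1) Rx" "card Rx = q\<^sup>2" and Ry: "card Ry = q\<^sup>2"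
    and H: "sc \<nu> raised = (\<Sum>x\<in>Rx. \<Sum>y\<in>Ry. \<pi> (umat E x y) (\<pi> (zeta_pow 1) raised)) + \<pi> (zeta_pow (- 1)) D"
    and D: "sc lam v = D + (\<Sum>x\<in>Rx. \<pi> (umat E x 0) (\<pi> (zeta_pow 1) raised))"
    by (rule eigen_relations)
  let ?S = "\<lambda>i. \<Sum>x\<in>Rx. \<psi> (uE powi i * x)"
  have 1: "\<nu> * torus_l i raised = of_nat q ^ 2 * ?S i * torus_l (i + 1) raised + torus_l (i - 1) D" for i
    using arg_cong[OF H, of "torus_l i"]
    by (simp add: torus_l_scale torus_l_add torus_l_sum torus_l_umat torus_l_zeta_pow Ry sum_distrib_left sum_distrib_right mult.assoc)
  have 2: "lam * torus_val (i - 1) = torus_l (i - 1) D + ?S (i - 1) * torus_l i raised" for i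
    using arg_cong[OF D, of "torus_l (i - 1)"]
    by (simp add: torus_l_scale torus_l_add torus_l_sum torus_l_umat torus_l_zeta_pow sum_distrib_right flip: torus_val_def)
  have "\<nu> * of_nat q = of_nat q ^ 2 * of_nat q ^ 2 * torus_l 1 raised + torus_l (- 1) D"
    using 1[of 0] psi_sum_nonneg[OF Rx, of 0] by (simp add: torus_l_raised torus_val_neg torus_val_0)
  moreover have "torus_l (- 1) D = 0" using 2[of 0] psi_sum_neg[OF Rx(1)] by (simp add: torus_val_neg)
  ultimately show "\<nu> * of_nat q = of_nat q ^ 4 * (1 + of_nat q * torus_val 1)"
    by (simp add: torus_l_raised torus_val_0 flip: power_add)
  assume i: "1 \<le> i"
  have "\<nu> * torus_l i raised = of_nat q ^ 2 * of_nat q ^ 2 * torus_l (i + 1) raised + (lam * torus_val (i - 1) - of_nat q ^ 2 * torus_l i raised)"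
    using 1[of i] 2[of i] psi_sum_nonneg[OF Rx, of i] psi_sum_nonneg[OF Rx, of "i - 1"] i by simp
  then show "(\<nu> + of_nat q ^ 2) * (torus_val (i - 1) + of_nat q * torus_val i) =
     of_nat q ^ 4 * (torus_val i + of_nat q * torus_val (i + 1)) + lam * torus_val (i - 1)"
    by (simp add: torus_l_raised algebra_simps flip: power_add)
qed

end

section \<open>Integrals of functions that are constant on the parts of a countable partition\<close>

lemma integral_countable_partition:
  fixes f :: "'a \<Rightarrow> complex" and A :: "nat \<Rightarrow> 'a set"
  assumes A: "\<And>n. A n \<in> sets M" "\<And>n. emeasure M (A n) = ennreal (a n)" "\<And>n. 0 \<le> a n"
    and disj: "\<And>x n n'. x \<in> A n \<Longrightarrow> x \<in> A n' \<Longrightarrow> n = n'"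
    and f: "\<And>x n. x \<in> A n \<Longrightarrow> f x = c n" "\<And>x. x \<in> space M \<Longrightarrow> \<forall>n. x \<notin> A n \<Longrightarrow> f x = 0"
    and sum: "summable (\<lambda>n. cmod (c n) * a n)"
  shows "integrable M f" "(\<lambda>n. c n * of_real (a n)) sums integral\<^sup>L M f"
proof -
  define g where "g n x = indicator (A n) x *\<^sub>R c n" for n x
  have "has_bochner_integral M (g n) (measure M (A n) *\<^sub>R c n)" for n
    unfolding g_def using A(1,2)[of n] by (intro has_bochner_integral_indicator) auto
  moreover have meas: "measure M (A n) = a n" for n
    using A(2,3)[of n] by (simp add: measure_def)
  ultimately have g: "has_bochner_integral M (g n) (a n *\<^sub>R c n)" for n by simp
  have g_int: "integrable M (g n)" for n
    using g by (rule integrable.intros)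
  have fin: "finite {n. x \<in> A n}" for x
  proof (cases "\<exists>n. x \<in> A n")
    case True
    then obtain n where "x \<in> A n" by blast
    then have "{n. x \<in> A n} \<subseteq> {n}" using disj by blast
    then show ?thesis by (rule finite_subset) simp
  qed simp
  have g0: "g n x = 0" if "n \<notin> {n. x \<in> A n}" for n x using that by (simp add: g_def)
  have summ: "AE x in M. summable (\<lambda>n. norm (g n x))"
    by (intro AE_I2 summable_finite[OF fin]) (use g0 in auto)
  have norm_int: "(\<integral>x. norm (g n x) \<partial>M) = cmod (c n) * a n" for n
  proof -
    have "(\<integral>x. norm (g n x) \<partial>M) = (\<integral>x. indicator (A n) x *\<^sub>R cmod (c n) \<partial>M)"
      by (intro Bochner_Integration.integral_cong) (auto simp: g_def indicator_def)
    also have "\<dots> = measure M (A n) *\<^sub>R cmod (c n)"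
      using A(1,2)[of n] by (intro has_bochner_integral_integral_eq has_bochner_integral_indicator) auto
    finally show ?thesis by (simp add: meas mult.commute)
  qed
  have g_integral: "integral\<^sup>L M (g n) = c n * of_real (a n)" for n
    using has_bochner_integral_integral_eq[OF g] by (simp add: scaleR_conv_of_real mult.commute)
  have sum': "summable (\<lambda>n. \<integral>x. norm (g n x) \<partial>M)" using sum by (simp add: norm_int)
  have f_eq: "(\<Sum>n. g n x) = f x" if "x \<in> space M" for x
  proof (cases "\<exists>n. x \<in> A n")
    case True
    then obtain n where n: "x \<in> A n" by blast
    have "(\<Sum>n. g n x) = (\<Sum>n\<in>{n}. g n x)"
    proof (rule suminf_finite)
      fix k assume "k \<notin> {n}"
      then have "x \<notin> A k" using disj n by auto
      then show "g k x = 0" by (simp add: g_def)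
    qed simp
    then show ?thesis using n f(1) by (simp add: g_def)
  next
    case False
    then show ?thesis using f(2)[OF that] by (simp add: g_def)
  qed
  have "integrable M (\<lambda>x. \<Sum>n. g n x)" by (rule integrable_suminf[OF g_int summ sum'])
  then show "integrable M f" using f_eq by (simp cong: Bochner_Integration.integrable_cong)
  have "(\<lambda>n. integral\<^sup>L M (g n)) sums (\<integral>x. (\<Sum>n. g n x) \<partial>M)"
    by (rule sums_integral[OF g_int summ sum'])
  moreover have "(\<integral>x. (\<Sum>n. g n x) \<partial>M) = integral\<^sup>L M f"
    by (rule Bochner_Integration.integral_cong) (use f_eq in auto)
  ultimately show "(\<lambda>n. c n * of_real (a n)) sums integral\<^sup>L M f" by (simp add: g_integral)
qed

lemma open_vabs_le: "0 < r \<Longrightarrow> open {x :: 'a::nonarch_valued_field. vabs x \<le> r}"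
  unfolding open_dist
proof (intro ballI exI[of _ r] conjI allI impI)
  fix x y :: 'a assume "x \<in> {x. vabs x \<le> r}" "dist y x < r"
  then show "y \<in> {x. vabs x \<le> r}" using vabs_add_le[of "y - x" r x] by (simp add: dist_vabs)
qed simp

lemma open_vabs_eq: "0 < r \<Longrightarrow> open {x :: 'a::nonarch_valued_field. vabs x = r}"
  unfolding open_dist
proof (intro ballI exI[of _ r] conjI allI impI)
  fix x y :: 'a assume "x \<in> {x. vabs x = r}" "dist y x < r"
  then show "y \<in> {x. vabs x = r}" using vabs_add_eq[of "y - x" x] by (simp add: dist_vabs)
qed simp

text \<open>The field operations are continuous for the metric of the absolute value; this instance is the one
  that lower unipotent translations of row vectors need.\<close>

lemma continuous_on_diff_mult:
  fixes f g :: "'b::topological_space \<Rightarrow> 'a::nonarch_valued_field"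
  assumes f: "continuous_on S f" and g: "continuous_on S g"
  shows "continuous_on S (\<lambda>x. f x - g x * z)"
  unfolding continuous_on tendsto_iff
proof (intro ballI allI impI)
  fix a and e :: real assume a: "a \<in> S" and e: "0 < e"
  let ?d = "e / (vabs z + 1)"
  have z: "0 < vabs z + 1" using vabs_nonneg[of z] by linarith
  then have d: "0 < ?d" using e by simp
  have "\<forall>\<^sub>F x in at a within S. dist (f x) (f a) < e" "\<forall>\<^sub>F x in at a within S. dist (g x) (g a) < ?d"
    using f g a e d unfolding continuous_on tendsto_iff by blast+
  then show "\<forall>\<^sub>F x in at a within S. dist (f x - g x * z) (f a - g a * z) < e"
  proof eventually_elim
    case (elim x)
    have eq: "(f x - g x * z) - (f a - g a * z) = (f x - f a) + (g a - g x) * z"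
      by (simp add: algebra_simps)
    have "vabs (g a - g x) * vabs z \<le> vabs (g a - g x) * (vabs z + 1)"
      by (simp add: mult_left_mono)
    also have "\<dots> < e"
      using elim(2) z by (simp add: dist_vabs vabs_minus_commute[of "g x"] pos_less_divide_eq)
    finally have "vabs ((g a - g x) * z) < e" by (simp add: vabs_mult)
    then show ?case using elim(1) unfolding dist_vabs eq by (intro vabs_add_less)
  qed
qed

context unram_ext
begin

section \<open>The integral over the multiplicative group of \<open>F\<close>\<close>

abbreviation Xs :: "complex \<Rightarrow> complex" where "Xs s \<equiv> of_nat q powr (- 2 * s)"

lemma powi_q_powr: "complex_of_real (real q powi n) powr s = (of_nat q powr s) powi n"
proof -
  have "real q powi n = exp (of_int n * ln (real q))"
    using exp_power_int[of "ln (real q)" n] by simp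
  then have 1: "complex_of_real (real q powi n) powr s = exp (of_int n * (s * of_real (ln (real q))))"
    by (simp add: powr_def Ln_of_real exp_of_real[symmetric] del: exp_of_real)
       (simp add: exp_of_real Ln_of_real mult_ac)
  have "of_nat q powr s = exp (s * of_real (ln (real q)))"
    using Ln_of_real[of "real q"] by (simp add: powr_def)
  then show ?thesis using 1 by (simp add: exp_power_int)
qed

lemma Xs_nonzero [simp]: "Xs s \<noteq> 0"
  by (simp add: powr_def)

lemma norm_Xs: "cmod (Xs s) = real q powr (- 2 * Re s)"
  using norm_powr_real_powr[of "of_nat q" "- 2 * s"] by simp

lemma powi_q_powr2: "complex_of_real (real q powi (- 2 * n)) powr s = Xs s powi n"
proof -
  have "Xs s = of_nat q powr (- s + - s)" by simp
  also have "\<dots> = inverse (of_nat q powr s) * inverse (of_nat q powr s)"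
    by (simp only: powr_add powr_minus)
  finally have X: "Xs s = (of_nat q powr s) powi (- 2)"
    by (simp add: power_int_def power2_eq_square)
  show ?thesis unfolding powi_q_powr X by (rule power_int_mult)
qed

lemma haar_shell:
  assumes mF: "haar_units mF"
  shows "{r. vabs r = real q powi n} \<in> sets mF" "emeasure mF {r :: 'f. vabs r = real q powi n} = 1"
proof -
  have S: "{r :: 'f. vabs r = real q powi k} \<in> sets mF" for k
  proof -
    have "{r :: 'f. vabs r = real q powi k} \<in> sets borel"
      by (intro borel_open open_vabs_eq) simp
    moreover have "{r :: 'f. vabs r = real q powi k} \<subseteq> UNIV - {0}" by auto
    ultimately show ?thesis
      using mF by (auto simp: haar_units_def sets_restrict_space image_iff intro!: bexI[of _ "{r :: 'f. vabs r = real q powi k}"])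
  qed
  then show "{r. vabs r = real q powi n} \<in> sets mF" .
  have "{r :: 'f. vabs r = real q powi n} = (*) (uF powi (- n)) ` {r. vabs r = 1}"
  proof (intro equalityI subsetI)
    fix r :: 'f assume r: "r \<in> {r. vabs r = real q powi n}"
    have "r = uF powi (- n) * (uF powi n * r)" by (simp add: power_int_minus)
    moreover have "vabs (uF powi n * r) = 1"
      using r by (simp add: vabs_mult vabs_uF_powi power_int_minus)
    ultimately show "r \<in> (*) (uF powi (- n)) ` {r. vabs r = 1}" by blast
  next
    fix r :: 'f assume "r \<in> (*) (uF powi (- n)) ` {r. vabs r = 1}"
    then show "r \<in> {r. vabs r = real q powi n}"
      using vabs_uF_powi[of "- n"] by (auto simp: vabs_mult)
  qed
  then show "emeasure mF {r :: 'f. vabs r = real q powi n} = 1"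
    using mF S[of 0] by (simp add: haar_units_def)
qed

text \<open>When \<open>\<Phi>\<close> restricts \<open>r\<close> to a ball of radius \<open>q\<^sup>m\<close>, the integral is a geometric series.\<close>

lemma z_int_ball:
  assumes mF: "haar_units mF" and s: "Re s > 0"
    and ball: "\<And>r. r \<noteq> 0 \<Longrightarrow> (g$2$1 * r \<in> idealF E n \<and> g$2$2 * r \<in> ring_of_integers) \<longleftrightarrow> vabs r \<le> real q powi m"
  shows "z_int E mF s g (Phi E n) = Xs s powi (- m) / (1 - Xs s)"
proof -
  let ?f = "\<lambda>r. Phi E n (vector [0, r] v* g) * complex_of_real (vabs (j r)) powr s"
  let ?A = "\<lambda>k::nat. {r :: 'f. vabs r = real q powi (m - int k)}"
  let ?c = "\<lambda>k::nat. Xs s powi (- m) * Xs s ^ k"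
  have sp: "space mF = UNIV - {0}"
    using mF sets_eq_imp_space_eq[of mF "restrict_space borel (UNIV - {0})"]
    by (simp add: haar_units_def space_restrict_space)
  have lt: "cmod (Xs s) < 1" unfolding norm_Xs using s q_gt_1 powr_less_mono[of "- 2 * Re s" 0 "real q"] by simp
  have f_eq: "?f r = (if vabs r \<le> real q powi m then complex_of_real ((vabs r)\<^sup>2) powr s else 0)"
    if "r \<noteq> 0" for r :: 'f
  proof -
    have "(vector [0, r] v* g)$1 = g$2$1 * r" "(vector [0, r] v* g)$2 = g$2$2 * r"
      by (simp_all add: vector_matrix_mult_def sum_2 mult.commute)
    then show ?thesis using ball[OF that] by (simp add: Phi_def indicator_def)
  qed
  have "(\<lambda>k. ?c k * of_real 1) sums integral\<^sup>L mF ?f"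
  proof (rule integral_countable_partition(2)[where A = ?A])
    show "?A k \<in> sets mF" "emeasure mF (?A k) = ennreal 1" for k
      using haar_shell[OF mF] by simp_all
    show "k = k'" if "r \<in> ?A k" "r \<in> ?A k'" for r k k' using that by simp
    show "?f r = ?c k" if "r \<in> ?A k" for r k
    proof -
      have r: "vabs r = real q powi (m - int k)" using that by simp
      have r0: "r \<noteq> 0" using r by (metis powi_q_pos(2) vabs_zero)
      have "?f r = complex_of_real (real q powi (- 2 * (int k - m))) powr s"
        unfolding f_eq[OF r0] using r by (simp add: powi_q_square algebra_simps)
      also have "\<dots> = Xs s powi (- m + int k)" unfolding powi_q_powr2 by simp
      also have "\<dots> = Xs s powi (- m) * Xs s powi int k" by (rule power_int_add) simp
      also have "\<dots> = ?c k" by (simp only: power_int_of_nat)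
      finally show ?thesis .
    qed
    show "?f r = 0" if "r \<in> space mF" "\<forall>k. r \<notin> ?A k" for r
    proof -
      have r0: "r \<noteq> 0" using that(1) sp by auto
      then obtain i where i: "vabs r = real q powi i" by (rule value_F)
      have "\<not> i \<le> m"
      proof
        assume "i \<le> m"
        then have "i = m - int (nat (m - i))" by simp
        then show False using that(2) i by (metis (mono_tags) mem_Collect_eq)
      qed
      then show ?thesis unfolding f_eq[OF r0] by (simp add: i)
    qed
    show "summable (\<lambda>k. cmod (?c k) * 1)"
      using lt by (simp add: norm_mult norm_power summable_mult summable_geometric)
  qed simp
  moreover have "(\<lambda>k. ?c k * of_real 1) sums (Xs s powi (- m) * (1 / (1 - Xs s)))"
    using sums_mult[OF geometric_sums[OF lt]] by simp
  ultimately show ?thesis unfolding z_int_def using sums_unique2 by fastforce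
qed

section \<open>The group \<open>H\<close> and its quotient\<close>

lemma Hgrp_iff: "h \<in> Hgrp E \<longleftrightarrow> h \<in> unitary_group E \<and> h$1$2 = 0 \<and> h$2$1 = 0 \<and> h$2$2 = 1 \<and> h$2$3 = 0 \<and> h$3$2 = 0"
proof -
  have *: "embH m = mat3 (m$1$1) 0 (m$1$2) 0 1 0 (m$2$1) 0 (m$2$2)" for m :: "'e^2^2"
    by (simp add: embH_def mat3_def)
  have "h \<in> range embH \<longleftrightarrow> h$1$2 = 0 \<and> h$2$1 = 0 \<and> h$2$2 = 1 \<and> h$2$3 = 0 \<and> h$3$2 = 0"
  proof
    assume R: "h$1$2 = 0 \<and> h$2$1 = 0 \<and> h$2$2 = 1 \<and> h$2$3 = 0 \<and> h$3$2 = 0"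
    have "h = embH (vector [vector [h$1$1, h$1$3], vector [h$3$1, h$3$3]])"
      using R by (simp add: * mat3_cong_iff)
    then show "h \<in> range embH" by blast
  qed (auto simp: *)
  then show ?thesis by (auto simp: Hgrp_def)
qed

lemma Hgrp_mult: "g \<in> Hgrp E \<Longrightarrow> h \<in> Hgrp E \<Longrightarrow> g ** h \<in> Hgrp E"
  by (simp add: Hgrp_iff unitary_mult mult_nth3)

lemma Hgrp_ustar: "g \<in> Hgrp E \<Longrightarrow> ustar g \<in> Hgrp E"
  by (simp add: Hgrp_iff unitary_ustar)

lemma Hgrp_unitary: "h \<in> Hgrp E \<Longrightarrow> h \<in> unitary_group E"
  by (simp add: Hgrp_iff)

lemma zeta_pow_Hgrp [simp]: "zeta_pow i \<in> Hgrp E" and weyl_Hgrp [simp]: "weyl i \<in> Hgrp E"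
  and umat_Hgrp [simp]: "umat E 0 y \<in> Hgrp E"
  by (simp_all add: Hgrp_iff) (simp_all add: zeta_pow_def weyl_def umat_mat3)

lemma Hgrp_rel:
  assumes "h \<in> Hgrp E"
  shows "cj (h$3$3) * h$1$1 + cj (h$1$3) * h$3$1 = 1" "cj (h$3$3) * h$1$3 + cj (h$1$3) * h$3$3 = 0"
    "cj (h$3$1) * h$1$1 + cj (h$1$1) * h$3$1 = 0" "cj (h$3$1) * h$1$3 + cj (h$1$1) * h$3$3 = 1"
    "h$3$1 * cj (h$3$3) + h$3$3 * cj (h$3$1) = 0"
proof -
  have h: "h \<in> unitary_group E" "h$1$2 = 0" "h$2$1 = 0" "h$2$3 = 0" "h$3$2 = 0"
    using assms by (auto simp: Hgrp_iff)
  show "cj (h$3$3) * h$1$1 + cj (h$1$3) * h$3$1 = 1" "cj (h$3$3) * h$1$3 + cj (h$1$3) * h$3$3 = 0"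
    "cj (h$3$1) * h$1$1 + cj (h$1$1) * h$3$1 = 0" "cj (h$3$1) * h$1$3 + cj (h$1$1) * h$3$3 = 1"
    using unitary_rel[OF h(1)] h by simp_all
  have "(h ** ustar h)$3$1 = 0" using ustar_right[OF h(1)] by simp
  then show "h$3$1 * cj (h$3$3) + h$3$3 * cj (h$3$1) = 0" using h by (simp add: mult_nth3)
qed

lemma UH_eq: "UH E = {umat E 0 y | y. True}"
proof -
  have "x = 0" if "umat E x y \<in> Hgrp E" for x y
    using that by (simp add: Hgrp_iff umat_mat3)
  then show ?thesis unfolding UH_def using umat_Hgrp by blast
qed

lemma cosetUH_eq: "cosetUH E h = {umat E 0 y ** h | y. True}"
  by (auto simp: cosetUH_def UH_eq)

lemma cosetUH_row:
  assumes "g \<in> cosetUH E h" shows "g$3$1 = h$3$1" "g$3$3 = h$3$3"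
  using assms by (auto simp: cosetUH_eq mult_nth3 umat_mat3)

lemma cosetUH_Hgrp: "g \<in> cosetUH E h \<Longrightarrow> h \<in> Hgrp E \<Longrightarrow> g \<in> Hgrp E"
  by (auto simp: cosetUH_eq Hgrp_mult)

lemma cosetUH_self: "h \<in> cosetUH E h"
  by (simp add: cosetUH_eq) (metis matrix_mul_lid umat_0_0)

lemma cosetUH_umat: "cosetUH E (umat E 0 y ** h) = cosetUH E h"
proof -
  have "umat E 0 z ** (umat E 0 y ** h) = umat E 0 (z + y) ** h" for z
    by (simp add: matrix_mul_assoc umat_0_add)
  moreover have "umat E 0 z ** h = umat E 0 (z - y) ** (umat E 0 y ** h)" for z
    by (simp add: matrix_mul_assoc umat_0_add)
  ultimately show ?thesis unfolding cosetUH_eq by blast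
qed

text \<open>The bottom row is a complete invariant of a coset: the quotient is a space of row vectors.\<close>

lemma same_row:
  assumes h: "h \<in> Hgrp E" "h' \<in> Hgrp E" and row: "h'$3$1 = h$3$1" "h'$3$3 = h$3$3"
  obtains y where "h' = umat E 0 y ** h"
proof -
  define u where "u = h' ** ustar h"
  have uH: "u \<in> Hgrp E" unfolding u_def by (intro Hgrp_mult Hgrp_ustar h)
  have z: "h$3$2 = 0" "h'$3$2 = 0" using h by (auto simp: Hgrp_iff)
  have "u$3$1 = (h ** ustar h)$3$1" "u$3$3 = (h ** ustar h)$3$3"
    by (simp_all add: u_def mult_nth3 row z)
  then have u3: "u$3$1 = 0" "u$3$3 = 1" using ustar_right[OF Hgrp_unitary[OF h(1)]] by simp_all
  have u11: "u$1$1 = 1" using Hgrp_rel(1)[OF uH] u3 by simp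
  have "cj (u$1$3) = - u$1$3" using Hgrp_rel(2)[OF uH] u3 by (simp add: eq_neg_iff_add_eq_0 add.commute)
  from cj_antifixed[OF this] have u13: "u$1$3 = j (imF (u$1$3)) * se" .
  have "u = umat E 0 (imF (u$1$3))"
    using uH u3 u11 u13 by (simp add: mat3_cong_iff umat_mat3 Hgrp_iff)
  moreover have "h' = u ** h"
    by (simp add: u_def ustar_left[OF Hgrp_unitary[OF h(1)]] flip: matrix_mul_assoc)
  ultimately show thesis using that by metis
qed

definition rowset :: "('e \<Rightarrow> 'e \<Rightarrow> bool) \<Rightarrow> ('e^3^3) set" where
  "rowset P = {h \<in> Hgrp E. P (h$3$1) (h$3$3)}"

definition rowcosets :: "('e \<Rightarrow> 'e \<Rightarrow> bool) \<Rightarrow> ('e^3^3) set set" where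
  "rowcosets P = cosetUH E ` rowset P"

lemma cosetUH_in_rowcosets: "h \<in> Hgrp E \<Longrightarrow> cosetUH E h \<in> rowcosets P \<longleftrightarrow> P (h$3$1) (h$3$3)"
proof
  assume "cosetUH E h \<in> rowcosets P"
  then obtain g where g: "g \<in> rowset P" "cosetUH E h = cosetUH E g" by (auto simp: rowcosets_def)
  then have "h \<in> cosetUH E g" using cosetUH_self by blast
  then show "P (h$3$1) (h$3$3)" using g(1) cosetUH_row[of h g] by (simp add: rowset_def)
qed (auto simp: rowcosets_def rowset_def)

lemma Union_rowcosets: "\<Union> (rowcosets P) = rowset P"
proof
  show "\<Union> (rowcosets P) \<subseteq> rowset P"
    using cosetUH_row cosetUH_Hgrp by (fastforce simp: rowcosets_def rowset_def)
  show "rowset P \<subseteq> \<Union> (rowcosets P)" using cosetUH_self by (auto simp: rowcosets_def)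
qed

text \<open>Right translation acts on the space of rows, so a set of cosets given by a condition on rows
  is translated by transporting the condition.\<close>

lemma rowcosets_translate:
  assumes t: "t \<in> Hgrp E"
    and PQ: "\<And>h. h \<in> Hgrp E \<Longrightarrow> P (h$3$1) (h$3$3) \<longleftrightarrow> Q ((h ** t)$3$1) ((h ** t)$3$3)"
  shows "(\<lambda>X. (\<lambda>g. g ** t) ` X) ` rowcosets P = rowcosets Q"
proof -
  have c: "(\<lambda>g. g ** t) ` cosetUH E h = cosetUH E (h ** t)" for h
    by (auto simp: cosetUH_eq matrix_mul_assoc image_iff)
  have "rowset Q = (\<lambda>g. g ** t) ` rowset P"
  proof
    show "(\<lambda>g. g ** t) ` rowset P \<subseteq> rowset Q" using t PQ by (auto simp: rowset_def Hgrp_mult)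
    show "rowset Q \<subseteq> (\<lambda>g. g ** t) ` rowset P"
    proof
      fix h assume h: "h \<in> rowset Q"
      let ?g = "h ** ustar t"
      have g: "?g \<in> Hgrp E" using h t by (auto simp: rowset_def Hgrp_mult Hgrp_ustar)
      have gt: "?g ** t = h"
        by (simp add: ustar_left[OF Hgrp_unitary[OF t]] flip: matrix_mul_assoc)
      then have "?g \<in> rowset P" using g PQ[OF g] h by (simp add: rowset_def)
      then show "h \<in> (\<lambda>g. g ** t) ` rowset P" using gt by (metis image_eqI)
    qed
  qed
  then show ?thesis by (auto simp: rowcosets_def image_image c)
qed

lemma rowcosets_disj: "(\<And>C D. P C D \<Longrightarrow> Q C D \<Longrightarrow> False) \<Longrightarrow> rowcosets P \<inter> rowcosets Q = {}"
proof (rule ccontr)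
  assume no: "\<And>C D. P C D \<Longrightarrow> Q C D \<Longrightarrow> False" and "rowcosets P \<inter> rowcosets Q \<noteq> {}"
  then obtain h where h: "h \<in> rowset P" "cosetUH E h \<in> rowcosets Q" by (auto simp: rowcosets_def)
  then show False using no cosetUH_in_rowcosets[of h Q] by (auto simp: rowset_def)
qed

lemma rowcosets_Un: "rowcosets (\<lambda>C D. P C D \<or> Q C D) = rowcosets P \<union> rowcosets Q"
  unfolding rowcosets_def rowset_def by auto

lemma open_row_pred:
  assumes "open {C. P C}" "open {D. Q D}" shows "open {h :: 'e^3^3. P (h$3$1) \<and> Q (h$3$3)}"
proof -
  have "open ((\<lambda>h :: 'e^3^3. h$3$1) -` {C. P C} \<inter> (\<lambda>h :: 'e^3^3. h$3$3) -` {D. Q D})"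
    using assms by (intro open_Int open_vimage continuous_intros)
  then show ?thesis by (simp add: vimage_def Collect_conj_eq)
qed

lemma rowcosets_sets:
  assumes mH: "haar_quotient E N mH" and P: "open {h :: 'e^3^3. P (h$3$1) (h$3$3)}"
  shows "rowcosets P \<in> sets mH"
proof -
  have "rowset P = Hgrp E \<inter> {h :: 'e^3^3. P (h$3$1) (h$3$3)}" by (auto simp: rowset_def)
  then have "openin (top_of_set (Hgrp E)) (\<Union> (rowcosets P))"
    unfolding Union_rowcosets using P by (auto intro: openin_open_Int)
  moreover have "rowcosets P \<subseteq> quotient_space E"
    by (auto simp: rowcosets_def rowset_def quotient_space_def)
  ultimately show ?thesis
    using mH unfolding haar_quotient_def by (auto intro: sigma_sets.Basic)
qed

text \<open>Rows \<open>(C, D)\<close> are classified by \<open>min (val C - N) (val D)\<close>. The level sets of this function are the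
  orbits of \<open>H \<inter> K\<^sub>N\<close>; each is the disjoint union of the rows where \<open>D\<close>, respectively only
  \<open>C\<close>, has the minimal valuation.\<close>

definition rowsD :: "nat \<Rightarrow> int \<Rightarrow> int \<Rightarrow> 'e \<Rightarrow> 'e \<Rightarrow> bool" where
  "rowsD N m n C D \<longleftrightarrow> C \<in> idealE E (int N + m) \<and> vabs D = real q powi (- 2 * n)"

definition rowsC :: "nat \<Rightarrow> int \<Rightarrow> 'e \<Rightarrow> 'e \<Rightarrow> bool" where
  "rowsC N n C D \<longleftrightarrow> vabs C = real q powi (- 2 * (int N + n)) \<and> D \<in> idealE E (n + 1)"

definition orbit_rows :: "nat \<Rightarrow> int \<Rightarrow> 'e \<Rightarrow> 'e \<Rightarrow> bool" where
  "orbit_rows N n C D \<longleftrightarrow> rowsD N n n C D \<or> rowsC N n C D"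

lemma open_rows:
  "open {h :: 'e^3^3. rowsD N m n (h$3$1) (h$3$3)}" "open {h :: 'e^3^3. rowsC N n (h$3$1) (h$3$3)}"
  "open {h :: 'e^3^3. orbit_rows N n (h$3$1) (h$3$3)}"
proof -
  have I: "open {x. x \<in> idealE E i}" for i unfolding idealE_iff by (intro open_vabs_le) simp
  show 1: "open {h :: 'e^3^3. rowsD N m n (h$3$1) (h$3$3)}" for m
    unfolding rowsD_def by (intro open_row_pred I open_vabs_eq) simp
  show 2: "open {h :: 'e^3^3. rowsC N n (h$3$1) (h$3$3)}"
    unfolding rowsC_def by (intro open_row_pred I open_vabs_eq) simp
  show "open {h :: 'e^3^3. orbit_rows N n (h$3$1) (h$3$3)}"
    unfolding orbit_rows_def using open_Un[OF 1[of n] 2] by (simp add: Collect_disj_eq)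
qed

lemma rows_eqD:
  assumes "orbit_rows N n C D" "orbit_rows N n' C D" shows "n = n'"
proof -
  have E: "i \<le> k" if "vabs x = real q powi (- 2 * k)" "x \<in> idealE E i" for x i k
  proof -
    have "real q powi (- 2 * k) \<le> real q powi (- 2 * i)" using that by (simp only: idealE_iff)
    then have "- 2 * k \<le> - 2 * i" by (rule powi_q_le_iff[THEN iffD1])
    then show ?thesis by simp
  qed
  from assms consider "rowsD N n n C D" "rowsD N n' n' C D" | "rowsC N n C D" "rowsC N n' C D"
    | "rowsD N n n C D" "rowsC N n' C D" | "rowsC N n C D" "rowsD N n' n' C D"
    by (auto simp: orbit_rows_def)
  then show ?thesis
  proof cases
    case 3
    then have "int N + n \<le> int N + n'" "n' + 1 \<le> n" using E by (auto simp only: rowsD_def rowsC_def)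
    then show ?thesis by simp
  next
    case 4
    then have "int N + n' \<le> int N + n" "n + 1 \<le> n'" using E by (auto simp only: rowsD_def rowsC_def)
    then show ?thesis by simp
  qed (auto simp: rowsD_def rowsC_def)
qed

lemma rows_exist:
  assumes "h \<in> Hgrp E" obtains n where "orbit_rows N n (h$3$1) (h$3$3)"
proof -
  let ?C = "h$3$1" and ?D = "h$3$3"
  have E: "x \<in> idealE E i \<longleftrightarrow> i \<le> k" if "vabs x = real q powi (- 2 * k)" for x i k
    unfolding idealE_iff that by (subst powi_q_le_iff) auto
  consider "?D = 0" "?C \<noteq> 0" | "?C = 0" "?D \<noteq> 0" | "?C \<noteq> 0" "?D \<noteq> 0"
    using Hgrp_rel(1)[OF assms] by fastforce
  then show thesis
  proof cases
    case 1
    then obtain k where "vabs ?C = real q powi (- 2 * k)" using value_E by blast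
    then show thesis using that[of "k - int N"] 1 by (simp add: orbit_rows_def rowsC_def)
  next
    case 2
    then obtain k where "vabs ?D = real q powi (- 2 * k)" using value_E by blast
    then show thesis using that[of k] 2 by (simp add: orbit_rows_def rowsD_def)
  next
    case 3
    obtain k where k: "vabs ?C = real q powi (- 2 * k)" using 3 value_E by blast
    obtain i where i: "vabs ?D = real q powi (- 2 * i)" using 3 value_E by blast
    show thesis
    proof (cases "int N + i \<le> k")
      case True
      then show thesis using that[of i] i E[OF k] by (simp add: orbit_rows_def rowsD_def)
    next
      case False
      then show thesis using that[of "k - int N"] k E[OF i] by (simp add: orbit_rows_def rowsC_def)
    qed
  qed
qed

text \<open>The Iwasawa decomposition follows from \<open>same_row\<close>: every admissible row is the bottom row of an
  element of \<open>K\<^sub>N\<close>, which can be written down.\<close>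

lemma Hgrp_Kgrp_rows:
  assumes N: "1 \<le> N"
  shows "h \<in> Hgrp E \<inter> Kgrp E N \<Longrightarrow> orbit_rows N 0 (h$3$1) (h$3$3)"
    and "h \<in> Hgrp E \<Longrightarrow> orbit_rows N 0 (h$3$1) (h$3$3) \<Longrightarrow>
           \<exists>k y. k \<in> Hgrp E \<inter> Kgrp E N \<and> h = umat E 0 y ** k"
proof -
  assume h: "h \<in> Hgrp E \<inter> Kgrp E N"
  then have K: "h \<in> Kgrp E N" by simp
  have "h$3$3 \<in> idealE E 0" using K by (simp add: Kgrp_iff)
  then show "orbit_rows N 0 (h$3$1) (h$3$3)"
  proof (cases rule: idealE_0_cases)
    case 1
    then show ?thesis using K by (simp add: orbit_rows_def rowsD_def Kgrp_iff)
  next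
    case 2
    have one: "vabs (h$3$1) * vabs (h$1$3) = 1" by (rule Kgrp_33_nonunit(3)[OF K N 2])
    have le: "vabs (h$3$1) \<le> real q powi (- 2 * int N)" "vabs (h$1$3) \<le> real q powi (- 2 * (- int N))"
      using K by (simp_all only: Kgrp_iff idealE_iff)
    have "real q powi (- 2 * int N) = real q powi (- 2 * int N) * (vabs (h$3$1) * vabs (h$1$3))"
      by (simp only: one mult_1_right)
    also have "\<dots> \<le> real q powi (- 2 * int N) * (vabs (h$3$1) * real q powi (- 2 * (- int N)))"
      using le(2) by (intro mult_left_mono) (auto simp: less_imp_le)
    also have "\<dots> = vabs (h$3$1)" by (simp add: power_int_minus)
    finally have "vabs (h$3$1) = real q powi (- 2 * int N)" using le(1) by simp
    then show ?thesis using 2 by (simp add: orbit_rows_def rowsC_def)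
  qed
next
  assume h: "h \<in> Hgrp E" and r: "orbit_rows N 0 (h$3$1) (h$3$3)"
  let ?C = "h$3$1" and ?D = "h$3$3"
  have rel: "?C * cj ?D + ?D * cj ?C = 0" by (rule Hgrp_rel(5)[OF h])
  obtain k where k: "k \<in> Hgrp E \<inter> Kgrp E N" "k$3$1 = ?C" "k$3$3 = ?D"
  proof -
    from r consider "rowsD N 0 0 ?C ?D" | "rowsC N 0 ?C ?D" by (auto simp: orbit_rows_def)
    then show thesis
    proof cases
      case 1
      then have C: "?C \<in> idealE E (int N)" and D: "vabs ?D = 1" by (auto simp: rowsD_def)
      have D0: "?D \<noteq> 0" using D by auto
      \<comment> \<open>When \<open>D\<close> is a unit the row is completed to a lower triangular matrix.\<close>
      let ?k = "mat3 (inverse (cj ?D)) 0 0 0 1 0 ?C 0 ?D"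
      have "cj ?C / cj ?D + ?C / ?D = 0" using rel D0 by (simp add: field_simps)
      then have "cj ?C * inverse (cj ?D) + inverse ?D * ?C = 0" by (simp add: field_simps)
      then have "?k \<in> unitary_group E"
        using D0 by (simp add: unitary_iff mat3_cong_iff mult_nth3 cj_inverse)
      then have "?k \<in> Hgrp E \<inter> Kgrp E N"
        using C D by (simp add: Hgrp_iff Kgrp_iff idealE_iff[of _ 0] vabs_inverse)
      then show thesis using that by simp
    next
      case 2
      then have C: "vabs ?C = real q powi (- 2 * int N)" and D: "?D \<in> idealE E 1" by (auto simp: rowsC_def)
      have C0: "?C \<noteq> 0" using C by (metis powi_q_pos(2) vabs_zero)
      \<comment> \<open>Otherwise \<open>C\<close> has exact valuation \<open>N\<close>, so its inverse is allowed in the upper right corner.\<close>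
      let ?k = "mat3 0 0 (inverse (cj ?C)) 0 1 0 ?C 0 ?D"
      have "cj ?D / cj ?C + ?D / ?C = 0" using rel C0 by (simp add: field_simps)
      then have "cj ?D * inverse (cj ?C) + inverse ?C * ?D = 0" by (simp add: field_simps)
      then have U: "?k \<in> unitary_group E"
        using C0 by (simp add: unitary_iff mat3_cong_iff mult_nth3 cj_inverse)
      have "inverse (cj ?C) \<in> idealE E (- int N)"
        unfolding idealE_iff vabs_inverse vabs_cj C by (simp add: power_int_minus)
      moreover have "?C \<in> idealE E (int N)" using C by (simp add: idealE_iff)
      moreover have "?D \<in> idealE E 0" using D by (rule idealE_mono) simp
      ultimately have "?k \<in> Hgrp E \<inter> Kgrp E N" using U by (simp add: Hgrp_iff Kgrp_iff)
      then show thesis using that by simp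
    qed
  qed
  obtain y where "h = umat E 0 y ** k" using same_row[of k h] k h by auto
  then show "\<exists>k y. k \<in> Hgrp E \<inter> Kgrp E N \<and> h = umat E 0 y ** k" using k(1) by blast
qed

lemma rowcosets_0: "1 \<le> N \<Longrightarrow> rowcosets (orbit_rows N 0) = cosetUH E ` (Hgrp E \<inter> Kgrp E N)"
proof
  assume N: "1 \<le> N"
  show "cosetUH E ` (Hgrp E \<inter> Kgrp E N) \<subseteq> rowcosets (orbit_rows N 0)"
    using Hgrp_Kgrp_rows(1)[OF N] by (auto simp: rowcosets_def rowset_def)
  show "rowcosets (orbit_rows N 0) \<subseteq> cosetUH E ` (Hgrp E \<inter> Kgrp E N)"
  proof
    fix X assume "X \<in> rowcosets (orbit_rows N 0)"
    then obtain h where h: "h \<in> Hgrp E" "orbit_rows N 0 (h$3$1) (h$3$3)" "X = cosetUH E h"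
      by (auto simp: rowcosets_def rowset_def)
    then obtain k y where "k \<in> Hgrp E \<inter> Kgrp E N" "h = umat E 0 y ** k"
      using Hgrp_Kgrp_rows(2)[OF N] by blast
    then show "X \<in> cosetUH E ` (Hgrp E \<inter> Kgrp E N)" using h(3) cosetUH_umat by auto
  qed
qed

lemma Iwasawa:
  assumes N: "1 \<le> N" and h: "h \<in> Hgrp E" "orbit_rows N n (h$3$1) (h$3$3)"
  obtains y k where "k \<in> Hgrp E \<inter> Kgrp E N" "h = umat E 0 y ** zeta_pow (- n) ** k"
proof -
  let ?g = "zeta_pow n ** h"
  have g: "?g \<in> Hgrp E" using h by (intro Hgrp_mult) auto
  have row: "?g$3$1 = uE powi (- n) * h$3$1" "?g$3$3 = uE powi (- n) * h$3$3"
    by (simp_all add: mult_nth3 zeta_pow_def)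
  have v: "vabs (uE powi (- n) * x) = real q powi (2 * n) * vabs x" for x
    using vabs_uE_powi[of "- n"] by (simp add: vabs_mult)
  have "orbit_rows N 0 (?g$3$1) (?g$3$3)"
    using h(2) unfolding orbit_rows_def rowsD_def rowsC_def row idealE_uE_powi_mult v
    by (auto simp: algebra_simps simp flip: power_int_add)
  then obtain k y where k: "k \<in> Hgrp E \<inter> Kgrp E N" "?g = umat E 0 y ** k"
    using Hgrp_Kgrp_rows(2)[OF N g] by blast
  have "h = zeta_pow (- n) ** ?g" by (simp add: matrix_mul_assoc zeta_pow_inverse)
  also have "\<dots> = zeta_pow (- n) ** umat E 0 y ** k" by (simp add: k(2) matrix_mul_assoc)
  also have "\<dots> = umat E 0 (uF powi (2 * - n) * y) ** zeta_pow (- n) ** k"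
    by (subst zeta_pow_umat) simp
  finally show thesis using that k(1) by blast
qed

section \<open>The volumes of the orbits\<close>

lemma volume_translate:
  assumes mH: "haar_quotient E N mH" and t: "t \<in> Hgrp E" and P: "open {h :: 'e^3^3. P (h$3$1) (h$3$3)}"
    and PQ: "\<And>h. h \<in> Hgrp E \<Longrightarrow> P (h$3$1) (h$3$3) \<longleftrightarrow> Q ((h ** t)$3$1) ((h ** t)$3$3)"
  shows "emeasure mH (rowcosets Q) = emeasure mH (rowcosets P)"
proof -
  have "\<And>A. A \<in> sets mH \<Longrightarrow> emeasure mH ((\<lambda>X. (\<lambda>g. g ** t) ` X) ` A) = emeasure mH A"
    using mH t unfolding haar_quotient_def by blast
  from this[OF rowcosets_sets[OF mH P]]
  have "emeasure mH ((\<lambda>X. (\<lambda>g. g ** t) ` X) ` rowcosets P) = emeasure mH (rowcosets P)" .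
  moreover have "(\<lambda>X. (\<lambda>g. g ** t) ` X) ` rowcosets P = rowcosets Q"
    by (rule rowcosets_translate[where P = P and Q = Q]) (use t PQ in auto)
  ultimately show "emeasure mH (rowcosets Q) = emeasure mH (rowcosets P)" by simp
qed

end

context unram_ext
begin

text \<open>The volumes are determined by invariance alone: translation by \<open>\<zeta>\<close> shifts both indices of
  \<open>rowsD\<close>, lower unipotent translates of a set with a stronger condition on \<open>C\<close> tile one with
  a weaker condition, and the Weyl element exchanges \<open>rowsC\<close> and \<open>rowsD\<close>.\<close>

lemma volume_zeta:
  assumes mH: "haar_quotient E N mH"
  shows "emeasure mH (rowcosets (rowsD N (m + 1) (n - 1))) = emeasure mH (rowcosets (rowsD N m n))"
proof (rule volume_translate[OF mH zeta_pow_Hgrp[of 1] open_rows(1)])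
  fix h :: "'e^3^3"
  have r: "(h ** zeta_pow 1)$3$1 = uE powi 1 * h$3$1" "(h ** zeta_pow 1)$3$3 = uE powi (- 1) * h$3$3"
    by (simp_all add: mult_nth3 zeta_pow_def mult.commute)
  have "real q powi (- 2 * (n - 1)) = real q powi (2 + - 2 * n)" by (simp add: algebra_simps)
  also have "\<dots> = real q powi 2 * real q powi (- 2 * n)" by (rule power_int_add) simp
  finally have "real q powi (- 2 * (n - 1)) = real q powi 2 * real q powi (- 2 * n)" .
  moreover have "vabs (uE powi (- 1) * h$3$3) = real q powi 2 * vabs (h$3$3)"
    using vabs_uE_powi[of "- 1"] by (simp add: vabs_mult)
  ultimately show "rowsD N m n (h$3$1) (h$3$3) \<longleftrightarrow> rowsD N (m + 1) (n - 1) ((h ** zeta_pow 1)$3$1) ((h ** zeta_pow 1)$3$3)"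
    unfolding rowsD_def r idealE_uE_powi_mult by (auto simp: algebra_simps)
qed

lemma volume_weyl:
  assumes mH: "haar_quotient E N mH"
  shows "emeasure mH (rowcosets (rowsC N n)) = emeasure mH (rowcosets (rowsD N (n + 1) n))"
proof (rule volume_translate[OF mH weyl_Hgrp[of "int N"] open_rows(1)])
  fix h :: "'e^3^3"
  have r: "(h ** weyl (int N))$3$1 = uE powi (int N) * h$3$3"
    "(h ** weyl (int N))$3$3 = uE powi (- int N) * h$3$1"
    by (simp_all add: mult_nth3 weyl_def mult.commute)
  have "real q powi (- 2 * (int N + n)) = real q powi (- 2 * int N) * real q powi (- 2 * n)"
    by (simp add: algebra_simps flip: power_int_add)
  moreover have "vabs (uE powi (int N) * h$3$3) = real q powi (- 2 * int N) * vabs (h$3$3)"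
    by (simp only: vabs_mult vabs_uE_powi)
  ultimately have "vabs (uE powi (int N) * h$3$3) = real q powi (- 2 * (int N + n)) \<longleftrightarrow>
      vabs (h$3$3) = real q powi (- 2 * n)"
    by (simp only: mult_cancel_left powi_q_pos simp_thms)
  then show "rowsD N (n + 1) n (h$3$1) (h$3$3) \<longleftrightarrow> rowsC N n ((h ** weyl (int N))$3$1) ((h ** weyl (int N))$3$3)"
    unfolding rowsD_def rowsC_def r idealE_uE_powi_mult by (auto simp: algebra_simps)
qed

lemma volume_lower:
  assumes mH: "haar_quotient E N mH"
  shows "emeasure mH (rowcosets (rowsD N m n)) = of_nat q * emeasure mH (rowcosets (rowsD N (m + 1) n))"
proof -
  let ?a = "int N + m - n"
  obtain R where R: "transversal (+) (idealF E ?a) (idealF E (?a + 1)) R" "finite R" "card R = q"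
    using transversal_idealF_1 by blast
  note RD = transversalD[OF R(1)]
  define Q where "Q y C D \<longleftrightarrow> rowsD N (m + 1) n (C - D * (j y * se)) D" for y C D
  let ?l = "\<lambda>y. weyl 0 ** umat E 0 y ** weyl 0"
  have l: "?l y \<in> Hgrp E" for y by (intro Hgrp_mult) auto
  have row: "(h ** ?l y)$3$1 = h$3$1 + h$3$3 * (j y * se)" "(h ** ?l y)$3$3 = h$3$3"
    if "h \<in> Hgrp E" for h y
    using that by (simp_all add: Hgrp_iff mult_nth3 weyl_def umat_mat3)
  have muQ: "emeasure mH (rowcosets (Q y)) = emeasure mH (rowcosets (rowsD N (m + 1) n))" for y
    by (rule volume_translate[OF mH l[of y] open_rows(1)]) (simp add: Q_def row)
  have openQ: "open {h :: 'e^3^3. Q y (h$3$1) (h$3$3)}" for y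
  proof -
    have "open {x. x \<in> idealE E i}" for i unfolding idealE_iff by (intro open_vabs_le) simp
    moreover have "continuous_on UNIV (\<lambda>h :: 'e^3^3. h$3$1 - h$3$3 * (j y * se))"
      by (intro continuous_on_diff_mult continuous_intros)
    ultimately have 1: "open ((\<lambda>h :: 'e^3^3. h$3$1 - h$3$3 * (j y * se)) -` {x. x \<in> idealE E (int N + (m + 1))})"
      by (intro open_vimage)
    have 2: "open ((\<lambda>h :: 'e^3^3. h$3$3) -` {x. vabs x = real q powi (- 2 * n)})"
      by (intro open_vimage open_vabs_eq continuous_intros) simp
    show ?thesis using open_Int[OF 1 2] by (simp add: Q_def rowsD_def vimage_def Collect_conj_eq)
  qed
  have setsQ: "rowcosets (Q y) \<in> sets mH" for y by (rule rowcosets_sets[OF mH openQ])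
  have small: "D * (j y * se) \<in> idealE E (int N + m + i) \<longleftrightarrow> y \<in> idealF E (?a + i)"
    if D: "vabs D = real q powi (- 2 * n)" for D y i
  proof -
    have "D * (j y * se) \<in> idealE E (int N + m + i) \<longleftrightarrow> uE powi n * j y \<in> idealE E (int N + m + i)"
      using vabs_uE_powi[of n] D by (simp add: idealE_iff vabs_mult)
    also have "\<dots> \<longleftrightarrow> y \<in> idealF E (?a + i)"
      unfolding idealE_uE_powi_mult by (simp add: algebra_simps)
    finally show ?thesis .
  qed
  have uniq: "y' = y" if "y \<in> R" "y' \<in> R" "Q y C D" "Q y' C D" for y y' C D
  proof -
    have D: "vabs D = real q powi (- 2 * n)" using that by (simp add: Q_def rowsD_def)
    have "C - D * (j y * se) \<in> idealE E (int N + m + 1)" "C - D * (j y' * se) \<in> idealE E (int N + m + 1)"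
      using that by (simp_all add: Q_def rowsD_def add.assoc)
    from idealE_diff[OF this]
    have "(C - D * (j y * se)) - (C - D * (j y' * se)) \<in> idealE E (int N + m + 1)" .
    then have "D * (j (y' - y) * se) \<in> idealE E (int N + m + 1)"
      by (simp add: emb_diff algebra_simps)
    then have "y' - y \<in> idealF E (?a + 1)" by (simp only: small[OF D])
    then show ?thesis using RD(3)[OF that(1,2), of "y' - y"] by simp
  qed
  have "rowcosets (rowsD N m n) = (\<Union>y\<in>R. rowcosets (Q y))"
  proof -
    have "rowsD N m n (h$3$1) (h$3$3) \<longleftrightarrow> (\<exists>y\<in>R. Q y (h$3$1) (h$3$3))" if h: "h \<in> Hgrp E" for h
    proof
      let ?C = "h$3$1" and ?D = "h$3$3"
      assume r: "rowsD N m n ?C ?D"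
      then have C: "?C \<in> idealE E (int N + m)" and D: "vabs ?D = real q powi (- 2 * n)" by (auto simp: rowsD_def)
      have D0: "?D \<noteq> 0" using D by (metis powi_q_pos(2) vabs_zero)
      have "cj (?C / ?D) = - (?C / ?D)"
        using Hgrp_rel(5)[OF h] D0 by (simp add: cj_divide field_simps eq_neg_iff_add_eq_0)
      from cj_antifixed[OF this] obtain z where "?C / ?D = j z * se" by blast
      then have Cz: "?C = ?D * (j z * se)" using D0 by (simp add: field_simps)
      then have z: "z \<in> idealF E ?a" using C small[OF D, of z 0] by simp
      obtain y b where yb: "y \<in> R" "b \<in> idealF E (?a + 1)" "z = y + b" using RD(2)[OF z] by blast
      have "?C - ?D * (j y * se) = ?D * (j b * se)"
        by (subst Cz) (simp add: yb(3) emb_add algebra_simps)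
      then have "?C - ?D * (j y * se) \<in> idealE E (int N + m + 1)"
        using yb(2) by (simp only: small[OF D])
      then have "Q y ?C ?D" using D by (simp add: Q_def rowsD_def add.assoc)
      then show "\<exists>y\<in>R. Q y ?C ?D" using yb(1) by blast
    next
      let ?C = "h$3$1" and ?D = "h$3$3"
      assume "\<exists>y\<in>R. Q y ?C ?D"
      then obtain y where y: "y \<in> R" "?C - ?D * (j y * se) \<in> idealE E (int N + m + 1)"
        and D: "vabs ?D = real q powi (- 2 * n)" by (auto simp: Q_def rowsD_def add.assoc)
      have "y \<in> idealF E (?a + 0)" using y(1) RD(1) by auto
      then have "?D * (j y * se) \<in> idealE E (int N + m + 0)" by (simp only: small[OF D])
      moreover have "?C - ?D * (j y * se) \<in> idealE E (int N + m + 0)"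
        using y(2) by (rule idealE_mono) simp
      ultimately have "?C - ?D * (j y * se) + ?D * (j y * se) \<in> idealE E (int N + m + 0)"
        by (intro idealE_add)
      then show "rowsD N m n ?C ?D" using D by (simp add: rowsD_def)
    qed
    then have "rowset (rowsD N m n) = (\<Union>y\<in>R. rowset (Q y))" by (auto simp: rowset_def)
    then show ?thesis by (simp only: rowcosets_def image_UN)
  qed
  also have "emeasure mH (\<Union>y\<in>R. rowcosets (Q y)) = (\<Sum>y\<in>R. emeasure mH (rowcosets (Q y)))"
  proof (rule sum_emeasure[symmetric])
    show "disjoint_family_on (\<lambda>y. rowcosets (Q y)) R"
      unfolding disjoint_family_on_def
    proof (intro ballI impI)
      fix y y' assume "y \<in> R" "y' \<in> R" "y \<noteq> y'"
      then show "rowcosets (Q y) \<inter> rowcosets (Q y') = {}"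
        using uniq by (intro rowcosets_disj) blast
    qed
  qed (use R setsQ in auto)
  also have "\<dots> = of_nat q * emeasure mH (rowcosets (rowsD N (m + 1) n))"
    by (simp add: muQ R(3))
  finally show ?thesis .
qed

text \<open>With \<open>x\<^sub>n\<close> the volume of \<open>rowsD N (n + 1) n\<close>, the orbit at \<open>n\<close> has volume \<open>(q + 1) x\<^sub>n\<close>, and
  \<open>x\<^sub>n\<close> is \<open>q\<^sup>2 x\<^sub>n\<^sub>+\<^sub>1\<close>. The normalization of the measure fixes the orbit at \<open>0\<close>.\<close>

lemma volume_rows:
  assumes mH: "haar_quotient E N mH" and N: "1 \<le> N"
  shows "emeasure mH (rowcosets (orbit_rows N (- int i))) = ennreal (real q ^ (2 * i))"
proof -
  let ?mu = "\<lambda>P. emeasure mH (rowcosets P)"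
  have O: "?mu (orbit_rows N n) = (of_nat q + 1) * ?mu (rowsD N (n + 1) n)" for n
  proof -
    have "rowsD N n n C D \<Longrightarrow> rowsC N n C D \<Longrightarrow> False" for C D
      using powi_q_le_iff[of "- 2 * n" "- 2 * (n + 1)"]
      by (simp add: rowsD_def rowsC_def idealE_iff)
    then have "rowcosets (rowsD N n n) \<inter> rowcosets (rowsC N n) = {}" by (rule rowcosets_disj)
    moreover have "rowcosets (orbit_rows N n) = rowcosets (rowsD N n n) \<union> rowcosets (rowsC N n)"
      unfolding rowcosets_Un[symmetric] by (rule arg_cong[of _ _ rowcosets]) (auto simp: orbit_rows_def fun_eq_iff)
    ultimately have "?mu (orbit_rows N n) = ?mu (rowsD N n n) + ?mu (rowsC N n)"
      using rowcosets_sets[OF mH open_rows(1)] rowcosets_sets[OF mH open_rows(2)]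
      by (simp add: plus_emeasure)
    then show ?thesis using volume_lower[OF mH, of n n] volume_weyl[OF mH, of n] by (simp add: algebra_simps)
  qed
  have x: "?mu (rowsD N (n + 1) n) = of_nat q * (of_nat q * ?mu (rowsD N (n + 1 + 1) (n + 1)))" for n
    using volume_zeta[OF mH, of n "n + 1"] volume_lower[OF mH, of n "n + 1"] volume_lower[OF mH, of "n + 1" "n + 1"] by simp
  have step: "?mu (orbit_rows N n) = of_nat q * of_nat q * ?mu (orbit_rows N (n + 1))" for n
    unfolding O x[of n] by (simp only: mult_ac)
  have base: "?mu (orbit_rows N 0) = 1"
    using mH unfolding rowcosets_0[OF N] by (simp add: haar_quotient_def)
  show ?thesis
  proof (induction i)
    case 0
    then show ?case using base by simp
  next
    case (Suc i)
    have "?mu (orbit_rows N (- int (Suc i))) = of_nat q * of_nat q * ?mu (orbit_rows N (- int i))"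
      using step[of "- int (Suc i)"] by simp
    also have "\<dots> = ennreal (real q * real q * real q ^ (2 * i))"
      unfolding Suc by (simp add: ennreal_mult ennreal_of_nat_eq_real_of_nat)
    finally show ?case by (simp add: power_add algebra_simps)
  qed
qed

section \<open>The section \<open>f(s, h, \<Phi>)\<close>\<close>

text \<open>The decompositions of \<open>h\<close> from which \<open>f_section\<close> selects one.\<close>

definition decomp :: "'e^3^3 \<Rightarrow> 'e \<Rightarrow> 'f^2^2 \<Rightarrow> bool" where
  "decomp h b g \<longleftrightarrow> b \<noteq> 0 \<and> det g = 1 \<and>
     h = embH (tmat E b ** dmat se ** (\<chi> i k. j (g $ i $ k)) ** dmat (inverse se))"

lemma decomp_iff:
  "decomp h b g \<longleftrightarrow> b \<noteq> 0 \<and> g$1$1 * g$2$2 - g$1$2 * g$2$1 = 1 \<and>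
     h = mat3 (b * j (g$1$1)) 0 (b * j (g$1$2) * se) 0 1 0
       (inverse (cj b) * j (g$2$1) * inverse se) 0 (inverse (cj b) * j (g$2$2))"
proof -
  have "embH (tmat E b ** dmat se ** (\<chi> i k. j (g $ i $ k)) ** dmat (inverse se)) =
     mat3 (b * j (g$1$1)) 0 (b * j (g$1$2) * se) 0 1 0
       (inverse (cj b) * j (g$2$1) * inverse se) 0 (inverse (cj b) * j (g$2$2))"
    by (simp add: embH_def mat3_cong_iff tmat_def dmat_def matrix_matrix_mult_def sum_2)
  then show ?thesis by (simp add: decomp_def det_2)
qed

text \<open>The two entries \<open>C\<close>, \<open>D\<close> of the bottom row satisfy \<open>C / D \<in> \<surd>\<epsilon> F\<close>. Dividing by \<open>D\<close>, or by
  \<open>C \<surd>\<epsilon>\<close> if \<open>D = 0\<close>, makes the row rational after conjugation by \<open>d(\<surd>\<epsilon>)\<close>, and unitarity does the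
  same for the upper row.\<close>

lemma decomp_exists:
  assumes h: "h \<in> Hgrp E" obtains b g where "decomp h b g"
proof -
  define A B C D where ABCD: "A = h$1$1" "B = h$1$3" "C = h$3$1" "D = h$3$3"
  have h_eq: "h = mat3 A 0 B 0 1 0 C 0 D"
    using h by (simp add: mat3_cong_iff Hgrp_iff ABCD)
  note rel = Hgrp_rel[OF h, folded ABCD]
  have eps: "j (eps E) = se * se" using se_square by (simp add: power2_eq_square)
  show thesis
  proof (cases "D = 0")
    case False
    have "cj (C / D) = - (C / D)"
      using rel(5) False by (simp add: cj_divide field_simps eq_neg_iff_add_eq_0)
    from cj_antifixed[OF this] obtain y where "C / D = j y * se" by blast
    then have C: "C = D * (j y * se)" using False by (simp add: field_simps)
    have "cj (B * cj D) = - (B * cj D)"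
      using rel(2) by (simp add: cj_mult eq_neg_iff_add_eq_0 algebra_simps)
    from cj_antifixed[OF this] obtain x where x: "B * cj D = j x * se" by blast
    have "cj B * D = cj (B * cj D)" by (simp add: cj_mult)
    also have "\<dots> = cj (j x * se)" by (simp only: x)
    finally have x': "cj B * D = - (j x * se)" by (simp add: cj_mult)
    have CB: "cj B * C = (cj B * D) * (j y * se)" by (simp add: C mult.assoc)
    have "A * cj D = 1 - cj B * C" using rel(1) by (simp add: eq_diff_eq mult.commute)
    also have "\<dots> = 1 - (- (j x * se)) * (j y * se)" by (simp only: CB x')
    finally have "A * cj D = 1 + j x * (j y * (se * se))" by (simp add: mult_ac)
    then have A: "A = inverse (cj D) * (1 + j x * (j y * (se * se)))"
      using False by (simp add: field_simps)
    have B: "B = inverse (cj D) * j x * se" using x False by (simp add: field_simps)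
    have "decomp h (inverse (cj D)) (vector [vector [1 + x * (y * eps E), x], vector [y * eps E, 1]])"
      unfolding decomp_iff h_eq mat3_eq_iff
      using False by (simp add: A B C emb_add emb_mult eps cj_inverse)
    then show thesis by (rule that)
  next
    case True
    have BC1: "cj B * C = 1" using rel(1) True by simp
    have "B * cj C = cj (cj B * C)" by (simp add: cj_mult)
    then have BC: "B * cj C = 1" by (simp only: BC1 cj_1)
    have C0: "C \<noteq> 0" using BC1 by auto
    have "cj (A * cj C) = - (A * cj C)"
      using rel(3) by (simp add: cj_mult eq_neg_iff_add_eq_0 algebra_simps)
    from cj_antifixed[OF this] obtain x where x: "A * cj C = j x * se" by blast
    have A: "A = inverse (cj C) * (j x * se)" using x C0 by (simp add: field_simps)
    have B: "B = inverse (cj C)" using BC by (metis inverse_unique mult.commute)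
    have "decomp h (inverse (cj (C * se))) (vector [vector [- (x * eps E), - 1], vector [1, 0]])"
      unfolding decomp_iff h_eq mat3_eq_iff
      using C0 True by (simp add: A B emb_minus emb_mult eps cj_inverse cj_mult cj_minus)
    then show thesis by (rule that)
  qed
qed

text \<open>A change of the decomposition moves the radius of the ball in \<open>z_int_ball\<close> by the
  valuation \<open>\<beta>\<close> of \<open>b\<close>, and the factor \<open>|b|\<^sup>s\<close> compensates it; so the unspecified choice in
  \<open>f_section\<close> is harmless.\<close>

lemma f_section_rows:
  assumes mF: "haar_units mF" and s: "Re s > 0"
    and h: "h \<in> Hgrp E" and r: "orbit_rows N n (h$3$1) (h$3$3)"
  shows "f_section E mF s h (Phi E (int N)) = Xs s powi (- n) / (1 - Xs s)"
proof -
  define p where "p = (SOME (b, g). decomp h b g)"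
  obtain b0 g0 where "decomp h b0 g0" using decomp_exists[OF h] .
  then have "\<exists>p. case p of (b, g) \<Rightarrow> decomp h b g" by (intro exI[of _ "(b0, g0)"]) simp
  then have "case p of (b, g) \<Rightarrow> decomp h b g" unfolding p_def by (rule someI_ex)
  then obtain b g where bg: "p = (b, g)" "decomp h b g" by (cases p) auto
  have f: "f_section E mF s h (Phi E (int N)) = complex_of_real (vabs b) powr s * z_int E mF s g (Phi E (int N))"
    using bg(1) unfolding f_section_def p_def decomp_def by (simp add: Let_def)
  have b0: "b \<noteq> 0" and h31: "h$3$1 = inverse (cj b) * j (g$2$1) * inverse se"
    and h33: "h$3$3 = inverse (cj b) * j (g$2$2)"
    using bg(2) by (auto simp: decomp_iff)
  obtain \<beta> where \<beta>: "vabs b = real q powi (- 2 * \<beta>)" using value_E[OF b0] .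
  have ball: "(g$2$1 * t \<in> idealF E (int N) \<and> g$2$2 * t \<in> ring_of_integers) \<longleftrightarrow> vabs t \<le> real q powi (n + \<beta>)"
    if t0: "t \<noteq> 0" for t
  proof -
    obtain k where k: "vabs t = real q powi k" using value_F[OF t0] .
    have "j (g$2$1 * t) = h$3$1 * (cj b * se * j t)" "j (g$2$2 * t) = h$3$3 * (cj b * j t)"
      using b0 by (simp_all add: h31 h33 emb_mult field_simps)
    moreover have "vabs (cj b * se * j t) = vabs (uE powi (\<beta> - k))" "vabs (cj b * j t) = vabs (uE powi (\<beta> - k))"
      using \<beta> k vabs_uE_powi[of "\<beta> - k"] by (simp_all add: vabs_mult powi_q_square flip: power_int_add)
    ultimately have "vabs (j (g$2$1 * t)) = vabs (uE powi (\<beta> - k) * h$3$1)"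
      "vabs (j (g$2$2 * t)) = vabs (uE powi (\<beta> - k) * h$3$3)"
      by (simp_all add: vabs_mult)
    then have 1: "g$2$1 * t \<in> idealF E (int N) \<longleftrightarrow> h$3$1 \<in> idealE E (int N - (\<beta> - k))"
      and 2: "g$2$2 * t \<in> ring_of_integers \<longleftrightarrow> h$3$3 \<in> idealE E (- (\<beta> - k))"
      using idealE_uE_powi_mult[of "\<beta> - k" "h$3$1" "int N"] idealE_uE_powi_mult[of "\<beta> - k" "h$3$3" 0]
        emb_in_idealE[of "g$2$1 * t" "int N"] emb_in_idealE[of "g$2$2 * t" 0]
      by (simp_all add: idealE_iff integers_eq_idealF)
    have E: "x \<in> idealE E i \<longleftrightarrow> i \<le> l" if "vabs x = real q powi (- 2 * l)" for x i l
      unfolding idealE_iff that by (subst powi_q_le_iff) auto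
    have "h$3$1 \<in> idealE E (int N - (\<beta> - k)) \<and> h$3$3 \<in> idealE E (- (\<beta> - k)) \<longleftrightarrow> k \<le> n + \<beta>"
      using r unfolding orbit_rows_def
    proof
      assume "rowsD N n n (h$3$1) (h$3$3)"
      then have C: "h$3$1 \<in> idealE E (int N + n)" and D: "vabs (h$3$3) = real q powi (- 2 * n)"
        by (auto simp: rowsD_def)
      have "k \<le> n + \<beta> \<Longrightarrow> h$3$1 \<in> idealE E (int N - (\<beta> - k))" using C by (rule idealE_mono) simp
      then show ?thesis unfolding E[OF D] by auto
    next
      assume "rowsC N n (h$3$1) (h$3$3)"
      then have C: "vabs (h$3$1) = real q powi (- 2 * (int N + n))" and D: "h$3$3 \<in> idealE E (n + 1)"
        by (auto simp: rowsC_def)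
      have "k \<le> n + \<beta> \<Longrightarrow> h$3$3 \<in> idealE E (- (\<beta> - k))" using D by (rule idealE_mono) simp
      then show ?thesis unfolding E[OF C] by auto
    qed
    then show ?thesis unfolding 1 2 k powi_q_le_iff .
  qed
  have "z_int E mF s g (Phi E (int N)) = Xs s powi (- (n + \<beta>)) / (1 - Xs s)"
    by (rule z_int_ball[OF mF s ball])
  moreover have "Xs s powi \<beta> * Xs s powi (- (n + \<beta>)) = Xs s powi (\<beta> + - (n + \<beta>))"
    by (rule power_int_add[symmetric]) simp
  ultimately show ?thesis unfolding f \<beta> powi_q_powr2 by simp
qed

end

section \<open>The zeta integral\<close>

locale newform_zeta = newform E q sc \<pi> \<psi> l v N \<nu> lam
  for E :: "('f::nonarch_local_field, 'e::nonarch_local_field) quad_ext" and q :: nat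
    and sc :: "complex \<Rightarrow> 'v::ab_group_add \<Rightarrow> 'v" and \<pi> \<psi> l v N \<nu> lam +
  fixes mF :: "'f measure" and mH :: "('e^3^3) set measure"
  assumes mF: "haar_units mF" and mH: "haar_quotient E N mH"
begin

lemma N_ge_1: "1 \<le> N" using N_pos by simp

lemma whittaker_rows:
  assumes h: "h \<in> Hgrp E" "orbit_rows N n (h$3$1) (h$3$3)"
  shows "whittaker \<pi> l v h = torus_val (- n)"
proof -
  obtain y k where k: "k \<in> Hgrp E \<inter> Kgrp E N" "h = umat E 0 y ** zeta_pow (- n) ** k"
    using Iwasawa[OF N_ge_1 h] .
  then have "\<pi> h v = \<pi> (umat E 0 y) (\<pi> (zeta_pow (- n)) (\<pi> k v))"
    by (simp add: pi_mult unitary_mult Hgrp_unitary)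
  also have "\<pi> k v = v" using k by (simp add: v_Kgrp)
  finally show ?thesis using psi_integer[of 0] by (simp add: whittaker_def l_umat torus_val_def torus_l_def)
qed

lemma zeta_integrand_rows:
  assumes s: "Re s > 0" and h: "h \<in> Hgrp E" "orbit_rows N n (h$3$1) (h$3$3)"
  shows "zeta_integrand E mF s (whittaker \<pi> l v) (Phi E (int N)) (cosetUH E h) =
    torus_val (- n) * (Xs s powi (- n) / (1 - Xs s))"
proof -
  let ?g = "SOME g. g \<in> cosetUH E h"
  have g: "?g \<in> cosetUH E h" by (rule someI) (rule cosetUH_self)
  then have gH: "?g \<in> Hgrp E" using h(1) by (rule cosetUH_Hgrp)
  have row: "orbit_rows N n (?g$3$1) (?g$3$3)" using h(2) cosetUH_row[OF g] by simp
  show ?thesis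
    unfolding zeta_integrand_def Let_def
    by (simp only: whittaker_rows[OF gH row] f_section_rows[OF mF s gH row])
qed

text \<open>The value on the orbit of \<open>\<zeta>\<^sup>i\<close> times the volume of the orbit.\<close>

definition orbit_coeff :: "nat \<Rightarrow> complex" where "orbit_coeff i = torus_val (int i) * of_nat q ^ (2 * i)"
definition denom_coeff1 :: complex where "denom_coeff1 = (\<nu> + of_nat q ^ 2 - of_nat q ^ 3) * of_nat q powi (- 2)"
definition denom_coeff2 :: complex where "denom_coeff2 = (\<nu> + of_nat q ^ 2 - lam) * of_nat q powi (- 1)"

lemma orbit_coeff_recursion: "orbit_coeff 0 = 1" "orbit_coeff 1 = denom_coeff1 - 1" "orbit_coeff (Suc (Suc i)) = denom_coeff1 * orbit_coeff (Suc i) + denom_coeff2 * orbit_coeff i"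
proof -
  let ?Q = "of_nat q :: complex"
  have Q: "?Q \<noteq> 0" by simp
  show "orbit_coeff 0 = 1" by (simp add: orbit_coeff_def torus_val_0)
  have denom_coeff1: "denom_coeff1 * ?Q ^ 2 = \<nu> + ?Q ^ 2 - ?Q ^ 3" and denom_coeff2: "denom_coeff2 * ?Q = \<nu> + ?Q ^ 2 - lam"
    by (simp_all add: denom_coeff1_def denom_coeff2_def power_int_minus)
  show "orbit_coeff 1 = denom_coeff1 - 1"
  proof -
    have "?Q * (?Q ^ 2 * orbit_coeff 1) = \<nu> * ?Q - ?Q ^ 4"
      using torus_val_recursion(1) by (simp add: orbit_coeff_def algebra_simps power2_eq_square power4_eq_xxxx)
    also have "\<dots> = ?Q * (\<nu> + ?Q ^ 2 - ?Q ^ 3 - ?Q ^ 2)"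
      by (simp add: algebra_simps power3_eq_cube power4_eq_xxxx)
    also have "\<dots> = ?Q * (?Q ^ 2 * (denom_coeff1 - 1))"
      unfolding denom_coeff1[symmetric] by (simp add: algebra_simps)
    finally show ?thesis using Q by (simp only: mult_cancel_left power_eq_0_iff simp_thms)
  qed
  have rec: "(\<nu> + ?Q ^ 2) * (torus_val (int i) + ?Q * torus_val (int i + 1)) =
     ?Q ^ 4 * (torus_val (int i + 1) + ?Q * torus_val (int i + 2)) + lam * torus_val (int i)"
    using torus_val_recursion(2)[of "int i + 1"] by (simp add: add.assoc)
  have "?Q * (?Q ^ 4 * torus_val (int i + 2)) = (\<nu> + ?Q ^ 2 - ?Q ^ 3) * ?Q * torus_val (int i + 1) + (\<nu> + ?Q ^ 2 - lam) * torus_val (int i)"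
    using rec by (simp add: algebra_simps power2_eq_square power3_eq_cube power4_eq_xxxx)
  also have "\<dots> = ?Q * (denom_coeff1 * (?Q ^ 2 * torus_val (int i + 1)) + denom_coeff2 * torus_val (int i))"
    unfolding denom_coeff1[symmetric] denom_coeff2[symmetric] by (simp add: algebra_simps)
  finally have "?Q ^ 4 * torus_val (int i + 2) = denom_coeff1 * (?Q ^ 2 * torus_val (int i + 1)) + denom_coeff2 * torus_val (int i)"
    using Q by simp
  then have "?Q ^ (2 * i) * (?Q ^ 4 * torus_val (int i + 2)) = ?Q ^ (2 * i) * (denom_coeff1 * (?Q ^ 2 * torus_val (int i + 1)) + denom_coeff2 * torus_val (int i))"
    by simp
  moreover have "int (Suc (Suc i)) = int i + 2" "int (Suc i) = int i + 1"
    "2 * Suc (Suc i) = 2 * i + 4" "2 * Suc i = 2 * i + 2" by simp_all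
  ultimately show "orbit_coeff (Suc (Suc i)) = denom_coeff1 * orbit_coeff (Suc i) + denom_coeff2 * orbit_coeff i"
    unfolding orbit_coeff_def by (simp only: power_add) (simp add: algebra_simps)
qed

text \<open>A solution of the recursion grows at most like the powers of this number, which gives an explicit
  half plane of convergence.\<close>

definition growth_rate :: real where "growth_rate = 1 + cmod denom_coeff1 + cmod denom_coeff2"

lemma norm_orbit_coeff: "cmod (orbit_coeff i) \<le> growth_rate ^ i"
proof (induction i rule: induct_nat_012)
  case 0
  then show ?case by (simp add: orbit_coeff_recursion)
next
  case 1
  have "cmod (denom_coeff1 - 1) \<le> growth_rate"
    unfolding growth_rate_def
    using norm_triangle_ineq4[of denom_coeff1 1] norm_ge_zero[of denom_coeff2] norm_one[where 'a = complex] by linarith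
  then show ?case by (simp add: orbit_coeff_recursion(2)[unfolded One_nat_def])
next
  case (ge2 i)
  have K1: "1 \<le> growth_rate" by (simp add: growth_rate_def)
  have "cmod (orbit_coeff (Suc (Suc i))) \<le> cmod denom_coeff1 * cmod (orbit_coeff (Suc i)) + cmod denom_coeff2 * cmod (orbit_coeff i)"
    unfolding orbit_coeff_recursion(3) by (metis norm_mult norm_triangle_ineq)
  also have "\<dots> \<le> cmod denom_coeff1 * growth_rate ^ Suc i + cmod denom_coeff2 * growth_rate ^ Suc i"
  proof (intro add_mono mult_left_mono)
    show "cmod (orbit_coeff i) \<le> growth_rate ^ Suc i"
      using ge2(1) power_increasing[of i "Suc i" growth_rate] K1 by linarith
  qed (use ge2 in auto)
  also have "\<dots> = (growth_rate - 1) * growth_rate ^ Suc i" by (simp add: growth_rate_def algebra_simps)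
  also have "\<dots> \<le> growth_rate * growth_rate ^ Suc i" using K1 by (intro mult_right_mono) auto
  finally show ?case by simp
qed

lemma orbit_coeff_sums:
  assumes X: "cmod X * growth_rate < 1"
  shows "summable (\<lambda>i. cmod (orbit_coeff i * X ^ i))"
    and "(\<Sum>i. orbit_coeff i * X ^ i) * (1 - denom_coeff1 * X - denom_coeff2 * X ^ 2) = 1 - X"
proof -
  have K1: "1 \<le> growth_rate" by (simp add: growth_rate_def)
  have geo: "summable (\<lambda>i. (cmod X * growth_rate) ^ i)" using X K1 by (intro summable_geometric) simp
  have le: "norm (cmod (orbit_coeff i * X ^ i)) \<le> (cmod X * growth_rate) ^ i" for i
    using mult_right_mono[OF norm_orbit_coeff[of i], of "cmod X ^ i"]
    by (simp add: norm_mult norm_power power_mult_distrib mult.commute)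
  show sn: "summable (\<lambda>i. cmod (orbit_coeff i * X ^ i))"
    by (rule summable_comparison_test'[where N = 0, OF geo]) (rule le)
  let ?f = "\<lambda>i. orbit_coeff i * X ^ i"
  have s: "summable ?f" using sn by (rule summable_norm_cancel)
  define S where "S = suminf ?f"
  have S1: "(\<lambda>i. ?f (Suc i)) sums (S - 1)"
    using sums_Suc_iff[of ?f "S - 1"] summable_sums[OF s] by (simp add: S_def orbit_coeff_recursion)
  then have "(\<lambda>i. ?f (Suc (Suc i))) sums (S - 1 - (denom_coeff1 - 1) * X)"
    using sums_Suc_iff[of "\<lambda>i. ?f (Suc i)" "S - 1 - (denom_coeff1 - 1) * X"] orbit_coeff_recursion(2) by simp
  moreover have "(\<lambda>i. denom_coeff1 * X * ?f (Suc i) + denom_coeff2 * X ^ 2 * ?f i) sums (denom_coeff1 * X * (S - 1) + denom_coeff2 * X ^ 2 * S)"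
    unfolding S_def using S1[unfolded S_def] summable_sums[OF s] by (intro sums_add sums_mult)
  moreover have "?f (Suc (Suc i)) = denom_coeff1 * X * ?f (Suc i) + denom_coeff2 * X ^ 2 * ?f i" for i
    by (simp add: orbit_coeff_recursion(3) algebra_simps power2_eq_square)
  ultimately have "S - 1 - (denom_coeff1 - 1) * X = denom_coeff1 * X * (S - 1) + denom_coeff2 * X ^ 2 * S"
    using sums_unique2 by (metis (no_types, lifting) sums_cong)
  then show "suminf ?f * (1 - denom_coeff1 * X - denom_coeff2 * X ^ 2) = 1 - X"
    unfolding S_def[symmetric] by (simp add: algebra_simps)
qed

lemma zeta_value:
  assumes s: "Re s > 0" and X: "cmod (Xs s) * growth_rate < 1"
  shows "zeta_converges E mF mH s (whittaker \<pi> l v) (Phi E (int N))"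
    and "1 - denom_coeff1 * Xs s - denom_coeff2 * Xs s ^ 2 \<noteq> 0"
    and "zeta_integral E mF mH s (whittaker \<pi> l v) (Phi E (int N)) = 1 / (1 - denom_coeff1 * Xs s - denom_coeff2 * Xs s ^ 2)"
proof -
  let ?X = "Xs s"
  let ?f = "zeta_integrand E mF s (whittaker \<pi> l v) (Phi E (int N))"
  let ?c = "\<lambda>i::nat. torus_val (int i) * (?X ^ i / (1 - ?X))"
  let ?A = "\<lambda>i::nat. rowcosets (orbit_rows N (- int i))"
  have lt: "cmod ?X < 1" unfolding norm_Xs using s q_gt_1 powr_less_mono[of "- 2 * Re s" 0 "real q"] by simp
  then have X1: "1 - ?X \<noteq> 0" by auto
  have trm: "?c i * of_real (real q ^ (2 * i)) = orbit_coeff i * ?X ^ i * inverse (1 - ?X)" for i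
    by (simp add: orbit_coeff_def divide_inverse mult_ac)
  have space: "space mH = quotient_space E" using mH by (simp add: haar_quotient_def)
  have A: "?A i \<in> sets mH" "emeasure mH (?A i) = ennreal (real q ^ (2 * i))" for i
    using rowcosets_sets[OF mH open_rows(3)] volume_rows[OF mH N_ge_1] by auto
  have disj: "i = i'" if "x \<in> ?A i" "x \<in> ?A i'" for x i i'
  proof -
    have "\<not> (\<forall>C D. orbit_rows N (- int i) C D \<longrightarrow> orbit_rows N (- int i') C D \<longrightarrow> False)"
      using that rowcosets_disj[of "orbit_rows N (- int i)" "orbit_rows N (- int i')"] by blast
    then show ?thesis using rows_eqD by fastforce
  qed
  have f1: "?f x = ?c i" if x: "x \<in> ?A i" for x i
  proof -
    obtain h where "h \<in> Hgrp E" "orbit_rows N (- int i) (h$3$1) (h$3$3)" "x = cosetUH E h"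
      using x unfolding rowcosets_def rowset_def by blast
    then show ?thesis using zeta_integrand_rows[OF s, of h "- int i"] by simp
  qed
  have f2: "?f x = 0" if x: "x \<in> space mH" "\<forall>i. x \<notin> ?A i" for x
  proof -
    obtain h where h: "h \<in> Hgrp E" "x = cosetUH E h" using x(1) unfolding space quotient_space_def by blast
    obtain n where n: "orbit_rows N n (h$3$1) (h$3$3)" using rows_exist[OF h(1)] .
    have "\<not> n \<le> 0"
    proof
      assume "n \<le> 0"
      then have "n = - int (nat (- n))" by simp
      then have "x \<in> ?A (nat (- n))" using n h cosetUH_in_rowcosets[OF h(1)] by simp
      then show False using x(2) by blast
    qed
    then show ?thesis using zeta_integrand_rows[OF s h(1) n] h(2) torus_val_neg[of "- n"] by simp
  qed
  have sum: "summable (\<lambda>i. cmod (?c i) * real q ^ (2 * i))"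
  proof -
    have "cmod (?c i) * real q ^ (2 * i) = cmod (orbit_coeff i * ?X ^ i) * cmod (inverse (1 - ?X))" for i
    proof -
      have "cmod (?c i) * real q ^ (2 * i) = cmod (?c i * of_real (real q ^ (2 * i)))"
        by (simp only: norm_mult norm_of_real abs_of_nonneg zero_le_power of_nat_0_le_iff)
      also have "\<dots> = cmod (orbit_coeff i * ?X ^ i) * cmod (inverse (1 - ?X))" unfolding trm by (rule norm_mult)
      finally show ?thesis .
    qed
    then show ?thesis using orbit_coeff_sums(1)[OF X] by (simp add: summable_mult2)
  qed
  note P = integral_countable_partition[where A = ?A and f = ?f and c = ?c, OF A _ disj f1 f2 sum]
  show "zeta_converges E mF mH s (whittaker \<pi> l v) (Phi E (int N))"
    unfolding zeta_converges_def by (rule P(1)) auto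
  have "(\<lambda>i. ?c i * of_real (real q ^ (2 * i))) sums integral\<^sup>L mH ?f" by (rule P(2)) auto
  moreover have "(\<lambda>i. ?c i * of_real (real q ^ (2 * i))) sums ((\<Sum>i. orbit_coeff i * ?X ^ i) * inverse (1 - ?X))"
    unfolding trm by (intro sums_mult2 summable_sums summable_norm_cancel[OF orbit_coeff_sums(1)[OF X]])
  ultimately have Z: "zeta_integral E mF mH s (whittaker \<pi> l v) (Phi E (int N)) =
      (\<Sum>i. orbit_coeff i * ?X ^ i) * inverse (1 - ?X)"
    unfolding zeta_integral_def by (rule sums_unique2)
  note S = orbit_coeff_sums(2)[OF X]
  show nz: "1 - denom_coeff1 * ?X - denom_coeff2 * ?X ^ 2 \<noteq> 0" using S X1 by auto
  have "zeta_integral E mF mH s (whittaker \<pi> l v) (Phi E (int N)) * (1 - denom_coeff1 * ?X - denom_coeff2 * ?X ^ 2) = 1"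
    unfolding Z using S X1 by (simp add: mult.assoc mult.commute[of "inverse _"])
       (simp add: mult.assoc[symmetric])
  then show "zeta_integral E mF mH s (whittaker \<pi> l v) (Phi E (int N)) = 1 / (1 - denom_coeff1 * ?X - denom_coeff2 * ?X ^ 2)"
    using nz by (simp add: field_simps)
qed

lemma zeta_region:
  "\<exists>\<sigma> :: real. \<forall>s. Re s > \<sigma> \<longrightarrow> Re s > 0 \<and> cmod (Xs s) * growth_rate < 1"
  \<comment> \<open>Here \<open>|Xs s| = q powr (- 2 * Re s)\<close> is less than \<open>growth_rate\<^sup>-\<^sup>2\<close>, and \<open>growth_rate \<ge> 1\<close>.\<close>
proof (intro exI[of _ "log (real q) growth_rate"] allI impI)
  fix s assume s: "Re s > log (real q) growth_rate"
  have K1: "1 \<le> growth_rate" by (simp add: growth_rate_def)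
  have q1: "1 < real q" using q_gt_1 by simp
  have "0 \<le> log (real q) growth_rate" using K1 q1 by simp
  with s have s0: "Re s > 0" by linarith
  have "growth_rate = real q powr log (real q) growth_rate" using K1 q1 by simp
  also have "\<dots> < real q powr (2 * Re s)" using s s0 q1 by (intro powr_less_mono) auto
  finally have "growth_rate < real q powr (2 * Re s)" .
  then have "real q powr (- 2 * Re s) * growth_rate < real q powr (- 2 * Re s) * real q powr (2 * Re s)"
    using q1 by (intro mult_strict_left_mono) auto
  also have "\<dots> = 1" using q1 by (simp flip: powr_add)
  finally show "Re s > 0 \<and> cmod (Xs s) * growth_rate < 1" unfolding norm_Xs using s0 by blast
qed

lemma zeta_ratfun_Q:
  "zeta_ratfun E mF mH (whittaker \<pi> l v) (Phi E (int N)) 1 [:1, - denom_coeff1, - denom_coeff2:]"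
proof -
  obtain \<sigma> :: real where \<sigma>: "\<And>s. Re s > \<sigma> \<Longrightarrow> Re s > 0 \<and> cmod (Xs s) * growth_rate < 1"
    using zeta_region by blast
  have p: "poly [:1, - denom_coeff1, - denom_coeff2:] X = 1 - denom_coeff1 * X - denom_coeff2 * X ^ 2" for X
    by (simp add: algebra_simps power2_eq_square)
  show ?thesis
    unfolding zeta_ratfun_def Let_def q_eq[symmetric] p poly_1
  proof (intro exI[of _ \<sigma>] allI impI conjI)
    fix s assume "\<sigma> < Re s"
    then have r: "Re s > 0" "cmod (Xs s) * growth_rate < 1" using \<sigma> by auto
    show "zeta_converges E mF mH s (whittaker \<pi> l v) (Phi E (int N))" by (rule zeta_value(1)[OF r])
    show "1 - denom_coeff1 * Xs s - denom_coeff2 * Xs s ^ 2 \<noteq> 0" by (rule zeta_value(2)[OF r])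
    show "zeta_integral E mF mH s (whittaker \<pi> l v) (Phi E (int N)) = 1 / (1 - denom_coeff1 * Xs s - denom_coeff2 * Xs s ^ 2)"
      by (rule zeta_value(3)[OF r])
  qed
qed

text \<open>A rational function is determined by its values on the infinite set of the numbers \<open>Xs s\<close>.\<close>

lemma zeta_ratfun_unique:
  assumes r: "zeta_ratfun E mF mH W \<Phi> P Q" "zeta_ratfun E mF mH W \<Phi> P' Q'"
  shows "P * Q' = P' * Q"
proof -
  obtain \<sigma> where \<sigma>: "\<And>s. Re s > \<sigma> \<Longrightarrow> poly Q (Xs s) \<noteq> 0 \<and> zeta_integral E mF mH s W \<Phi> = poly P (Xs s) / poly Q (Xs s)"
    using r(1) unfolding zeta_ratfun_def Let_def q_eq[symmetric] by blast
  obtain \<sigma>' where \<sigma>': "\<And>s. Re s > \<sigma>' \<Longrightarrow> poly Q' (Xs s) \<noteq> 0 \<and> zeta_integral E mF mH s W \<Phi> = poly P' (Xs s) / poly Q' (Xs s)"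
    using r(2) unfolding zeta_ratfun_def Let_def q_eq[symmetric] by blast
  let ?I = "{x :: real. max \<sigma> \<sigma>' < x}"
  have zero: "poly (P * Q' - P' * Q) (Xs (of_real x)) = 0" if "x \<in> ?I" for x
    using \<sigma>[of "of_real x"] \<sigma>'[of "of_real x"] that by (simp add: field_simps)
  have inj: "inj_on (\<lambda>x :: real. Xs (of_real x)) ?I"
  proof (rule inj_onI)
    fix x y :: real assume "Xs (of_real x) = Xs (of_real y)"
    then have "cmod (Xs (of_real x)) = cmod (Xs (of_real y))" by simp
    then have "real q powr (- 2 * x) = real q powr (- 2 * y)" unfolding norm_Xs by simp
    then show "x = y" using q_gt_1 by (simp add: powr_inj)
  qed
  have "infinite ?I" using infinite_Ioi[of "max \<sigma> \<sigma>'"] by (simp add: greaterThan_def)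
  then have "infinite ((\<lambda>x. Xs (of_real x)) ` ?I)" using inj by (simp add: finite_image_iff)
  moreover have "(\<lambda>x. Xs (of_real x)) ` ?I \<subseteq> {X. poly (P * Q' - P' * Q) X = 0}" using zero by blast
  ultimately have "infinite {X. poly (P * Q' - P' * Q) X = 0}" using infinite_super by blast
  then have "P * Q' - P' * Q = 0" using poly_roots_finite by blast
  then show ?thesis by simp
qed

text \<open>A fraction in lowest terms that equals \<open>1 / Q\<close> has a constant numerator, so the selected
  representation has the same zeros in its denominator as \<open>Q\<close>, and both sides are \<open>0\<close> there.\<close>

lemma Zeta_value:
  "Zeta E mF mH s (whittaker \<pi> l v) (Phi E (int N)) = 1 / (1 - denom_coeff1 * Xs s - denom_coeff2 * Xs s ^ 2)"
proof -
  let ?R = "zeta_ratfun E mF mH (whittaker \<pi> l v) (Phi E (int N))"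
  let ?Q = "[:1, - denom_coeff1, - denom_coeff2:]"
  define p where "p = (SOME (P, Q). coprime P Q \<and> ?R P Q)"
  have "case p of (P, Q) \<Rightarrow> coprime P Q \<and> ?R P Q"
    unfolding p_def by (rule someI[of _ "(1, ?Q)"]) (simp add: zeta_ratfun_Q)
  then obtain P Q where PQ: "p = (P, Q)" "coprime P Q" "?R P Q" by (cases p) auto
  have eq: "P * ?Q = Q" using zeta_ratfun_unique[OF PQ(3) zeta_ratfun_Q] by simp
  then have "P dvd Q" by (metis dvd_triv_left)
  then have "is_unit P" using PQ(2) by (metis coprime_absorb_left)
  then obtain c where c: "P = [:c:]" "c \<noteq> 0" by (auto simp: is_unit_poly_iff dvd_field_iff)
  have "Zeta E mF mH s (whittaker \<pi> l v) (Phi E (int N)) = poly P (Xs s) / poly Q (Xs s)"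
    unfolding Zeta_def p_def[symmetric] PQ(1) q_eq[symmetric] by (simp add: Let_def)
  also have "\<dots> = poly P (Xs s) / (poly P (Xs s) * poly ?Q (Xs s))"
    by (subst eq[symmetric]) (simp only: poly_mult)
  also have "\<dots> = 1 / poly ?Q (Xs s)" using c by simp
  also have "poly ?Q (Xs s) = 1 - denom_coeff1 * Xs s - denom_coeff2 * Xs s ^ 2"
    by (simp add: algebra_simps power2_eq_square)
  finally show ?thesis .
qed

end

theorem theorem5p10:
  fixes E :: "('f::nonarch_local_field, 'e::nonarch_local_field) quad_ext"
    and sc :: "complex \<Rightarrow> 'v::ab_group_add \<Rightarrow> 'v"
    and \<pi> :: "'e^3^3 \<Rightarrow> 'v \<Rightarrow> 'v"
    and \<psi> :: "'e \<Rightarrow> complex"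
    and l :: "'v \<Rightarrow> complex"
    and v :: 'v
    and \<nu> lam :: complex
    and mF :: "'f measure"
    and mH :: "('e^3^3) set measure"
    and q N :: nat
  assumes "odd (residual_char TYPE('f))"
    and "unramified_quadratic E"
    and "q = residue_card TYPE('f)"
    and "haar_units mF"
    and "haar_quotient E N mH"
    and "additive_character \<psi>" and "\<exists>x. \<psi> x \<noteq> 1"
    and "has_conductor E \<psi> ring_of_integers"
    and "smooth_rep E sc \<pi>" and "irreducible_rep E sc \<pi>" and "generic_rep E sc \<pi> \<psi>"
    and "l \<in> Hom_U E sc \<pi> \<psi>" and "l \<noteq> (\<lambda>_. 0)"
    and "N = rep_conductor E \<pi>" and "N > 0"
    and "\<forall>w \<in> Vfix E \<pi> (N + 1). hecke_T E \<pi> (N + 1) w = sc \<nu> w"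
    and "\<forall>w \<in> Vfix E \<pi> N. delta E \<pi> N (theta' E \<pi> N w) = sc lam w"
    and "v \<in> Vfix E \<pi> N" and "whittaker \<pi> l v (mat 1) = 1"
  shows "(\<exists>\<sigma>::real. \<forall>s. Re s > \<sigma> \<longrightarrow>
            zeta_converges E mF mH s (whittaker \<pi> l v) (Phi E (int N))) \<and>
         (\<forall>s. Zeta E mF mH s (whittaker \<pi> l v) (Phi E (int N)) =
            1 / (1 - (\<nu> + of_nat q ^ 2 - of_nat q ^ 3) * of_nat q powi (- 2) * of_nat q powr (- 2 * s)
                   - (\<nu> + of_nat q ^ 2 - lam) * of_nat q powi (- 1) * of_nat q powr (- 4 * s)))"
proof -
  interpret newform_zeta E q sc \<pi> \<psi> l v N \<nu> lam mF mH
    by unfold_locales (use assms in auto)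
  obtain \<sigma> :: real where "\<And>s. Re s > \<sigma> \<Longrightarrow> Re s > 0 \<and> cmod (Xs s) * growth_rate < 1"
    using zeta_region by blast
  then have "\<exists>\<sigma>::real. \<forall>s. Re s > \<sigma> \<longrightarrow> zeta_converges E mF mH s (whittaker \<pi> l v) (Phi E (int N))"
    using zeta_value(1) by blast
  moreover have "of_nat q powr (- 4 * s) = Xs s ^ 2" for s :: complex
    by (simp add: power2_eq_square flip: powr_add)
  ultimately show ?thesis
    using Zeta_value unfolding denom_coeff1_def denom_coeff2_def by simp
qed

end
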